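(* Let $n=3$, let $\lambda_1,\lambda_2\in\mathbb{R}$ with $\lambda_1\lambda_2>0$, and let $u$ be a solution of the cubic-quintic nonlinear Schrödinger equation $$iu_t+\Delta u=\lambda_1|u|^2u-\lambda_2|u|^4u,\qquad (t,x)\in\mathbb{R}\times\mathbb{R}^3,$$ with $P[u]=0$. Then $u$ cannot be a breather in any of the following cases: (1) $\lambda_1<0$ and $E_1[u]>\dfrac{3\lambda_1^2}{128|\lambda_2|}M[u]$; (2) $\lambda_1>0$, $E_1[u]<0$ and $\widetilde P[u](0)>0$.
   Context: The mass, momentum, energy and weighted momentum are $$M[u]=\|u\|_{L^2}^2,\qquad P[u]=\mathrm{Im}\int_{\mathbb{R}^3}\bar u\,\nabla_xu\,dx,\qquad E_1[u]=\int_{\mathbb{R}^3}\Big(|\nabla_xu|^2+\tfrac{\lambda_1}{2}|u|^4-\tfrac{\lambda_2}{3}|u|^6\Big)dx,$$ $$\widetilde P[u](t)=\mathrm{Im}\int_{\mathbb{R}^3}\bar u\;x\cdot\nabla_xu\,dx .$$ Breather (in the weak sense, which includes standing waves): a solution $u:\mathbb{R}\times\mathbb{R}^3\to\mathbb{C}$ for which there exist $\tau,C,\gamma>0$ and $\alpha^*\ge0$ such that: (i) $u(t+\tau,x)=u(t,x)$ for all $(t,x)\in\mathbb{R}\times\mathbb{R}^3$; (ii) $u(t,\cdot)\in C^\infty(\mathbb{R}^3)\cap H^1(\mathbb{R}^3)$ for all $t\in\mathbb{R}$; (iii) $\sup_{t\in\mathbb{R}}|D_x^\alpha u(t,x)|\le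 Ce^{-\gamma|x|}$ for all $x\in\mathbb{R}^3$ and all multi-indices $|\alpha|\le\alpha^*$. *)

theory Defs
  imports "HOL-Analysis.Analysis"
begin

section \<open>Calculus for complex-valued functions on three-dimensional space\<close>

definition pdiff :: "3 \<Rightarrow> (real^3 \<Rightarrow> complex) \<Rightarrow> real^3 \<Rightarrow> complex" where
  "pdiff j f x = frechet_derivative f (at x) (axis j 1)"

definition laplacian :: "(real^3 \<Rightarrow> complex) \<Rightarrow> real^3 \<Rightarrow> complex" where
  "laplacian f x = (\<Sum>j\<in>UNIV. pdiff j (pdiff j f) x)"

primrec Ck :: "nat \<Rightarrow> (real^3 \<Rightarrow> complex) \<Rightarrow> bool" where
  "Ck 0 f \<longleftrightarrow> continuous_on UNIV f"
| "Ck (Suc k) f \<longleftrightarrow> (\<forall>x. f differentiable (at x)) \<and> (\<forall>j. Ck k (pdiff j f))"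

definition smooth :: "(real^3 \<Rightarrow> complex) \<Rightarrow> bool" where
  "smooth f \<longleftrightarrow> (\<forall>k. Ck k f)"

definition multi_order :: "nat^3 \<Rightarrow> nat" where
  "multi_order \<alpha> = (\<Sum>j\<in>UNIV. \<alpha> $ j)"

definition multi_deriv :: "nat^3 \<Rightarrow> (real^3 \<Rightarrow> complex) \<Rightarrow> real^3 \<Rightarrow> complex" where
  "multi_deriv \<alpha> f = (pdiff 1 ^^ (\<alpha> $ 1)) ((pdiff 2 ^^ (\<alpha> $ 2)) ((pdiff 3 ^^ (\<alpha> $ 3)) f))"

section \<open>The Sobolev space \<open>H\<^sup>1\<close>\<close>

definition test_function :: "(real^3 \<Rightarrow> complex) \<Rightarrow> bool" where
  "test_function \<phi> \<longleftrightarrow> smooth \<phi> \<and> compact (closure {x. \<phi> x \<noteq> 0})"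

definition square_integrable :: "(real^3 \<Rightarrow> complex) \<Rightarrow> bool" where
  "square_integrable f \<longleftrightarrow>
     f \<in> borel_measurable lborel \<and> integrable lborel (\<lambda>x. (cmod (f x))\<^sup>2)"

definition weak_pdiff :: "3 \<Rightarrow> (real^3 \<Rightarrow> complex) \<Rightarrow> (real^3 \<Rightarrow> complex) \<Rightarrow> bool" where
  "weak_pdiff j f g \<longleftrightarrow>
     (\<forall>\<phi>. test_function \<phi> \<longrightarrow>
        (LINT x|lborel. f x * pdiff j \<phi> x) = - (LINT x|lborel. g x * \<phi> x))"

definition H1 :: "(real^3 \<Rightarrow> complex) set" where
  "H1 = {f. square_integrable f \<and> (\<forall>j. \<exists>g. square_integrable g \<and> weak_pdiff j f g)}"

section \<open>The functionals\<close>

text \<open>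
  These act on a single time slice, with the classical gradient.  Mass, momentum and energy are
  conserved, so for a solution \<open>u\<close> they are evaluated at the initial slice \<open>u 0\<close>.
\<close>

definition mass :: "(real^3 \<Rightarrow> complex) \<Rightarrow> real" where
  "mass v = (LINT x|lborel. (cmod (v x))\<^sup>2)"

definition momentum :: "(real^3 \<Rightarrow> complex) \<Rightarrow> real^3" where
  "momentum v = (\<chi> j. Im (LINT x|lborel. cnj (v x) * pdiff j v x))"

definition energy1 :: "real \<Rightarrow> real \<Rightarrow> (real^3 \<Rightarrow> complex) \<Rightarrow> real" where
  "energy1 lam1 lam2 v = (LINT x|lborel.
     (\<Sum>j\<in>UNIV. (cmod (pdiff j v x))\<^sup>2)
     + lam1 / 2 * cmod (v x) ^ 4 - lam2 / 3 * cmod (v x) ^ 6)"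

definition weighted_momentum :: "(real^3 \<Rightarrow> complex) \<Rightarrow> real" where
  "weighted_momentum v =
     Im (LINT x|lborel. cnj (v x) * (\<Sum>j\<in>UNIV. of_real (x $ j) * pdiff j v x))"

section \<open>Solutions and breathers\<close>

text \<open>
  Solutions are classical: the equation holds at every point of space-time, each time slice
  is twice continuously differentiable, and the time derivative is jointly continuous.
\<close>

definition nls_solution :: "real \<Rightarrow> real \<Rightarrow> (real \<Rightarrow> real^3 \<Rightarrow> complex) \<Rightarrow> bool" where
  "nls_solution lam1 lam2 u \<longleftrightarrow>
     (\<forall>t. Ck 2 (u t)) \<and>
     (\<exists>u\<^sub>t. continuous_on UNIV (\<lambda>(t, x). u\<^sub>t t x) \<and>
        (\<forall>t x. ((\<lambda>s. u s x) has_vector_derivative u\<^sub>t t x) (at t) \<and>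
           \<i> * u\<^sub>t t x + laplacian (u t) x =
             of_real (lam1 * (cmod (u t x))\<^sup>2) * u t x - of_real (lam2 * cmod (u t x) ^ 4) * u t x))"

text \<open>
  The bound on the supremum over time is written out as a bound at every time, because the
  supremum of an unbounded set of reals has an unspecified value.
\<close>

definition breather :: "real \<Rightarrow> real \<Rightarrow> (real \<Rightarrow> real^3 \<Rightarrow> complex) \<Rightarrow> bool" where
  "breather lam1 lam2 u \<longleftrightarrow> nls_solution lam1 lam2 u \<and>
     (\<exists>\<tau> C \<gamma> :: real. \<exists>\<alpha>' :: nat. \<tau> > 0 \<and> C > 0 \<and> \<gamma> > 0 \<and>
        (\<forall>t x. u (t + \<tau>) x = u t x) \<and>
        (\<forall>t. smooth (u t) \<and> u t \<in> H1) \<and>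
        (\<forall>x \<alpha>. multi_order \<alpha> \<le> \<alpha>' \<longrightarrow>
           (\<forall>t. cmod (multi_deriv \<alpha> (u t) x) \<le> C * exp (- \<gamma> * norm x))))"

end

theory Submission imports Defs begin

text \<open>
  Let \<open>u\<close> have period \<open>\<tau>\<close>, and write \<open>Q\<close> and \<open>V\<close> for the space integrals of \<open>\<lambda>\<^sub>1 |u|\<^sup>4 - \<lambda>\<^sub>2 |u|\<^sup>6\<close>
  and \<open>\<lambda>\<^sub>1/2 |u|\<^sup>4 - 2\<lambda>\<^sub>2/3 |u|\<^sup>6\<close>, so that \<open>Q - V\<close> is the potential energy.  Averaging the virial
  identity for \<open>Im \<integral> u\<^sup>* x \<cdot> \<nabla>u\<close> over a period formally gives \<open>2 \<tau> E + \<integral>\<^sub>0\<^sup>\<tau> (5 V - 2 Q) dt = 0\<close>.  Decay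
  is only known for \<open>u\<close> itself, so derivatives of \<open>u\<close> are avoided: \<open>u\<close> is paired with its dilates
  \<open>u\<^sub>s(t,x) = u(s\<^sup>2 t, s x)\<close>.  In the time derivative of \<open>\<integral> a\<^sup>* b dx\<close> the Laplacians of two solutions
  cancel, which doubling of variables makes rigorous without any gradient bound.  The integrand left
  is exact up to \<open>|u\<^sub>s - u|\<^sup>3\<close>, and a Gronwall estimate gives \<open>\<parallel>u\<^sub>s - u\<parallel>\<^sup>2 = O(s - 1)\<close> in \<open>L\<^sup>2\<close>.  By
  periodicity the boundary terms over one period reduce to \<open>\<integral> u(0,x)\<^sup>* (u(h,s x) - u(0,s x)) dx\<close>
  with \<open>h = (s\<^sup>2 - 1) \<tau>\<close>, whose derivative at \<open>s = 1\<close> produces the energy.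

  If \<open>\<lambda>\<^sub>1 < 0\<close>, completing a square bounds \<open>5 V - 2 Q\<close> below by a multiple of the conserved mass.  If
  \<open>\<lambda>\<^sub>1 > 0\<close>, then \<open>5 V - 2 Q \<le> 4 (Q - V) \<le> 4 E\<close>, so the identity forces \<open>6 \<tau> E \<ge> 0\<close>.
\<close>

section \<open>Integration of exponentially decaying functions\<close>

text \<open>With \<open>\<alpha>' = 0\<close> nothing is known about the decay of derivatives, and
  no pairing with \<open>x \<cdot> \<nabla>u\<close> is known to converge. Its substitute is
  \<open>u\<^sub>s - u\<close>: formally, the derivative of \<open>u\<^sub>s\<close> at
  \<open>s = 1\<close> is \<open>x \<cdot> \<nabla>u + 2 t u\<^sub>t\<close>. Between the ends of a
  period the first part cancels and the second leaves \<open>2 \<tau>\<close> times the pairing of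
  \<open>u\<close> with \<open>u\<^sub>t\<close>; this is how the kinetic energy enters, of which
  the time integrand is free. Without weighted gradient bounds the \<open>L^2\<close> norm of
  \<open>u\<^sub>s - u\<close> is only known to be of order \<open>(s - 1)^(1/2)\<close>. A cubic
  remainder tolerates this: one factor is uniformly small, the other two give \<open>s - 1\<close>.
  Unweighted gradients suffice: at time 0 they are square integrable because the energy is nonzero,
  and differences with translates carry this forward. Energy conservation is not assumed; it comes
  out of the identity itself, started at different times. The threshold
  \<open>3 \<lambda>\<^sub>1\<^sup>2 / (128 |\<lambda>\<^sub>2|)\<close> is the least constant for
  which the square completes.\<close>

lemma nn_integral_exp_abs_finite:
  fixes c :: real
  assumes "c > 0"
  shows "(\<integral>\<^sup>+x. ennreal (exp (- c * \<bar>x\<bar>)) \<partial>lborel) < \<infinity>"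
proof -
  have half: "(\<integral>\<^sup>+x. ennreal (exp (- c * x)) * indicator {0..} x \<partial>lborel) = ennreal (0 - (- exp (- c * 0) / c))"
  proof (rule nn_integral_FTC_atLeast)
    show "((\<lambda>x. - exp (- c * x) / c) \<longlongrightarrow> 0) at_top"
    proof -
      have "filterlim (\<lambda>x. - c * x) at_bot at_top"
        using assms by (simp add: filterlim_tendsto_pos_mult_at_top[OF tendsto_const _ filterlim_ident]
            filterlim_uminus_at_bot)
      then have "((\<lambda>x. exp (- c * x)) \<longlongrightarrow> 0) at_top"
        using filterlim_compose[OF exp_at_bot] by blast
      from tendsto_divide[OF tendsto_minus[OF this] tendsto_const, of c] assms show ?thesis by simp
    qed
  qed (use assms in \<open>auto intro!: derivative_eq_intros\<close>)
  have other: "(\<integral>\<^sup>+x. ennreal (exp (c * x)) * indicator {..0} x \<partial>lborel) =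
      (\<integral>\<^sup>+x. ennreal (exp (- c * x)) * indicator {0..} x \<partial>lborel)"
    by (subst nn_integral_real_affine[where c="-1" and t=0]) (auto simp: indicator_def intro!: nn_integral_cong)
  have "(\<integral>\<^sup>+x. ennreal (exp (- c * \<bar>x\<bar>)) \<partial>lborel)
     \<le> (\<integral>\<^sup>+x. ennreal (exp (- c * x)) * indicator {0..} x + ennreal (exp (c * x)) * indicator {..0} x \<partial>lborel)"
    by (intro nn_integral_mono) (auto simp: indicator_def split: if_splits)
  also have "\<dots> = ennreal (0 - (- exp (- c * 0) / c)) + ennreal (0 - (- exp (- c * 0) / c))"
    unfolding half[symmetric] by (subst nn_integral_add) (auto simp only: other, auto)
  also have "\<dots> < \<infinity>" by simp
  finally show ?thesis .
qed

lemma integrable_exp_norm: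
  fixes c :: real
  assumes "c > 0"
  shows "integrable lborel (\<lambda>x::'a::euclidean_space. exp (- c * norm x))"
proof (rule integrableI_nonneg)
  \<comment> \<open>Each \<open>\<bar>x \<bullet> b\<bar>\<close> is at most \<open>norm x\<close>;
    averaging over the basis bounds the exponential by a product of one-variable exponentials, whose
    integral factorises.\<close>
  define d where "d = c / DIM('a)"
  have d: "d > 0" using assms by (simp add: d_def)
  have le: "exp (- c * norm x) \<le> (\<Prod>b\<in>Basis. exp (- d * \<bar>x \<bullet> b\<bar>))" for x :: 'a
  proof -
    have "(\<Sum>b\<in>(Basis::'a set). d * \<bar>x \<bullet> b\<bar>) \<le> (\<Sum>b\<in>(Basis::'a set). d * norm x)"
      using d by (intro sum_mono mult_left_mono) (auto simp: Basis_le_norm)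
    also have "\<dots> = c * norm x" by (simp add: d_def)
    finally show ?thesis by (simp add: exp_sum[symmetric] sum_negf)
  qed
  have "(\<integral>\<^sup>+x. ennreal (exp (- c * norm (x::'a))) \<partial>lborel)
      \<le> (\<integral>\<^sup>+x. (\<Prod>b\<in>Basis. ennreal (exp (- d * \<bar>(x::'a) \<bullet> b\<bar>))) \<partial>lborel)"
  proof (rule nn_integral_mono)
    fix x :: 'a
    have "ennreal (exp (- c * norm x)) \<le> ennreal (\<Prod>b\<in>Basis. exp (- d * \<bar>x \<bullet> b\<bar>))"
      using le by (rule ennreal_leI)
    also have "\<dots> = (\<Prod>b\<in>Basis. ennreal (exp (- d * \<bar>x \<bullet> b\<bar>)))"
      by (rule prod_ennreal[symmetric]) simp
    finally show "ennreal (exp (- c * norm x)) \<le> (\<Prod>b\<in>Basis. ennreal (exp (- d * \<bar>x \<bullet> b\<bar>)))" .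
  qed
  also have "\<dots> = (\<Prod>b\<in>(Basis::'a set). (\<integral>\<^sup>+x. ennreal (exp (- d * \<bar>x\<bar>)) \<partial>lborel))"
    by (rule nn_integral_lborel_prod[where f="\<lambda>b x. ennreal (exp (- d * \<bar>x\<bar>))"]) auto
  also have "\<dots> < \<infinity>"
    using nn_integral_exp_abs_finite[OF d] by (simp add: power_less_top_ennreal)
  finally show "(\<integral>\<^sup>+x. ennreal (exp (- c * norm (x::'a))) \<partial>lborel) < \<infinity>" .
qed auto

lemma integral_translate:
  fixes f :: "'a::euclidean_space \<Rightarrow> 'b::{banach,second_countable_topology}"
  assumes [measurable]: "f \<in> borel_measurable borel"
  shows "(LINT x|lborel. f (c + x)) = (LINT x|lborel. f x)"
  using integral_distr[of "(+) c" lborel borel f] by (simp add: lborel_distr_plus)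

lemma integrable_translate:
  fixes f :: "'a::euclidean_space \<Rightarrow> 'b::{banach,second_countable_topology}"
  assumes [measurable]: "f \<in> borel_measurable borel"
  shows "integrable lborel (\<lambda>x. f (c + x)) \<longleftrightarrow> integrable lborel f"
  using integrable_distr_eq[of "(+) c" lborel borel f] by (simp add: lborel_distr_plus)

lemma integral_scale:
  fixes f :: "'a::euclidean_space \<Rightarrow> 'b::{banach,second_countable_topology}"
  assumes [measurable]: "f \<in> borel_measurable borel" and "c > 0"
  shows "(LINT x|lborel. f (c *\<^sub>R x)) = (1 / c ^ DIM('a)) *\<^sub>R (LINT x|lborel. f x)"
proof -
  have "(LINT x|lborel. f x) = (LINT x|density (distr lborel borel (\<lambda>x. 0 + c *\<^sub>R x)) (\<lambda>_. ennreal (\<bar>c\<bar>^DIM('a))). f x)"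
    by (subst lborel_affine[of c 0]) (use assms(2) in \<open>auto simp: ennreal_power\<close>)
  also have "\<dots> = (c ^ DIM('a)) *\<^sub>R (LINT x|lborel. f (c *\<^sub>R x))"
    using assms(2) by (simp add: integral_density integral_distr)
  finally show ?thesis using assms(2) by simp
qed

lemma nn_integral_translate:
  fixes f :: "'a::euclidean_space \<Rightarrow> ennreal"
  assumes [measurable]: "f \<in> borel_measurable borel"
  shows "(\<integral>\<^sup>+x. f (c + x) \<partial>lborel) = (\<integral>\<^sup>+x. f x \<partial>lborel)"
  using nn_integral_distr[of "(+) c" lborel borel f] by (simp add: lborel_distr_plus)

lemma nn_integral_scale_le:
  fixes f :: "'a::euclidean_space \<Rightarrow> ennreal"
  assumes [measurable]: "f \<in> borel_measurable borel" and "c \<ge> 1"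
  shows "(\<integral>\<^sup>+x. f (c *\<^sub>R x) \<partial>lborel) \<le> (\<integral>\<^sup>+x. f x \<partial>lborel)"
proof -
  have "(\<integral>\<^sup>+x. f x \<partial>lborel) = (\<integral>\<^sup>+x. f x \<partial>density (distr lborel borel (\<lambda>x. 0 + c *\<^sub>R x)) (\<lambda>_. ennreal (\<bar>c\<bar>^DIM('a))))"
    by (subst lborel_affine[of c 0]) (use assms(2) in \<open>auto simp: ennreal_power\<close>)
  also have "\<dots> = ennreal (c ^ DIM('a)) * (\<integral>\<^sup>+x. f (c *\<^sub>R x) \<partial>lborel)"
    using assms(2) by (simp add: nn_integral_density nn_integral_distr nn_integral_cmult)
  also have "\<dots> \<ge> 1 * (\<integral>\<^sup>+x. f (c *\<^sub>R x) \<partial>lborel)"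
    using assms(2) by (intro mult_right_mono) (auto simp: one_le_power)
  finally show ?thesis by simp
qed

text \<open>Dominated convergence for a continuous parameter. Limits at a point of a first countable
  space can be tested on sequences, and a bound that holds only near \<open>t0\<close> holds along a
  sequence from some index on; the earlier terms are removed by a shift.\<close>

lemma tendsto_integral_at:
  fixes f :: "'t::first_countable_topology \<Rightarrow> 'a::euclidean_space \<Rightarrow> 'b::{banach,second_countable_topology}"
  assumes "\<And>x. ((\<lambda>t. f t x) \<longlongrightarrow> g x) (at t0 within S)"
    and ev: "eventually (\<lambda>t. f t \<in> borel_measurable borel \<and> (\<forall>x. norm (f t x) \<le> w x)) (at t0 within S)"
    and "g \<in> borel_measurable borel" "integrable lborel w"
  shows "((\<lambda>t. LINT x|lborel. f t x) \<longlongrightarrow> (LINT x|lborel. g x)) (at t0 within S)"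
  unfolding tendsto_at_iff_sequentially
proof (intro allI impI)
  fix X :: "nat \<Rightarrow> 't" assume "\<forall>i. X i \<in> S - {t0}" "X \<longlonglongrightarrow> t0"
  then have X: "filterlim X (at t0 within S) sequentially"
    by (auto simp: filterlim_at)
  from eventually_compose_filterlim[OF ev X] obtain N
    where N: "\<And>n. n \<ge> N \<Longrightarrow> f (X n) \<in> borel_measurable borel \<and> (\<forall>x. norm (f (X n) x) \<le> w x)"
    by (auto simp: eventually_sequentially)
  have "(\<lambda>n. LINT x|lborel. f (X (n + N)) x) \<longlonglongrightarrow> (LINT x|lborel. g x)"
  proof (rule integral_dominated_convergence[where w=w])
    show "AE x in lborel. (\<lambda>n. f (X (n + N)) x) \<longlonglongrightarrow> g x"
      using assms(1) X by (auto intro!: AE_I2 LIMSEQ_ignore_initial_segment filterlim_compose[OF assms(1) X])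
  qed (use N assms in auto)
  then show "((\<lambda>t. LINT x|lborel. f t x) \<circ> X) \<longlonglongrightarrow> (LINT x|lborel. g x)"
    by (auto simp: o_def dest: LIMSEQ_offset)
qed

text \<open>The constants do not depend on time, so a single integrable majorant serves all times,
  and joint continuity makes space integrals continuous in time. The class is closed under sums,
  products, translations and dilations with factor at least 1, and serves real and complex values
  alike.\<close>

definition exp_decay :: "(real \<Rightarrow> real^3 \<Rightarrow> 'b::real_normed_vector) \<Rightarrow> bool" where
  "exp_decay w \<longleftrightarrow> continuous_on UNIV (\<lambda>(t, x). w t x) \<and>
     (\<exists>C \<gamma>. \<gamma> > 0 \<and> (\<forall>t x. norm (w t x) \<le> C * exp (- \<gamma> * norm x)))"

lemma exp_decayI:
  assumes "continuous_on UNIV (\<lambda>(t, x). w t x)" "\<gamma> > 0" "\<And>t x. norm (w t x) \<le> C * exp (- \<gamma> * norm x)"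
  shows "exp_decay w"
  using assms by (auto simp: exp_decay_def)

lemma exp_decayE:
  assumes "exp_decay w"
  obtains C \<gamma> where "C > 0" "\<gamma> > 0" "\<And>t x. norm (w t x) \<le> C * exp (- \<gamma> * norm x)"
proof -
  from assms obtain C \<gamma> where *: "\<gamma> > 0" "\<And>t x. norm (w t x) \<le> C * exp (- \<gamma> * norm x)"
    by (auto simp: exp_decay_def)
  have "norm (w t x) \<le> (\<bar>C\<bar> + 1) * exp (- \<gamma> * norm x)" for t x
    using *(2)[of t x] by (rule order_trans) (auto intro!: mult_right_mono)
  with * that[of "\<bar>C\<bar> + 1" \<gamma>] show ?thesis by auto
qed

lemma exp_decay_continuous: "exp_decay w \<Longrightarrow> continuous_on UNIV (\<lambda>(t, x). w t x)"
  by (simp add: exp_decay_def)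

lemma exp_decay_bounded:
  assumes "exp_decay w" obtains C where "C > 0" "\<And>t x. norm (w t x) \<le> C"
proof -
  obtain C \<gamma> where *: "C > 0" "\<gamma> > 0" "\<And>t x. norm (w t x) \<le> C * exp (- \<gamma> * norm x)" using exp_decayE[OF assms] by metis
  have "norm (w t x) \<le> C" for t x
    using *(3)[of t x] by (rule order_trans) (use * in \<open>auto intro!: mult_left_le\<close>)
  with * that show ?thesis by blast
qed

lemma joint_continuous_slice:
  assumes "continuous_on UNIV (\<lambda>(t, x). w t x)"
  shows "continuous_on S (w t)" "continuous_on T (\<lambda>t. w t x)"
proof -
  show "continuous_on S (w t)"
    using continuous_on_compose2[OF assms, of S "\<lambda>x. (t, x)"] by (simp add: continuous_on_Pair)
  show "continuous_on T (\<lambda>t. w t x)"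
    using continuous_on_compose2[OF assms, of T "\<lambda>t. (t, x)"] by (simp add: continuous_on_Pair)
qed

lemma exp_decay_slice: "exp_decay w \<Longrightarrow> continuous_on S (w t)" "exp_decay w \<Longrightarrow> continuous_on T (\<lambda>t. w t x)"
  using joint_continuous_slice exp_decay_continuous by blast+

lemma exp_decay_measurable: "exp_decay w \<Longrightarrow> w t \<in> borel_measurable borel"
  by (rule borel_measurable_continuous_onI) (rule exp_decay_slice)

lemma exp_decay_integrable:
  fixes w :: "real \<Rightarrow> real^3 \<Rightarrow> 'b::{banach,second_countable_topology}"
  assumes "exp_decay w" shows "integrable lborel (w t)"
proof -
  obtain C \<gamma> where *: "C > 0" "\<gamma> > 0" "\<And>t x. norm (w t x) \<le> C * exp (- \<gamma> * norm x)" using exp_decayE[OF assms] by metis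
  show ?thesis
    by (rule Bochner_Integration.integrable_bound[OF integrable_mult_right[OF integrable_exp_norm[OF *(2)], of C]])
      (use * exp_decay_measurable[OF assms] in auto)
qed

lemma exp_decay_integral_continuous:
  fixes w :: "real \<Rightarrow> real^3 \<Rightarrow> 'b::{banach,second_countable_topology}"
  assumes "exp_decay w" shows "continuous_on S (\<lambda>t. LINT x|lborel. w t x)"
proof -
  obtain C \<gamma> where *: "C > 0" "\<gamma> > 0" "\<And>t x. norm (w t x) \<le> C * exp (- \<gamma> * norm x)" using exp_decayE[OF assms] by metis
  have "continuous (at t) (\<lambda>t. LINT x|lborel. w t x)" for t
    unfolding continuous_at
  proof (rule tendsto_integral_at[where w="\<lambda>x. C * exp (- \<gamma> * norm x)"])
    show "((\<lambda>t. w t x) \<longlongrightarrow> w t x) (at t)" for x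
      using exp_decay_slice(2)[OF assms, of UNIV x] by (simp add: continuous_on_eq_continuous_at continuous_at)
  qed (use * exp_decay_measurable[OF assms] integrable_exp_norm[OF *(2)] in \<open>auto intro!: always_eventually\<close>)
  then show ?thesis by (auto intro: continuous_at_imp_continuous_on)
qed

lemma exp_decay_integral_bounded:
  fixes w :: "real \<Rightarrow> real^3 \<Rightarrow> 'b::{banach,second_countable_topology}"
  assumes "exp_decay w" obtains C where "C > 0" "\<And>t. norm (LINT x|lborel. w t x) \<le> C" "\<And>t. (LINT x|lborel. norm (w t x)) \<le> C"
proof -
  obtain C \<gamma> where *: "C > 0" "\<gamma> > 0" "\<And>t x. norm (w t x) \<le> C * exp (- \<gamma> * norm x)" using exp_decayE[OF assms] by metis
  let ?I = "LINT x|lborel. C * exp (- \<gamma> * norm (x::real^3))"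
  have "(LINT x|lborel. norm (w t x)) \<le> ?I" for t
    by (rule integral_mono)
      (use * integrable_exp_norm[OF *(2)] exp_decay_integrable[OF assms] in \<open>auto intro!: integrable_norm integrable_mult_right\<close>)
  moreover have "?I \<ge> 0" using * by (intro Bochner_Integration.integral_nonneg) auto
  moreover have "norm (LINT x|lborel. w t x) \<le> (LINT x|lborel. norm (w t x))" for t by (rule integral_norm_bound)
  ultimately show ?thesis using that[of "?I + 1"] by (smt (verit))
qed

lemma exp_decay_dominated:
  assumes "exp_decay w" "continuous_on UNIV (\<lambda>(t, x). v t x)" "\<And>t x. norm (v t x) \<le> K * norm (w t x)"
  shows "exp_decay v"
proof -
  obtain C \<gamma> where *: "C > 0" "\<gamma> > 0" "\<And>t x. norm (w t x) \<le> C * exp (- \<gamma> * norm x)" using exp_decayE[OF assms(1)] by metis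
  have "norm (v t x) \<le> (\<bar>K\<bar> * C) * exp (- \<gamma> * norm x)" for t x
  proof -
    have "norm (v t x) \<le> \<bar>K\<bar> * norm (w t x)"
      using assms(3)[of t x] by (rule order_trans) (auto intro!: mult_right_mono)
    also have "\<dots> \<le> \<bar>K\<bar> * (C * exp (- \<gamma> * norm x))" using * by (intro mult_left_mono) auto
    finally show ?thesis by (simp add: mult.assoc)
  qed
  with * assms(2) show ?thesis by (intro exp_decayI)
qed

lemma exp_decay_add:
  assumes "exp_decay v" "exp_decay w" shows "exp_decay (\<lambda>t x. v t x + w t x)"
proof -
  obtain C c where v: "C > 0" "c > 0" "\<And>t x. norm (v t x) \<le> C * exp (- c * norm x)" using exp_decayE[OF assms(1)] by metis
  obtain D d where w: "D > 0" "d > 0" "\<And>t x. norm (w t x) \<le> D * exp (- d * norm x)" using exp_decayE[OF assms(2)] by metis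
  have m: "min c d * norm x \<le> c * norm x" "min c d * norm x \<le> d * norm x" for x :: "real^3"
    by (auto intro!: mult_right_mono)
  have "norm (v t x + w t x) \<le> (C + D) * exp (- min c d * norm x)" for t x
  proof -
    have "norm (v t x + w t x) \<le> C * exp (- c * norm x) + D * exp (- d * norm x)"
      using v w by (intro norm_triangle_le add_mono)
    also have "\<dots> \<le> C * exp (- min c d * norm x) + D * exp (- min c d * norm x)"
      using v w m[of x] by (intro add_mono mult_left_mono) auto
    finally show ?thesis by (simp add: distrib_right)
  qed
  moreover have "continuous_on UNIV (\<lambda>(t, x). v t x + w t x)"
    using continuous_on_add[OF exp_decay_continuous[OF assms(1)] exp_decay_continuous[OF assms(2)]] by (simp add: split_def)
  ultimately show ?thesis using v w by (intro exp_decayI[where \<gamma>="min c d"]) auto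
qed

lemma exp_decay_mult_bounded:
  fixes w :: "real \<Rightarrow> real^3 \<Rightarrow> 'b::real_normed_algebra"
  assumes "exp_decay w" "continuous_on UNIV (\<lambda>(t, x). v t x)" "\<And>t x. norm (v t x) \<le> K"
  shows "exp_decay (\<lambda>t x. v t x * w t x)"
proof (rule exp_decay_dominated[OF assms(1)])
  show "continuous_on UNIV (\<lambda>(t, x). v t x * w t x)"
    using continuous_on_mult[OF assms(2) exp_decay_continuous[OF assms(1)]] by (simp add: split_def)
  show "norm (v t x * w t x) \<le> K * norm (w t x)" for t x
    using norm_mult_ineq[of "v t x" "w t x"] assms(3)[of t x]
    by (meson mult_right_mono norm_ge_zero order_trans)
qed

lemma exp_decay_mult:
  fixes w :: "real \<Rightarrow> real^3 \<Rightarrow> 'b::real_normed_algebra"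
  assumes "exp_decay v" "exp_decay w" shows "exp_decay (\<lambda>t x. v t x * w t x)"
  using exp_decay_bounded[OF assms(1)] exp_decay_mult_bounded[OF assms(2) exp_decay_continuous[OF assms(1)]] by metis

lemma exp_decay_cmult:
  fixes w :: "real \<Rightarrow> real^3 \<Rightarrow> 'b::real_normed_algebra"
  assumes "exp_decay w" shows "exp_decay (\<lambda>t x. c * w t x)"
  by (rule exp_decay_mult_bounded[OF assms, where K="norm c"]) (auto simp: split_def)

lemma exp_decay_diff:
  fixes w :: "real \<Rightarrow> real^3 \<Rightarrow> 'b::real_normed_algebra_1"
  assumes "exp_decay v" "exp_decay w" shows "exp_decay (\<lambda>t x. v t x - w t x)"
  using exp_decay_add[OF assms(1) exp_decay_cmult[OF assms(2), of "-1"]] by simp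

lemma exp_decay_cnj: "exp_decay w \<Longrightarrow> exp_decay (\<lambda>t x. cnj (w t x))"
  by (rule exp_decay_dominated[where K=1]) (auto simp: split_def intro!: continuous_intros dest: exp_decay_continuous)

lemma exp_decay_Re: "exp_decay w \<Longrightarrow> exp_decay (\<lambda>t x. Re (w t x))"
  by (rule exp_decay_dominated[where K=1]) (auto simp: split_def abs_Re_le_cmod intro!: continuous_intros dest: exp_decay_continuous)

lemma exp_decay_norm: "exp_decay w \<Longrightarrow> exp_decay (\<lambda>t x. norm (w t x))"
  by (rule exp_decay_dominated[where K=1]) (auto simp: split_def intro!: continuous_intros dest: exp_decay_continuous)

lemma exp_decay_of_real: "exp_decay w \<Longrightarrow> exp_decay (\<lambda>t x. complex_of_real (w t x))"
  by (rule exp_decay_dominated[where K=1]) (auto simp: split_def intro!: continuous_intros dest: exp_decay_continuous)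

lemma exp_decay_power: 
  fixes w :: "real \<Rightarrow> real^3 \<Rightarrow> real"
  shows "exp_decay w \<Longrightarrow> n > 0 \<Longrightarrow> exp_decay (\<lambda>t x. w t x ^ n)"
proof (induction n)
  case (Suc n) then show ?case by (cases n) (auto intro: exp_decay_mult)
qed simp

text \<open>Uniformity in time makes every continuous change of the time variable harmless: a
  constant one freezes a factor at a fixed time, multiplication by \<open>s\<^sup>2\<close> gives
  the dilates.\<close>

lemma exp_decay_time: 
  assumes "exp_decay w" "continuous_on UNIV \<theta>" shows "exp_decay (\<lambda>t x. w (\<theta> t) x)"
proof -
  obtain C \<gamma> where *: "C > 0" "\<gamma> > 0" "\<And>t x. norm (w t x) \<le> C * exp (- \<gamma> * norm x)" using exp_decayE[OF assms(1)] by metis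
  have "continuous_on UNIV (\<lambda>p. (\<theta> (fst p), snd p :: real^3))"
    by (intro continuous_on_Pair continuous_on_compose2[OF assms(2)] continuous_intros) auto
  from continuous_on_compose2[OF exp_decay_continuous[OF assms(1)] this]
  have "continuous_on UNIV (\<lambda>(t, x). w (\<theta> t) x)" by (simp add: split_def)
  with * show ?thesis by (intro exp_decayI[where \<gamma>=\<gamma> and C=C]) auto
qed

lemma exp_decay_translate:
  assumes "exp_decay w" shows "exp_decay (\<lambda>t x. w t (c + x))"
proof -
  obtain C \<gamma> where *: "C > 0" "\<gamma> > 0" "\<And>t x. norm (w t x) \<le> C * exp (- \<gamma> * norm x)" using exp_decayE[OF assms(1)] by metis
  have "continuous_on UNIV (\<lambda>(t, x). w t (c + x))"
    using continuous_on_compose2[OF exp_decay_continuous[OF assms(1)], of UNIV "\<lambda>p. (fst p, c + snd p)"]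
    by (simp add: split_def continuous_on_Pair continuous_on_fst continuous_on_snd continuous_on_add continuous_on_scaleR)
  moreover have "norm (w t (c + x)) \<le> (C * exp (\<gamma> * norm c)) * exp (- \<gamma> * norm x)" for t x
  proof -
    have "norm x \<le> norm (c + x) + norm c" by (metis add_diff_cancel_left' norm_triangle_ineq4)
    then have "\<gamma> * norm x \<le> \<gamma> * (norm (c + x) + norm c)" using * by (intro mult_left_mono) auto
    then have "exp (- \<gamma> * norm (c + x)) \<le> exp (\<gamma> * norm c + - \<gamma> * norm x)"
      by (auto simp: algebra_simps)
    then have "C * exp (- \<gamma> * norm (c + x)) \<le> C * exp (\<gamma> * norm c + - \<gamma> * norm x)"
      using *(1) by (intro mult_left_mono) auto
    with *(3)[of t "c + x"] have "norm (w t (c + x)) \<le> C * exp (\<gamma> * norm c + - \<gamma> * norm x)" by linarith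
    then show ?thesis by (simp only: exp_add mult.assoc)
  qed
  ultimately show ?thesis using * by (intro exp_decayI)
qed

lemma exp_decay_scale:
  assumes "exp_decay w" "c \<ge> 1" shows "exp_decay (\<lambda>t x. w t (c *\<^sub>R x))"
proof -
  obtain C \<gamma> where *: "C > 0" "\<gamma> > 0" "\<And>t x. norm (w t x) \<le> C * exp (- \<gamma> * norm x)" using exp_decayE[OF assms(1)] by metis
  have "continuous_on UNIV (\<lambda>(t, x). w t (c *\<^sub>R x))"
    using continuous_on_compose2[OF exp_decay_continuous[OF assms(1)], of UNIV "\<lambda>p. (fst p, c *\<^sub>R snd p)"]
    by (simp add: split_def continuous_on_Pair continuous_on_fst continuous_on_snd continuous_on_add continuous_on_scaleR)
  moreover have "norm (w t (c *\<^sub>R x)) \<le> C * exp (- \<gamma> * norm x)" for t x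
  proof -
    have "1 * norm x \<le> c * norm x" using assms(2) by (intro mult_right_mono) auto
    then have "\<gamma> * norm x \<le> \<gamma> * norm (c *\<^sub>R x)" using * assms(2) by (intro mult_left_mono) auto
    then have "C * exp (- \<gamma> * norm (c *\<^sub>R x)) \<le> C * exp (- \<gamma> * norm x)" using * by (intro mult_left_mono) auto
    with *(3)[of t "c *\<^sub>R x"] show ?thesis by linarith
  qed
  ultimately show ?thesis using * by (intro exp_decayI)
qed

section \<open>Differentiation of parameter integrals and integration by parts\<close>

text \<open>The quotient form is the one to which \<open>tendsto_integral_at\<close>
  applies.\<close>

lemma has_vector_derivative_iff_quotient:
  fixes f :: "real \<Rightarrow> 'b::real_normed_vector"
  shows "(f has_vector_derivative D) (at t) \<longleftrightarrow> ((\<lambda>h. (f (t + h) - f t) /\<^sub>R h) \<longlongrightarrow> D) (at 0)"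
proof -
  have "((\<lambda>h. norm (f (t + h) - f t - h *\<^sub>R D) / norm h) \<longlongrightarrow> 0) (at 0)
      \<longleftrightarrow> ((\<lambda>h. norm ((f (t + h) - f t) /\<^sub>R h - D)) \<longlongrightarrow> 0) (at 0)"
  proof (rule tendsto_cong)
    have "norm (f (t + h) - f t - h *\<^sub>R D) / norm h = norm ((f (t + h) - f t) /\<^sub>R h - D)" if "h \<noteq> 0" for h
    proof -
      have "(f (t + h) - f t) /\<^sub>R h - D = (f (t + h) - f t - h *\<^sub>R D) /\<^sub>R h"
        using that by (simp add: scaleR_diff_right)
      then show ?thesis by (simp add: divide_inverse mult.commute)
    qed
    then show "\<forall>\<^sub>F h in at 0. norm (f (t + h) - f t - h *\<^sub>R D) / norm h = norm ((f (t + h) - f t) /\<^sub>R h - D)"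
      by (auto simp: eventually_at intro: exI[of _ 1])
  qed
  then show ?thesis
    unfolding has_vector_derivative_def has_derivative_at tendsto_norm_zero_iff
    by (simp add: bounded_linear_scaleR_left LIM_zero_iff)
qed

lemma mean_value_bound:
  fixes f :: "real \<Rightarrow> 'b::real_normed_vector"
  assumes "\<And>s. s \<in> closed_segment a b \<Longrightarrow> (f has_vector_derivative f' s) (at s)"
    and "\<And>s. s \<in> closed_segment a b \<Longrightarrow> norm (f' s) \<le> M"
  shows "norm (f b - f a) \<le> M * \<bar>b - a\<bar>"
proof -
  have "norm (f b - f a) \<le> M * norm (b - a)"
  proof (rule differentiable_bound[where S="closed_segment a b" and f'="\<lambda>s h. h *\<^sub>R f' s"])
    show "(f has_derivative (\<lambda>h. h *\<^sub>R f' s)) (at s within closed_segment a b)" if "s \<in> closed_segment a b" for s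
      using assms(1)[OF that] by (auto simp: has_vector_derivative_def intro: has_derivative_at_withinI)
    show "onorm (\<lambda>h. h *\<^sub>R f' s) \<le> M" if "s \<in> closed_segment a b" for s
      using assms(2)[OF that] by (intro onorm_le) (simp add: mult.commute[of M] mult_left_mono)
  qed auto
  then show ?thesis by simp
qed

lemma norm_quotient_le:
  fixes v :: "'b::real_normed_vector"
  assumes "norm v \<le> M * \<bar>h\<bar>" "h \<noteq> 0" shows "norm (v /\<^sub>R h) \<le> M"
  using assms by (simp add: divide_simps mult.commute)

text \<open>By the mean value inequality the difference quotients inherit the majorant
  \<open>w\<close> of the derivative, which is required only within distance 1 of
  \<open>t0\<close>.\<close>

lemma has_vector_derivative_integral:
  fixes F :: "real \<Rightarrow> 'a::euclidean_space \<Rightarrow> 'b::{banach,second_countable_topology}"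
  assumes d: "\<And>t x. \<bar>t - t0\<bar> \<le> 1 \<Longrightarrow> ((\<lambda>t. F t x) has_vector_derivative F' t x) (at t)"
    and b: "\<And>t x. \<bar>t - t0\<bar> \<le> 1 \<Longrightarrow> norm (F' t x) \<le> w x"
    and i: "\<And>t. integrable lborel (F t)" and m: "F' t0 \<in> borel_measurable borel"
    and w: "integrable lborel w"
  shows "((\<lambda>t. LINT x|lborel. F t x) has_vector_derivative (LINT x|lborel. F' t0 x)) (at t0)"
proof -
  have "((\<lambda>h. LINT x|lborel. (F (t0 + h) x - F t0 x) /\<^sub>R h) \<longlongrightarrow> (LINT x|lborel. F' t0 x)) (at 0)"
  proof (rule tendsto_integral_at[where w=w])
    show "((\<lambda>h. (F (t0 + h) x - F t0 x) /\<^sub>R h) \<longlongrightarrow> F' t0 x) (at 0)" for x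
      using d[of t0 x] by (simp add: has_vector_derivative_iff_quotient)
    have "norm ((F (t0 + h) x - F t0 x) /\<^sub>R h) \<le> w x" if "h \<noteq> 0" "\<bar>h\<bar> < 1" for h x
    proof -
      have cs: "\<bar>s - t0\<bar> \<le> 1" if "s \<in> closed_segment t0 (t0 + h)" for s
        using that \<open>\<bar>h\<bar> < 1\<close> by (auto simp: closed_segment_eq_real_ivl split: if_splits)
      have "norm (F (t0 + h) x - F t0 x) \<le> w x * \<bar>(t0 + h) - t0\<bar>"
        by (rule mean_value_bound[where f'="\<lambda>s. F' s x"]) (use d b cs in auto)
      then show ?thesis using that by (intro norm_quotient_le) auto
    qed
    moreover have "(\<lambda>x. (F (t0 + h) x - F t0 x) /\<^sub>R h) \<in> borel_measurable borel" for h
      using i[of "t0 + h"] i[of t0] by (auto dest!: borel_measurable_integrable)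
    ultimately show "\<forall>\<^sub>F h in at 0. (\<lambda>x. (F (t0 + h) x - F t0 x) /\<^sub>R h) \<in> borel_measurable borel \<and>
        (\<forall>x. norm ((F (t0 + h) x - F t0 x) /\<^sub>R h) \<le> w x)"
      by (auto simp: eventually_at intro!: exI[of _ 1])
  qed (use m w in auto)
  then show ?thesis
    unfolding has_vector_derivative_iff_quotient using i by simp
qed

text \<open>Integration by parts involves derivatives along one axis at a time. The bump is
  therefore differentiated along lines, where one-variable rules apply; \<open>ddir_pdiff\<close>
  supplies the link to \<open>pdiff\<close>.\<close>

definition ddir :: "3 \<Rightarrow> (real^3 \<Rightarrow> 'b::real_normed_vector) \<Rightarrow> (real^3 \<Rightarrow> 'b) \<Rightarrow> bool" where
  "ddir j f f' \<longleftrightarrow> (\<forall>x. ((\<lambda>s. f (x + s *\<^sub>R axis j 1)) has_vector_derivative f' x) (at 0))"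

lemma ddirD:
  assumes "ddir j f f'"
  shows "((\<lambda>s. f (x + s *\<^sub>R axis j 1)) has_vector_derivative f' (x + s *\<^sub>R axis j 1)) (at s)"
proof -
  have "((\<lambda>h. f ((x + s *\<^sub>R axis j 1) + h *\<^sub>R axis j 1)) has_vector_derivative f' (x + s *\<^sub>R axis j 1)) (at 0)"
    using assms by (simp add: ddir_def)
  then show ?thesis by (simp add: has_vector_derivative_iff_quotient algebra_simps)
qed

lemma ddir_pdiff:
  assumes "f differentiable (at x)"
  shows "((\<lambda>s. f (x + s *\<^sub>R axis j 1)) has_vector_derivative pdiff j f x) (at 0)"
proof -
  have "(f has_derivative frechet_derivative f (at x)) (at (x + 0 *\<^sub>R axis j 1))"
    using assms by (simp add: frechet_derivative_works)
  moreover have "((\<lambda>s. x + s *\<^sub>R axis j 1) has_vector_derivative axis j 1) (at (0::real))"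
    by (auto intro!: derivative_eq_intros)
  ultimately have "((f \<circ> (\<lambda>s. x + s *\<^sub>R axis j 1)) has_vector_derivative frechet_derivative f (at x) (axis j 1)) (at 0)"
    by (intro vector_derivative_diff_chain_within) (auto intro: has_derivative_at_withinI)
  then show ?thesis by (simp add: pdiff_def o_def)
qed

lemma ddir_mult:
  fixes f g :: "real^3 \<Rightarrow> 'b::real_normed_algebra"
  assumes "ddir j f f'" "ddir j g g'"
  shows "ddir j (\<lambda>x. f x * g x) (\<lambda>x. f x * g' x + f' x * g x)"
  using assms unfolding ddir_def by (auto intro!: derivative_eq_intros)

lemma ddir_of_real:
  assumes "ddir j f f'"
  shows "ddir j (\<lambda>x. of_real (f x) :: complex) (\<lambda>x. of_real (f' x))"
  using assms unfolding ddir_def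
  by (auto intro!: has_vector_derivative_of_real simp flip: has_real_derivative_iff_has_vector_derivative)

lemma ddir_cnj:
  assumes "ddir j f f'" shows "ddir j (\<lambda>x. cnj (f x)) (\<lambda>x. cnj (f' x))"
  using assms unfolding ddir_def by (auto intro!: has_vector_derivative_cnj)

lemma ddir_affine:
  assumes "ddir j f f'" 
  shows "ddir j (\<lambda>x. f (c *\<^sub>R (x - z))) (\<lambda>x. c *\<^sub>R f' (c *\<^sub>R (x - z)))"
  unfolding ddir_def
proof
  fix x
  have "((\<lambda>s. f (c *\<^sub>R (x - z) + s *\<^sub>R axis j 1)) has_vector_derivative f' (c *\<^sub>R (x - z))) (at (c * 0))"
    using assms by (simp add: ddir_def)
  moreover have "((\<lambda>s. c * s) has_vector_derivative c) (at 0)" by (auto intro!: derivative_eq_intros)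
  ultimately have "(((\<lambda>s. f (c *\<^sub>R (x - z) + s *\<^sub>R axis j 1)) \<circ> (\<lambda>s. c * s)) has_vector_derivative c *\<^sub>R f' (c *\<^sub>R (x - z))) (at 0)"
    by (intro vector_diff_chain_at) auto
  then show "((\<lambda>s. f (c *\<^sub>R (x + s *\<^sub>R axis j 1 - z))) has_vector_derivative c *\<^sub>R f' (c *\<^sub>R (x - z))) (at 0)"
    by (simp add: o_def algebra_simps)
qed

text \<open>The integral of every difference quotient vanishes by translation invariance, and the
  quotients converge dominatedly because the support is bounded. No iterated integrals
  enter.\<close>

lemma integral_ddir_eq_0:
  fixes G :: "real^3 \<Rightarrow> 'b::{banach,second_countable_topology}"
  assumes d: "ddir j G G'" and c: "continuous_on UNIV G" and c': "continuous_on UNIV G'"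
    and R: "\<And>x. norm x \<ge> R \<Longrightarrow> G x = 0"
  shows "(LINT x|lborel. G' x) = 0"
proof -
  \<comment> \<open>Quotients with step below 1 vanish outside radius
    \<open>\<bar>R\<bar> + 1\<close>; on that ball they are controlled by \<open>G'\<close> up to
    radius \<open>\<bar>R\<bar> + 2\<close>.\<close>
  define S where "S = cball (0::real^3) (\<bar>R\<bar> + 1)"
  have "compact (G' ` cball 0 (\<bar>R\<bar> + 2))"
    by (intro compact_continuous_image continuous_on_subset[OF c']) auto
  then obtain M where M: "\<And>x. norm x \<le> \<bar>R\<bar> + 2 \<Longrightarrow> norm (G' x) \<le> M"
    by (auto dest!: compact_imp_bounded simp: bounded_iff dist_norm) (metis mem_cball_0)
  have [measurable]: "G \<in> borel_measurable borel" "G' \<in> borel_measurable borel"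
    using c c' by (auto intro: borel_measurable_continuous_onI)
  have iG: "integrable lborel G"
  proof -
    have "integrable lborel (\<lambda>x. indicator S x *\<^sub>R G x)"
      using borel_integrable_compact[of S G] c by (auto simp: S_def intro: continuous_on_subset)
    moreover have "(\<lambda>x. indicator S x *\<^sub>R G x) = G"
      using R by (auto simp: S_def indicator_def)
    ultimately show ?thesis by simp
  qed
  have "((\<lambda>h. LINT x|lborel. (G (x + h *\<^sub>R axis j 1) - G x) /\<^sub>R h) \<longlongrightarrow> (LINT x|lborel. G' x)) (at 0)"
  proof (rule tendsto_integral_at[where w="\<lambda>x. M * indicator S x"])
    show "((\<lambda>h. (G (x + h *\<^sub>R axis j 1) - G x) /\<^sub>R h) \<longlongrightarrow> G' x) (at 0)" for x
      using d by (simp add: ddir_def has_vector_derivative_iff_quotient)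
    have "norm ((G (x + h *\<^sub>R axis j 1) - G x) /\<^sub>R h) \<le> M * indicator S x" if "h \<noteq> 0" "\<bar>h\<bar> < 1" for h x
    proof (cases "x \<in> S")
      case True
      have "norm (G (x + h *\<^sub>R axis j 1) - G (x + 0 *\<^sub>R axis j 1)) \<le> M * \<bar>h - 0\<bar>"
      proof (rule mean_value_bound[where f'="\<lambda>s. G' (x + s *\<^sub>R axis j 1)"])
        fix s assume "s \<in> closed_segment 0 h"
        then have "\<bar>s\<bar> \<le> 1" using that by (auto simp: closed_segment_eq_real_ivl split: if_splits)
        then have "norm (x + s *\<^sub>R axis j 1) \<le> \<bar>R\<bar> + 2"
          using True norm_triangle_ineq[of x "s *\<^sub>R axis j 1"] by (simp add: S_def)
        then show "norm (G' (x + s *\<^sub>R axis j 1)) \<le> M" by (rule M)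
      qed (rule ddirD[OF d])
      then show ?thesis using that True by (intro norm_quotient_le) auto
    next
      case False
      then have "norm x > \<bar>R\<bar> + 1" by (simp add: S_def)
      moreover have "norm x \<le> norm (x + h *\<^sub>R axis j 1) + norm (h *\<^sub>R (axis j 1 :: real^3))"
        by (metis add_diff_cancel_right' norm_triangle_ineq4)
      ultimately have "norm (x + h *\<^sub>R axis j 1) \<ge> R" "norm x \<ge> R" using that by (auto simp: norm_scaleR)
      then show ?thesis using R False by simp
    qed
    then show "\<forall>\<^sub>F h in at 0. (\<lambda>x. (G (x + h *\<^sub>R axis j 1) - G x) /\<^sub>R h) \<in> borel_measurable borel \<and>
        (\<forall>x. norm ((G (x + h *\<^sub>R axis j 1) - G x) /\<^sub>R h) \<le> M * indicator S x)"
      by (auto simp: eventually_at intro!: exI[of _ 1])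
    show "integrable lborel (\<lambda>x. M * indicator S x)"
      using emeasure_bounded_finite[OF bounded_cball, of "0::real^3" "\<bar>R\<bar> + 1"] by (simp add: S_def)
  qed auto
  moreover have z: "(LINT x|lborel. (G (x + h *\<^sub>R axis j 1) - G x) /\<^sub>R h) = 0" for h
    using integral_translate[of G "h *\<^sub>R axis j 1"] integrable_translate[of G "h *\<^sub>R axis j 1"] iG
    by (simp add: add.commute)
  ultimately have "((\<lambda>h::real. 0) \<longlongrightarrow> (LINT x|lborel. G' x)) (at 0)" by (simp only: z)
  then show ?thesis using LIM_const_eq by metis
qed

section \<open>Weak solutions of inhomogeneous Schroedinger equations\<close>

text \<open>The cube makes the bump twice continuously differentiable, which is all that is needed.\<close>

definition bump :: "real^3 \<Rightarrow> real" where
  "bump x = (max 0 (1 - (norm x)\<^sup>2)) ^ 3"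

definition bump_d :: "3 \<Rightarrow> real^3 \<Rightarrow> real" where
  "bump_d j x = - 6 * x $ j * (max 0 (1 - (norm x)\<^sup>2))\<^sup>2"

definition bump_dd :: "3 \<Rightarrow> real^3 \<Rightarrow> real" where
  "bump_dd j x = - 6 * (max 0 (1 - (norm x)\<^sup>2))\<^sup>2 + 24 * (x $ j)\<^sup>2 * max 0 (1 - (norm x)\<^sup>2)"

definition bump_laplacian :: "real^3 \<Rightarrow> real" where
  "bump_laplacian x = (\<Sum>j\<in>UNIV. bump_dd j x)"

lemma has_real_derivative_max_power:
  "((\<lambda>r. (max 0 r) ^ Suc (Suc n)) has_real_derivative real (Suc (Suc n)) * (max 0 r) ^ Suc n) (at r)"
proof -
  consider "r > 0" | "r < 0" | "r = 0" by linarith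
  then show ?thesis
  proof cases
    case 1
    have "((\<lambda>r. r ^ Suc (Suc n)) has_real_derivative real (Suc (Suc n)) * r ^ Suc n) (at r)"
      using DERIV_pow[of "Suc (Suc n)" r] by (simp del: power_Suc of_nat_Suc)
    then have "((\<lambda>r. (max 0 r) ^ Suc (Suc n)) has_real_derivative real (Suc (Suc n)) * r ^ Suc n) (at r)"
      by (rule DERIV_cong_ev[OF refl _ refl, THEN iffD1, rotated])
        (use 1 in \<open>auto intro!: eventually_mono[OF eventually_nhds_in_open[of "{0<..}"]]\<close>)
    with 1 show ?thesis by simp
  next
    case 2
    have "((\<lambda>r. 0) has_real_derivative 0) (at r)" by simp
    then have "((\<lambda>r. (max 0 r) ^ Suc (Suc n)) has_real_derivative 0) (at r)"
      by (rule DERIV_cong_ev[OF refl _ refl, THEN iffD1, rotated])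
        (use 2 in \<open>auto intro!: eventually_mono[OF eventually_nhds_in_open[of "{..<0}"]]\<close>)
    with 2 show ?thesis by (simp add: max_def)
  next
    case 3
    \<comment> \<open>At the kink the difference quotient of the power \<open>n + 2\<close> is the
      power \<open>n + 1\<close> of the same positive part, which tends to 0.\<close>
    have "((\<lambda>h::real. (max 0 h) ^ Suc n) \<longlongrightarrow> (max 0 0) ^ Suc n) (at 0)"
      by (intro tendsto_intros)
    moreover have "\<forall>\<^sub>F h in at 0. (max 0 h) ^ Suc n = ((max 0 (0 + h)) ^ Suc (Suc n) - (max 0 0) ^ Suc (Suc n)) / (h::real)"
      by (auto simp: eventually_at max_def intro!: exI[of _ 1])
    ultimately have "((\<lambda>r. (max 0 r) ^ Suc (Suc n)) has_real_derivative 0) (at 0)"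
      unfolding DERIV_def by (auto elim: Lim_transform_eventually)
    then show ?thesis using 3 by simp
  qed
qed

lemma has_real_derivative_normsq:
  "((\<lambda>s. 1 - (norm ((x::real^3) + s *\<^sub>R axis j 1))\<^sup>2) has_real_derivative - 2 * x $ j) (at 0)"
proof -
  have "(norm (x + s *\<^sub>R axis j 1))\<^sup>2 = (norm x)\<^sup>2 + 2 * s * x $ j + s\<^sup>2" for s
    unfolding power2_norm_eq_inner by (simp add: algebra_simps inner_axis inner_axis' power2_eq_square inner_commute)
  then show ?thesis by (auto intro!: derivative_eq_intros)
qed

lemma has_real_derivative_max_normsq:
  "((\<lambda>s. (max 0 (1 - (norm ((x::real^3) + s *\<^sub>R axis j 1))\<^sup>2)) ^ Suc (Suc n)) has_real_derivative
     real (Suc (Suc n)) * (max 0 (1 - (norm x)\<^sup>2)) ^ Suc n * (- 2 * x $ j)) (at 0)"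
  using DERIV_chain2[OF has_real_derivative_max_power has_real_derivative_normsq]
  by (simp del: power_Suc)

lemma ddir_bump: "ddir j bump (bump_d j)"
  using has_real_derivative_max_normsq[of _ j 1]
  by (auto simp: ddir_def bump_def bump_d_def numeral_3_eq_3 numeral_2_eq_2 algebra_simps
      simp flip: has_real_derivative_iff_has_vector_derivative simp del: power_Suc)

lemma ddir_bump_d: "ddir j (bump_d j) (bump_dd j)"
proof -
  have "((\<lambda>s. - 6 * (x + s *\<^sub>R axis j 1) $ j * (max 0 (1 - (norm ((x::real^3) + s *\<^sub>R axis j 1))\<^sup>2))\<^sup>2)
    has_real_derivative bump_dd j x) (at 0)" for x
  proof -
    have 1: "((\<lambda>s. (max 0 (1 - (norm ((x::real^3) + s *\<^sub>R axis j 1))\<^sup>2))\<^sup>2)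
      has_real_derivative 2 * max 0 (1 - (norm x)\<^sup>2) * (- 2 * x $ j)) (at 0)"
      using has_real_derivative_max_normsq[of x j 0] by (simp add: numeral_2_eq_2)
    have 2: "((\<lambda>s. - 6 * (x + s *\<^sub>R axis j 1) $ j) has_real_derivative - 6) (at 0)"
      by (auto intro!: derivative_eq_intros simp: axis_def)
    show ?thesis
      by (rule DERIV_cong[OF DERIV_mult[OF 2 1]]) (simp add: bump_dd_def power2_eq_square)
  qed
  then show ?thesis
    by (simp add: ddir_def bump_d_def flip: has_real_derivative_iff_has_vector_derivative)
qed

lemma continuous_bump [continuous_intros]:
  "continuous_on S bump" "continuous_on S (bump_d j)" "continuous_on S (bump_dd j)" "continuous_on S bump_laplacian"
  unfolding bump_def[abs_def] bump_d_def[abs_def] bump_dd_def[abs_def] bump_laplacian_def[abs_def]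
  by (intro continuous_intros)+

lemma bump_eq_0:
  assumes "norm x \<ge> 1" shows "bump x = 0" "bump_d j x = 0" "bump_dd j x = 0" "bump_laplacian x = 0"
proof -
  have "max 0 (1 - (norm x)\<^sup>2) = 0" using assms by simp
  then show "bump x = 0" "bump_d j x = 0" "bump_dd j x = 0" "bump_laplacian x = 0"
    by (simp_all add: bump_def bump_d_def bump_dd_def bump_laplacian_def del: max_absorb1)
qed

lemma bump_minus: "bump (- x) = bump x" "bump_laplacian (- x) = bump_laplacian x"
  by (simp_all add: bump_def bump_laplacian_def bump_dd_def)

lemma bump_bounds: "0 \<le> bump x" "bump x \<le> 1"
  by (auto simp: bump_def intro!: power_le_one)

lemma bump_0: "bump 0 = 1" by (simp add: bump_def)

lemma bounded_of_support:
  fixes f :: "real^3 \<Rightarrow> real"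
  assumes "continuous_on UNIV f" "\<And>x. norm x \<ge> 1 \<Longrightarrow> f x = 0"
  obtains M where "M > 0" "\<And>x. \<bar>f x\<bar> \<le> M"
proof -
  have "compact (f ` cball 0 1)"
    by (intro compact_continuous_image continuous_on_subset[OF assms(1)]) auto
  then obtain M where "\<forall>y\<in>f ` cball 0 1. norm y \<le> M" by (auto dest!: compact_imp_bounded simp: bounded_iff)
  then have "\<bar>f x\<bar> \<le> \<bar>M\<bar> + 1" for x
    using assms(2)[of x] by (cases "norm x \<le> 1") force+
  then show ?thesis using that[of "\<bar>M\<bar> + 1"] by auto
qed

lemma bump_d_bounded: obtains M where "M > 0" "\<And>x. \<bar>bump_d j x\<bar> \<le> M"
  by (rule bounded_of_support[of "bump_d j"]) (auto intro: continuous_intros simp: bump_eq_0)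

lemma bump_laplacian_bounded: obtains M where "M > 0" "\<And>x. \<bar>bump_laplacian x\<bar> \<le> M"
  by (rule bounded_of_support[of bump_laplacian]) (auto intro: continuous_intros simp: bump_eq_0)

lemma integrable_bump: "integrable lborel bump"
proof -
  have "integrable lborel (\<lambda>x. indicator (cball 0 1) x *\<^sub>R bump x)"
    by (rule borel_integrable_compact) (auto intro: continuous_intros)
  moreover have "(\<lambda>x. indicator (cball 0 1) x *\<^sub>R bump x) = bump"
  proof
    show "indicator (cball 0 1) x *\<^sub>R bump x = bump x" for x
      using bump_eq_0(1)[of x] by (cases "x \<in> cball 0 1") auto
  qed
  ultimately show ?thesis by simp
qed

text \<open>The convolution \<open>cv\<close> is not normalised, and
  \<open>weak_schrodinger_pairing\<close> divides by this number. It is positive because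
  \<open>bump\<close> is positive on the open unit ball, a set of positive measure.\<close>

lemma integral_bump_pos: "(LINT x|lborel. bump x) > 0"
proof -
  have "(LINT x|lborel. bump x) \<noteq> 0"
  proof
    assume "(LINT x|lborel. bump x) = 0"
    then have "AE x in lborel. bump x = 0"
      using integral_nonneg_eq_0_iff_AE[OF integrable_bump] bump_bounds by auto
    then have "AE x in lborel. x \<notin> ball (0::real^3) 1"
    proof (rule AE_mp, intro AE_I2 impI)
      fix x :: "real^3" assume "bump x = 0"
      show "x \<notin> ball 0 1"
      proof
        assume "x \<in> ball 0 1"
        then have "(norm x)\<^sup>2 < 1" by (simp add: power_less_one_iff abs_square_less_1)
        with \<open>bump x = 0\<close> show False by (simp add: bump_def)
      qed
    qed
    then have "emeasure lborel (ball (0::real^3) 1) = 0"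
      by (subst (asm) AE_iff_measurable[OF _ refl]) (auto simp: ball_def)
    then show False using content_ball_pos[of 1 "0::real^3"] by (simp add: measure_def)
  qed
  then show ?thesis using Bochner_Integration.integral_nonneg[of lborel bump] bump_bounds by (simp add: less_le)
qed

text \<open>Convolution at scale \<open>\<epsilon>\<close>, without the normalising factor \<open>1 / \<epsilon> ^ 3\<close>.\<close>

definition cv :: "(real^3 \<Rightarrow> real) \<Rightarrow> real \<Rightarrow> (real^3 \<Rightarrow> complex) \<Rightarrow> real^3 \<Rightarrow> complex" where
  "cv \<kappa> \<epsilon> v z = (LINT y|lborel. of_real (\<kappa> ((1 / \<epsilon>) *\<^sub>R (y - z))) * v y)"

text \<open>A distributional form of \<open>i w\<^sub>t + \<Delta>w = g\<close>.  Translates and dilates of one bump are enough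
  test functions, and with this choice the class is visibly stable under translation, parabolic
  dilation and differences.\<close>

definition weak_schrodinger :: "(real \<Rightarrow> real^3 \<Rightarrow> complex) \<Rightarrow> (real \<Rightarrow> real^3 \<Rightarrow> complex) \<Rightarrow> bool" where
  "weak_schrodinger w g \<longleftrightarrow> exp_decay w \<and> exp_decay g \<and>
     (\<forall>\<epsilon>>0. \<forall>z t. ((\<lambda>t. cv bump \<epsilon> (w t) z) has_vector_derivative
        \<i> * (of_real (1 / \<epsilon>\<^sup>2) * cv bump_laplacian \<epsilon> (w t) z - cv bump \<epsilon> (g t) z)) (at t))"

section \<open>Bounds, symmetry and small-scale limit of the convolution\<close>

lemma cv_integrable:
  fixes v :: "real^3 \<Rightarrow> complex"
  assumes "continuous_on UNIV \<kappa>" "\<And>x. \<bar>\<kappa> x\<bar> \<le> M" "integrable lborel v"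
  shows "integrable lborel (\<lambda>y. of_real (\<kappa> ((1 / \<epsilon>) *\<^sub>R (y - z))) * v y)"
proof (rule Bochner_Integration.integrable_bound[OF integrable_mult_right[OF integrable_norm[OF assms(3)], of M]])
  have "continuous_on UNIV (\<lambda>y. \<kappa> ((1 / \<epsilon>) *\<^sub>R (y - z)))"
    by (rule continuous_on_compose2[OF assms(1)]) (auto intro!: continuous_intros)
  then have [measurable]: "(\<lambda>y. \<kappa> ((1 / \<epsilon>) *\<^sub>R (y - z))) \<in> borel_measurable borel"
    by (rule borel_measurable_continuous_onI)
  show "(\<lambda>y. of_real (\<kappa> ((1 / \<epsilon>) *\<^sub>R (y - z))) * v y) \<in> borel_measurable lborel"
    using assms(3) by measurable
  have "M \<ge> 0" using assms(2)[of 0] by linarith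
  show "AE y in lborel. norm (of_real (\<kappa> ((1 / \<epsilon>) *\<^sub>R (y - z))) * v y) \<le> norm (M * norm (v y))"
    using assms(2) \<open>M \<ge> 0\<close> by (intro AE_I2) (simp add: norm_mult abs_mult mult_right_mono)
qed

lemma cv_bound:
  assumes "continuous_on UNIV \<kappa>" "\<And>x. \<bar>\<kappa> x\<bar> \<le> M" "integrable lborel v"
  shows "norm (cv \<kappa> \<epsilon> v z) \<le> M * (LINT y|lborel. norm (v y))"
proof -
  have "norm (cv \<kappa> \<epsilon> v z) \<le> (LINT y|lborel. norm (of_real (\<kappa> ((1 / \<epsilon>) *\<^sub>R (y - z))) * v y))"
    unfolding cv_def by (rule integral_norm_bound)
  also have "\<dots> \<le> (LINT y|lborel. M * norm (v y))"
    using assms(2) by (intro integral_mono integrable_norm cv_integrable[OF assms] integrable_mult_right assms)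
      (simp add: norm_mult mult_right_mono)
  finally show ?thesis by simp
qed

lemma cv_continuous:
  assumes "continuous_on UNIV \<kappa>" "\<And>x. \<bar>\<kappa> x\<bar> \<le> M" "exp_decay v"
  shows "continuous_on UNIV (\<lambda>(t, z). cv \<kappa> \<epsilon> (v t) z)"
proof -
  obtain C \<gamma> where *: "C > 0" "\<gamma> > 0" "\<And>t x. norm (v t x) \<le> C * exp (- \<gamma> * norm x)" using exp_decayE[OF assms(3)] by metis
  have M: "M \<ge> 0" using assms(2)[of 0] by linarith
  have "continuous (at p) (\<lambda>p. LINT y|lborel. of_real (\<kappa> ((1 / \<epsilon>) *\<^sub>R (y - snd p))) * v (fst p) y)" for p
    unfolding continuous_at
  proof (rule tendsto_integral_at[where w="\<lambda>x. M * (C * exp (- \<gamma> * norm x))"])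
    fix y
    have "continuous_on UNIV (\<lambda>p. of_real (\<kappa> ((1 / \<epsilon>) *\<^sub>R (y - snd p))) * v (fst p) y)"
      by (intro continuous_intros continuous_on_compose2[OF assms(1)]
          continuous_on_compose2[OF exp_decay_slice(2)[OF assms(3)]]) auto
    then show "((\<lambda>p. of_real (\<kappa> ((1 / \<epsilon>) *\<^sub>R (y - snd p))) * v (fst p) y) \<longlongrightarrow>
        of_real (\<kappa> ((1 / \<epsilon>) *\<^sub>R (y - snd p))) * v (fst p) y) (at p)"
      by (cases p) (simp add: continuous_on_eq_continuous_at continuous_at)
  next
    have m: "(\<lambda>y. of_real (\<kappa> ((1 / \<epsilon>) *\<^sub>R (y - snd p))) * v (fst p) y) \<in> borel_measurable borel" for p
      using borel_measurable_integrable[OF cv_integrable[OF assms(1,2) exp_decay_integrable[OF assms(3)]]] by simp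
    have "norm (of_real (\<kappa> ((1 / \<epsilon>) *\<^sub>R (y - snd p))) * v (fst p) y) \<le> M * (C * exp (- \<gamma> * norm y))" for p y
      unfolding norm_mult by (rule mult_mono) (use * M assms(2) in auto)
    with m show "\<forall>\<^sub>F p in at p. (\<lambda>y. of_real (\<kappa> ((1 / \<epsilon>) *\<^sub>R (y - snd p))) * v (fst p) y) \<in> borel_measurable borel \<and>
       (\<forall>y. norm (of_real (\<kappa> ((1 / \<epsilon>) *\<^sub>R (y - snd p))) * v (fst p) y) \<le> M * (C * exp (- \<gamma> * norm y)))"
      by (intro always_eventually) auto
    show "(\<lambda>y. of_real (\<kappa> ((1 / \<epsilon>) *\<^sub>R (y - snd p))) * v (fst p) y) \<in> borel_measurable borel" by (rule m)
    show "integrable lborel (\<lambda>x::real^3. M * (C * exp (- \<gamma> * norm x)))"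
      using integrable_exp_norm[OF *(2), where 'a="real^3"] by simp
  qed
  then show ?thesis by (auto simp: cv_def split_def intro: continuous_at_imp_continuous_on)
qed

lemma cv_bounded_ec:
  assumes "continuous_on UNIV \<kappa>" "\<And>x. \<bar>\<kappa> x\<bar> \<le> M" "exp_decay v"
  obtains C where "\<And>t z. norm (cv \<kappa> \<epsilon> (v t) z) \<le> C"
proof -
  have M: "M \<ge> 0" using assms(2)[of 0] by linarith
  obtain C where C: "\<And>t. (LINT x|lborel. norm (v t x)) \<le> C" using exp_decay_integral_bounded[OF assms(3)] by metis
  have "norm (cv \<kappa> \<epsilon> (v t) z) \<le> M * C" for t z
    using cv_bound[OF assms(1,2) exp_decay_integrable[OF assms(3)], of \<epsilon> t z] mult_left_mono[OF C[of t] M] by linarith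
  then show ?thesis by (rule that)
qed

lemma cv_cnj: "cv \<kappa> \<epsilon> (\<lambda>y. cnj (v y)) z = cnj (cv \<kappa> \<epsilon> v z)"
  unfolding cv_def by (subst Bochner_Integration.integral_cnj[symmetric]) simp

text \<open>Fubini, with the evenness of \<open>\<kappa>\<close> exchanging the roles of
  \<open>y\<close> and \<open>z\<close>. For the kernel \<open>bump_laplacian\<close> it moves the
  Laplacian from one factor to the other, which is what makes two Laplacians cancel later.\<close>

lemma cv_symmetric:
  fixes v b :: "real^3 \<Rightarrow> complex"
  assumes \<kappa>: "continuous_on UNIV \<kappa>" "\<And>x. \<bar>\<kappa> x\<bar> \<le> M" "\<And>x. \<kappa> (- x) = \<kappa> x"
    and v: "integrable lborel v" and b: "integrable lborel b"
  shows "(LINT z|lborel. cv \<kappa> \<epsilon> v z * b z) = (LINT y|lborel. v y * cv \<kappa> \<epsilon> b y)"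
proof -
  define F where "F y z = of_real (\<kappa> ((1 / \<epsilon>) *\<^sub>R (y - z))) * v y * b z" for y z
  have "continuous_on UNIV (\<lambda>p. \<kappa> ((1 / \<epsilon>) *\<^sub>R (fst p - snd p)))"
    by (rule continuous_on_compose2[OF \<kappa>(1)]) (auto intro!: continuous_intros)
  then have [measurable]: "(\<lambda>p. \<kappa> ((1 / \<epsilon>) *\<^sub>R (fst p - snd p))) \<in> borel_measurable (lborel \<Otimes>\<^sub>M lborel)"
    by (simp add: lborel_prod borel_measurable_continuous_onI)
  have [measurable]: "v \<in> borel_measurable lborel" "b \<in> borel_measurable lborel" using v b by auto
  have M: "M \<ge> 0" using \<kappa>(2)[of 0] by linarith
  have bd: "norm (F y z) \<le> M * norm (v y) * norm (b z)" for y z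
    unfolding F_def norm_mult using \<kappa>(2) by (intro mult_right_mono) auto
  have int: "integrable (lborel \<Otimes>\<^sub>M lborel) (case_prod F)"
  proof (rule Bochner_Integration.integrable_bound)
    show "integrable (lborel \<Otimes>\<^sub>M lborel) (\<lambda>(y, z). M * norm (v y) * norm (b z))"
    proof (rule lborel_pair.Fubini_integrable)
      show "(\<lambda>(y, z). M * norm (v y) * norm (b z)) \<in> borel_measurable (lborel \<Otimes>\<^sub>M lborel)" by measurable
      have "integrable lborel (\<lambda>z. M * norm (v y) * norm (b z))" for y
        using integrable_mult_right[OF integrable_norm[OF b], of "M * norm (v y)"] by simp
      then show "AE y in lborel. integrable lborel (\<lambda>z. case (y, z) of (y, z) \<Rightarrow> M * norm (v y) * norm (b z))"
        by simp
      have "integrable lborel (\<lambda>y. M * (LINT z|lborel. norm (b z)) * norm (v y))"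
        using integrable_mult_right[OF integrable_norm[OF v]] by simp
      then show "integrable lborel (\<lambda>y. LINT z|lborel. norm (case (y, z) of (y, z) \<Rightarrow> M * norm (v y) * norm (b z)))"
        using M by (simp add: abs_mult mult_ac)
    qed
    show "case_prod F \<in> borel_measurable (lborel \<Otimes>\<^sub>M lborel)"
      unfolding F_def split_def by measurable
    show "AE p in lborel \<Otimes>\<^sub>M lborel. norm (case_prod F p) \<le> norm (case p of (y, z) \<Rightarrow> M * norm (v y) * norm (b z))"
      using bd M by (auto intro!: AE_I2 simp: abs_mult)
  qed
  have "(LINT z|lborel. cv \<kappa> \<epsilon> v z * b z) = (LINT z|lborel. LINT y|lborel. F y z)"
    unfolding cv_def F_def by simp
  also have "\<dots> = (LINT y|lborel. LINT z|lborel. F y z)"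
    using lborel_pair.Fubini_integral[OF int] .
  also have "\<dots> = (LINT y|lborel. v y * cv \<kappa> \<epsilon> b y)"
  proof (rule Bochner_Integration.integral_cong[OF refl])
    fix y
    have "\<kappa> ((1 / \<epsilon>) *\<^sub>R (y - z)) = \<kappa> ((1 / \<epsilon>) *\<^sub>R (z - y))" for z
      using \<kappa>(3)[of "(1 / \<epsilon>) *\<^sub>R (z - y)"] by (simp add: algebra_simps)
    then have "F y z = v y * (of_real (\<kappa> ((1 / \<epsilon>) *\<^sub>R (z - y))) * b z)" for z by (simp add: F_def)
    then show "(LINT z|lborel. F y z) = v y * cv \<kappa> \<epsilon> b y" by (simp add: cv_def)
  qed
  finally show ?thesis .
qed

text \<open>After the substitution \<open>y = z + w / (n + 1)\<close> the factor
  \<open>(n + 1) ^ 3\<close> is absorbed by the Jacobian. What is left is an average against a fixed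
  weight, with the scale only in the argument of \<open>v\<close>, so bounds and limits can be read
  off.\<close>

lemma cv_bump_rescale:
  fixes v :: "real^3 \<Rightarrow> complex"
  assumes [measurable]: "v \<in> borel_measurable borel"
  shows "of_real (real (Suc n) ^ 3) * cv bump (1 / real (Suc n)) v z =
    (LINT w|lborel. of_real (bump w) * v (z + (1 / real (Suc n)) *\<^sub>R w))"
proof -
  have [measurable]: "bump \<in> borel_measurable borel"
    by (auto intro!: borel_measurable_continuous_onI continuous_intros)
  let ?g = "\<lambda>x. of_real (bump (real (Suc n) *\<^sub>R x)) * v (z + x)"
  have "cv bump (1 / real (Suc n)) v z = (LINT x|lborel. ?g x)"
    unfolding cv_def
    using integral_translate[of "\<lambda>y. of_real (bump ((real (Suc n)) *\<^sub>R (y - z))) * v y" z] by simp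
  moreover have "(LINT w|lborel. of_real (bump w) * v (z + (1 / real (Suc n)) *\<^sub>R w)) = (LINT x|lborel. ?g ((1 / real (Suc n)) *\<^sub>R x))"
    by simp
  moreover have "(LINT x|lborel. ?g ((1 / real (Suc n)) *\<^sub>R x)) = (real (Suc n) ^ 3) *\<^sub>R (LINT x|lborel. ?g x)"
    by (subst integral_scale) (auto simp: power_divide)
  ultimately show ?thesis by (simp only: scaleR_conv_of_real)
qed

lemma cv_bump_bound:
  fixes v :: "real^3 \<Rightarrow> complex"
  assumes [measurable]: "v \<in> borel_measurable borel" and v: "\<And>x. norm (v x) \<le> C"
  shows "norm (of_real (real (Suc n) ^ 3) * cv bump (1 / real (Suc n)) v z) \<le> (LINT w|lborel. bump w) * C"
proof -
  have [measurable]: "bump \<in> borel_measurable borel"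
    by (auto intro!: borel_measurable_continuous_onI continuous_intros)
  have C: "C \<ge> 0" using v[of 0] norm_ge_zero order_trans by blast
  have bdA: "norm (of_real (bump w) * v (z + (1 / real (Suc n)) *\<^sub>R w)) \<le> bump w * C" for w
    unfolding norm_mult using v bump_bounds[of w] by (simp add: mult_left_mono)
  have "norm (LINT w|lborel. of_real (bump w) * v (z + (1 / real (Suc n)) *\<^sub>R w))
      \<le> (LINT w|lborel. norm (of_real (bump w) * v (z + (1 / real (Suc n)) *\<^sub>R w)))"
    by (rule integral_norm_bound)
    also have "\<dots> \<le> (LINT w|lborel. bump w * C)"
    proof (rule integral_mono)
      show "integrable lborel (\<lambda>w. norm (of_real (bump w) * v (z + (1 / real (Suc n)) *\<^sub>R w)))"
        by (rule Bochner_Integration.integrable_bound[of lborel "\<lambda>w. bump w * C"])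
          (use integrable_bump bdA C bump_bounds in \<open>auto intro!: AE_I2 simp: abs_mult\<close>)
    qed (use integrable_bump bdA in auto)
    finally show ?thesis by (simp only: cv_bump_rescale[OF assms(1)] integral_mult_left_zero)
qed

text \<open>An approximate identity, with the integral of \<open>bump\<close> as a leftover factor.
  Two dominated convergences are nested: under the average for fixed \<open>z\<close>, then in
  \<open>z\<close> with a multiple of \<open>norm (b z)\<close> as majorant.\<close>

lemma cv_limit:
  fixes v b :: "real^3 \<Rightarrow> complex"
  assumes v: "continuous_on UNIV v" "\<And>x. norm (v x) \<le> C" "integrable lborel v" and b: "integrable lborel b"
  shows "(\<lambda>n. of_real (real (Suc n) ^ 3) * (LINT z|lborel. cv bump (1 / real (Suc n)) v z * b z))
     \<longlonglongrightarrow> of_real (LINT x|lborel. bump x) * (LINT z|lborel. v z * b z)"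
proof -
  define A where "A n z = (LINT w|lborel. of_real (bump w) * v (z + (1 / real (Suc n)) *\<^sub>R w))" for n z
  have [measurable]: "v \<in> borel_measurable borel" "bump \<in> borel_measurable borel" "b \<in> borel_measurable borel"
    using v b by (auto intro!: borel_measurable_continuous_onI continuous_intros dest: borel_measurable_integrable)
  have A: "of_real (real (Suc n) ^ 3) * cv bump (1 / real (Suc n)) v z = A n z" for n z
    unfolding A_def by (rule cv_bump_rescale) simp
  have C: "C \<ge> 0" using v(2)[of 0] norm_ge_zero order_trans by blast
  have bdA: "norm (of_real (bump w) * v (z + (1 / real (Suc n)) *\<^sub>R w)) \<le> bump w * C" for n z w
    unfolding norm_mult using v(2) bump_bounds[of w] by (simp add: mult_left_mono)
  have Alim: "(\<lambda>n. A n z) \<longlonglongrightarrow> (LINT w|lborel. of_real (bump w) * v z)" for z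
    unfolding A_def
  proof (rule integral_dominated_convergence[where w="\<lambda>w. bump w * C"])
    show "AE w in lborel. (\<lambda>n. of_real (bump w) * v (z + (1 / real (Suc n)) *\<^sub>R w)) \<longlonglongrightarrow> of_real (bump w) * v z"
    proof (intro AE_I2 tendsto_mult tendsto_const)
      fix w
      have "(\<lambda>n. z + (1 / real (Suc n)) *\<^sub>R w) \<longlonglongrightarrow> z + 0 *\<^sub>R w"
        by (intro tendsto_intros LIMSEQ_Suc lim_1_over_n)
      then show "(\<lambda>n. v (z + (1 / real (Suc n)) *\<^sub>R w)) \<longlonglongrightarrow> v z"
        using v(1) by (intro continuous_on_tendsto_compose[OF v(1)]) auto
    qed
  qed (use integrable_bump bdA in auto)
  have Abd: "norm (A n z) \<le> (LINT w|lborel. bump w) * C" for n z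
    unfolding A[symmetric] by (rule cv_bump_bound) (use v(2) in auto)
  have "(\<lambda>n. LINT z|lborel. A n z * b z) \<longlonglongrightarrow> (LINT z|lborel. (LINT w|lborel. of_real (bump w) * v z) * b z)"
  proof (rule integral_dominated_convergence[where w="\<lambda>z. ((LINT w|lborel. bump w) * C) * norm (b z)"])
    \<comment> \<open>Continuity of the averages is wanted for their measurability.\<close>
    have "continuous_on UNIV (A n)" for n
    proof -
      have "continuous (at z) (A n)" for z
        unfolding continuous_at A_def
      proof (rule tendsto_integral_at[where w="\<lambda>w. bump w * C"])
        show "((\<lambda>z. of_real (bump w) * v (z + (1 / real (Suc n)) *\<^sub>R w)) \<longlongrightarrow>
            of_real (bump w) * v (z + (1 / real (Suc n)) *\<^sub>R w)) (at z)" for w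
          using v(1) by (intro tendsto_intros isCont_tendsto_compose[of _ v]) 
            (auto simp: continuous_on_eq_continuous_at)
      qed (use integrable_bump bdA in \<open>auto intro!: always_eventually\<close>)
      then show ?thesis by (auto intro: continuous_at_imp_continuous_on)
    qed
    then have [measurable]: "A n \<in> borel_measurable borel" for n by (rule borel_measurable_continuous_onI)
    show "(\<lambda>z. A n z * b z) \<in> borel_measurable lborel" for n by measurable
    have "(LINT w|lborel. of_real (bump w) * v z) = of_real (LINT w|lborel. bump w) * v z" for z
      using integrable_bump by simp
    then show "(\<lambda>z. (LINT w|lborel. of_real (bump w) * v z) * b z) \<in> borel_measurable lborel" by simp
    show "AE z in lborel. norm (A n z * b z) \<le> ((LINT w|lborel. bump w) * C) * norm (b z)" for n
      unfolding norm_mult using Abd by (intro AE_I2 mult_right_mono) auto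
  qed (use Alim b in \<open>auto intro!: AE_I2 tendsto_mult\<close>)
  moreover have "(LINT z|lborel. A n z * b z) = of_real (real (Suc n) ^ 3) * (LINT z|lborel. cv bump (1 / real (Suc n)) v z * b z)" for n
    unfolding A[symmetric] by (simp add: mult.assoc)
  moreover have "(LINT z|lborel. (LINT w|lborel. of_real (bump w) * v z) * b z) = of_real (LINT x|lborel. bump x) * (LINT z|lborel. v z * b z)"
    using integrable_bump by (simp add: mult.assoc)
  ultimately show ?thesis by simp
qed

lemma weak_schrodingerD:
  assumes "weak_schrodinger w g"
  shows "exp_decay w" "exp_decay g" "\<epsilon> > 0 \<Longrightarrow> ((\<lambda>t. cv bump \<epsilon> (w t) z) has_vector_derivative
        \<i> * (of_real (1 / \<epsilon>\<^sup>2) * cv bump_laplacian \<epsilon> (w t) z - cv bump \<epsilon> (g t) z)) (at t)"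
  using assms by (auto simp: weak_schrodinger_def)

lemma bump_abs_le: "\<bar>bump x\<bar> \<le> 1"
  using bump_bounds[of x] by simp

lemma cv_slice_continuous:
  assumes "continuous_on UNIV \<kappa>" "\<And>x. \<bar>\<kappa> x\<bar> \<le> M" "exp_decay v"
  shows "continuous_on UNIV (cv \<kappa> \<epsilon> (v t))"
  using joint_continuous_slice(1)[OF cv_continuous[OF assms]] by simp

lemma exp_decay_cv_mult:
  assumes "continuous_on UNIV \<kappa>" "\<And>x. \<bar>\<kappa> x\<bar> \<le> M" "exp_decay v" "exp_decay b"
  shows "exp_decay (\<lambda>t z. cv \<kappa> \<epsilon> (v t) z * b t z)"
proof -
  obtain C where "\<And>t z. norm (cv \<kappa> \<epsilon> (v t) z) \<le> C" using cv_bounded_ec[OF assms(1-3)] by metis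
  then show ?thesis by (intro exp_decay_mult_bounded[OF assms(4) cv_continuous[OF assms(1-3)]])
qed

text \<open>The quotient of the smoothed function converges pointwise and is bounded uniformly in
  \<open>z\<close> and \<open>h\<close>, because the time derivative is bounded; integrability comes
  from \<open>w\<close>. The factor \<open>w\<close> may move with \<open>h\<close>, since the
  product rule pairs one increment with the other function at the new time.\<close>

lemma pairing_quotient_limit:
  assumes s: "weak_schrodinger a p" and w: "exp_decay w" and \<epsilon>: "\<epsilon> > 0"
  shows "((\<lambda>h. LINT z|lborel. ((cv bump \<epsilon> (a (t + h)) z - cv bump \<epsilon> (a t) z) /\<^sub>R h) * w h z) \<longlongrightarrow>
     (LINT z|lborel. \<i> * (of_real (1 / \<epsilon>\<^sup>2) * cv bump_laplacian \<epsilon> (a t) z - cv bump \<epsilon> (p t) z) * w 0 z)) (at 0)"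
proof -
  obtain L where L: "\<And>x. \<bar>bump_laplacian x\<bar> \<le> L" using bump_laplacian_bounded by metis
  note s' = weak_schrodingerD[OF s]
  note cb = continuous_bump(1)[of UNIV] and cl = continuous_bump(4)[of UNIV]
  obtain C1 where C1: "\<And>t z. norm (cv bump_laplacian \<epsilon> (a t) z) \<le> C1"
    using cv_bounded_ec[OF cl L s'(1)] by metis
  obtain C2 where C2: "\<And>t z. norm (cv bump \<epsilon> (p t) z) \<le> C2"
    using cv_bounded_ec[OF cb bump_abs_le s'(2)] by metis
  define D where "D t z = \<i> * (of_real (1 / \<epsilon>\<^sup>2) * cv bump_laplacian \<epsilon> (a t) z - cv bump \<epsilon> (p t) z)" for t z
  define M where "M = 1 / \<epsilon>\<^sup>2 * C1 + C2"
  have D: "norm (D t z) \<le> M" for t z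
  proof -
    have "norm (of_real (1 / \<epsilon>\<^sup>2) * cv bump_laplacian \<epsilon> (a t) z) \<le> 1 / \<epsilon>\<^sup>2 * C1"
      using C1[of t z] by (simp add: norm_mult norm_divide norm_power divide_right_mono)
    then show ?thesis using C2[of t z] norm_triangle_ineq4[of "of_real (1 / \<epsilon>\<^sup>2) * cv bump_laplacian \<epsilon> (a t) z" "cv bump \<epsilon> (p t) z"]
      unfolding D_def M_def norm_mult norm_ii by linarith
  qed
  have M: "M \<ge> 0" using D[of 0 0] norm_ge_zero order_trans by blast
  obtain C \<gamma> where wb: "C > 0" "\<gamma> > 0" "\<And>t x. norm (w t x) \<le> C * exp (- \<gamma> * norm x)" using exp_decayE[OF w] by metis
  have q: "norm ((cv bump \<epsilon> (a (t + h)) z - cv bump \<epsilon> (a t) z) /\<^sub>R h) \<le> M" if "h \<noteq> 0" for h z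
  proof (rule norm_quotient_le[OF _ that])
    show "norm (cv bump \<epsilon> (a (t + h)) z - cv bump \<epsilon> (a t) z) \<le> M * \<bar>h\<bar>"
      using mean_value_bound[of t "t + h" "\<lambda>t. cv bump \<epsilon> (a t) z" "\<lambda>t. D t z" M] s'(3)[OF \<epsilon>] D
      by (simp add: D_def)
  qed
  have ma: "cv bump \<epsilon> (a t) \<in> borel_measurable borel" for t
    by (intro borel_measurable_continuous_onI cv_slice_continuous[OF cb bump_abs_le s'(1)])
  show ?thesis
    unfolding D_def[symmetric]
  proof (rule tendsto_integral_at[where w="\<lambda>x. M * (C * exp (- \<gamma> * norm x))"])
    show "((\<lambda>h. (cv bump \<epsilon> (a (t + h)) z - cv bump \<epsilon> (a t) z) /\<^sub>R h * w h z) \<longlongrightarrow> D t z * w 0 z) (at 0)" for z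
    proof (intro tendsto_mult)
      show "((\<lambda>h. (cv bump \<epsilon> (a (t + h)) z - cv bump \<epsilon> (a t) z) /\<^sub>R h) \<longlongrightarrow> D t z) (at 0)"
        using s'(3)[OF \<epsilon>, of z t] by (simp add: has_vector_derivative_iff_quotient D_def)
      show "((\<lambda>h. w h z) \<longlongrightarrow> w 0 z) (at 0)"
        using exp_decay_slice(2)[OF w, of UNIV z] by (simp add: continuous_on_eq_continuous_at continuous_at)
    qed
    have "(\<lambda>z. (cv bump \<epsilon> (a (t + h)) z - cv bump \<epsilon> (a t) z) /\<^sub>R h * w h z) \<in> borel_measurable borel" for h
      using ma exp_decay_measurable[OF w] by measurable
    moreover have "norm ((cv bump \<epsilon> (a (t + h)) z - cv bump \<epsilon> (a t) z) /\<^sub>R h * w h z) \<le> M * (C * exp (- \<gamma> * norm z))"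
      if "h \<noteq> 0" for h z
      unfolding norm_mult by (rule mult_mono[OF q[OF that] wb(3) M]) simp
    ultimately show "\<forall>\<^sub>F h in at 0. (\<lambda>z. (cv bump \<epsilon> (a (t + h)) z - cv bump \<epsilon> (a t) z) /\<^sub>R h * w h z) \<in> borel_measurable borel \<and>
       (\<forall>z. norm ((cv bump \<epsilon> (a (t + h)) z - cv bump \<epsilon> (a t) z) /\<^sub>R h * w h z) \<le> M * (C * exp (- \<gamma> * norm z)))"
      by (auto simp: eventually_at intro!: exI[of _ 1])
    have "D t \<in> borel_measurable borel"
      unfolding D_def[abs_def]
      by (intro borel_measurable_continuous_onI continuous_intros cv_slice_continuous[OF cb bump_abs_le s'(2)]
          cv_slice_continuous[OF cl L s'(1)])
    then show "(\<lambda>z. D t z * w 0 z) \<in> borel_measurable borel"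
      using exp_decay_measurable[OF w] by measurable
    show "integrable lborel (\<lambda>x::real^3. M * (C * exp (- \<gamma> * norm x)))"
      using integrable_exp_norm[OF wb(2), where 'a="real^3"] by simp
  qed
qed

text \<open>Doubling of variables: integrating \<open>cnj (a t y) * b t z\<close> against a kernel depending only on \<open>y - z\<close>,
  the two Laplacians cancel before the limit of small scale is taken.\<close>

lemma weak_schrodinger_doubling:
  assumes sa: "weak_schrodinger a p" and sb: "weak_schrodinger b q" and \<epsilon>: "\<epsilon> > 0"
  shows "((\<lambda>t. LINT z|lborel. cv bump \<epsilon> (\<lambda>y. cnj (a t y)) z * b t z) has_vector_derivative
     \<i> * ((LINT z|lborel. cv bump \<epsilon> (\<lambda>y. cnj (p t y)) z * b t z) - (LINT z|lborel. cv bump \<epsilon> (\<lambda>y. cnj (a t y)) z * q t z))) (at t)"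
proof -
  obtain L where L: "\<And>x. \<bar>bump_laplacian x\<bar> \<le> L" using bump_laplacian_bounded by metis
  note a = weak_schrodingerD[OF sa] and b = weak_schrodingerD[OF sb]
  note cb = continuous_bump(1)[of UNIV] and cl = continuous_bump(4)[of UNIV]
  have ec1: "exp_decay (\<lambda>h z. cnj (b (t + h) z))"
    by (intro exp_decay_cnj exp_decay_time[OF b(1)] continuous_intros)
  have ec2: "exp_decay (\<lambda>h z. cnj (a t z))"
    using exp_decay_time[OF exp_decay_cnj[OF a(1)], of "\<lambda>_. t"] by simp
  note lim1 = tendsto_cnj[OF pairing_quotient_limit[OF sa ec1 \<epsilon>, of t]]
  note lim2 = pairing_quotient_limit[OF sb ec2 \<epsilon>, of t]
  let ?J = "\<lambda>t. LINT z|lborel. cv bump \<epsilon> (\<lambda>y. cnj (a t y)) z * b t z"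
  note sym = cv_symmetric[OF cb bump_abs_le bump_minus(1)] and syml = cv_symmetric[OF cl L bump_minus(2)]
  have ia: "integrable lborel (\<lambda>y. cnj (a t y))" for t using exp_decay_integrable[OF exp_decay_cnj[OF a(1)]] .
  have icb: "integrable lborel (\<lambda>z. cv bump \<epsilon> (\<lambda>y. cnj (a s y)) z * b r z)" for s r
    using exp_decay_integrable[OF exp_decay_cv_mult[OF cb bump_abs_le exp_decay_time[OF exp_decay_cnj[OF a(1)], of "\<lambda>_. s"] exp_decay_time[OF b(1), of "\<lambda>_. r"]]]
    by simp
  have ica: "integrable lborel (\<lambda>z. cnj (a s z) * cv bump \<epsilon> (b r) z)" for s r
    using exp_decay_integrable[OF exp_decay_cv_mult[OF cb bump_abs_le exp_decay_time[OF b(1), of "\<lambda>_. r"] exp_decay_time[OF exp_decay_cnj[OF a(1)], of "\<lambda>_. s"]]]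
    by (simp add: mult.commute)
  \<comment> \<open>Discrete product rule: the increment of \<open>a\<close> meets \<open>b\<close>
    at time \<open>t + h\<close>, that of \<open>b\<close> meets \<open>a\<close> at time
    \<open>t\<close>. The middle terms match once the smoothing is moved from \<open>a\<close> to
    \<open>b\<close> by symmetry of the kernel.\<close>
  have split: "(?J (t + h) - ?J t) /\<^sub>R h =
     cnj (LINT z|lborel. ((cv bump \<epsilon> (a (t + h)) z - cv bump \<epsilon> (a t) z) /\<^sub>R h) * cnj (b (t + h) z))
     + (LINT z|lborel. ((cv bump \<epsilon> (b (t + h)) z - cv bump \<epsilon> (b t) z) /\<^sub>R h) * cnj (a t z))" for h
  proof -
    have "cnj (LINT z|lborel. ((cv bump \<epsilon> (a (t + h)) z - cv bump \<epsilon> (a t) z) /\<^sub>R h) * cnj (b (t + h) z))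
       = (LINT z|lborel. (cv bump \<epsilon> (\<lambda>y. cnj (a (t + h) y)) z * b (t + h) z - cv bump \<epsilon> (\<lambda>y. cnj (a t y)) z * b (t + h) z) /\<^sub>R h)"
      unfolding Bochner_Integration.integral_cnj[symmetric]
      by (rule Bochner_Integration.integral_cong[OF refl]) (simp add: cv_cnj algebra_simps)
    also have "\<dots> = (?J (t + h) - (LINT z|lborel. cv bump \<epsilon> (\<lambda>y. cnj (a t y)) z * b (t + h) z)) /\<^sub>R h"
      using icb by simp
    also have "(LINT z|lborel. cv bump \<epsilon> (\<lambda>y. cnj (a t y)) z * b (t + h) z) = (LINT z|lborel. cnj (a t z) * cv bump \<epsilon> (b (t + h)) z)"
      by (rule sym[OF ia exp_decay_integrable[OF b(1)]])
    finally have 1: "cnj (LINT z|lborel. ((cv bump \<epsilon> (a (t + h)) z - cv bump \<epsilon> (a t) z) /\<^sub>R h) * cnj (b (t + h) z))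
       = (?J (t + h) - (LINT z|lborel. cnj (a t z) * cv bump \<epsilon> (b (t + h)) z)) /\<^sub>R h" .
    have "(LINT z|lborel. ((cv bump \<epsilon> (b (t + h)) z - cv bump \<epsilon> (b t) z) /\<^sub>R h) * cnj (a t z))
       = (LINT z|lborel. (cnj (a t z) * cv bump \<epsilon> (b (t + h)) z - cnj (a t z) * cv bump \<epsilon> (b t) z) /\<^sub>R h)"
      by (rule Bochner_Integration.integral_cong[OF refl]) (simp add: algebra_simps)
    also have "\<dots> = ((LINT z|lborel. cnj (a t z) * cv bump \<epsilon> (b (t + h)) z) - (LINT z|lborel. cnj (a t z) * cv bump \<epsilon> (b t) z)) /\<^sub>R h"
      using ica by simp
    also have "(LINT z|lborel. cnj (a t z) * cv bump \<epsilon> (b t) z) = ?J t"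
      by (rule sym[OF ia exp_decay_integrable[OF b(1)], symmetric])
    finally show ?thesis unfolding 1 by (simp add: scaleR_diff_right)
  qed
  have i1: "integrable lborel (\<lambda>z. cv bump_laplacian \<epsilon> (\<lambda>y. cnj (a t y)) z * b t z)"
    by (rule exp_decay_integrable[OF exp_decay_cv_mult[OF cl L exp_decay_cnj[OF a(1)] b(1)]])
  have i2: "integrable lborel (\<lambda>z. cv bump \<epsilon> (\<lambda>y. cnj (p t y)) z * b t z)"
    by (rule exp_decay_integrable[OF exp_decay_cv_mult[OF cb bump_abs_le exp_decay_cnj[OF a(2)] b(1)]])
  have i3: "integrable lborel (\<lambda>z. cnj (a t z) * cv bump_laplacian \<epsilon> (b t) z)"
    using exp_decay_integrable[OF exp_decay_cv_mult[OF cl L b(1) exp_decay_cnj[OF a(1)]]] by (simp add: mult.commute)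
  have i4: "integrable lborel (\<lambda>z. cnj (a t z) * cv bump \<epsilon> (q t) z)"
    using exp_decay_integrable[OF exp_decay_cv_mult[OF cb bump_abs_le b(2) exp_decay_cnj[OF a(1)]]] by (simp add: mult.commute)
  let ?c = "of_real (1 / \<epsilon>\<^sup>2) :: complex"
  have r1: "cnj (LINT z|lborel. \<i> * (?c * cv bump_laplacian \<epsilon> (a t) z - cv bump \<epsilon> (p t) z) * cnj (b (t + 0) z))
     = - \<i> * (?c * (LINT z|lborel. cv bump_laplacian \<epsilon> (\<lambda>y. cnj (a t y)) z * b t z) - (LINT z|lborel. cv bump \<epsilon> (\<lambda>y. cnj (p t y)) z * b t z))"
  proof -
    have "cnj (LINT z|lborel. \<i> * (?c * cv bump_laplacian \<epsilon> (a t) z - cv bump \<epsilon> (p t) z) * cnj (b (t + 0) z))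
      = (LINT z|lborel. - \<i> * (?c * (cv bump_laplacian \<epsilon> (\<lambda>y. cnj (a t y)) z * b t z) - cv bump \<epsilon> (\<lambda>y. cnj (p t y)) z * b t z))"
      unfolding Bochner_Integration.integral_cnj[symmetric]
      by (rule Bochner_Integration.integral_cong[OF refl]) (simp add: cv_cnj algebra_simps)
    then show ?thesis using i1 i2 by (simp only: integral_mult_right_zero Bochner_Integration.integral_diff integrable_mult_right)
  qed
  have r2: "(LINT z|lborel. \<i> * (?c * cv bump_laplacian \<epsilon> (b t) z - cv bump \<epsilon> (q t) z) * cnj (a t z))
     = \<i> * (?c * (LINT z|lborel. cnj (a t z) * cv bump_laplacian \<epsilon> (b t) z) - (LINT z|lborel. cnj (a t z) * cv bump \<epsilon> (q t) z))"
  proof -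
    have "(LINT z|lborel. \<i> * (?c * cv bump_laplacian \<epsilon> (b t) z - cv bump \<epsilon> (q t) z) * cnj (a t z))
      = (LINT z|lborel. \<i> * (?c * (cnj (a t z) * cv bump_laplacian \<epsilon> (b t) z) - cnj (a t z) * cv bump \<epsilon> (q t) z))"
      by (rule Bochner_Integration.integral_cong[OF refl]) (simp add: algebra_simps)
    then show ?thesis using i3 i4 by (simp only: integral_mult_right_zero Bochner_Integration.integral_diff integrable_mult_right)
  qed
  \<comment> \<open>By \<open>syml\<close> the two Laplacian integrals agree, and they carry
    opposite signs because conjugation turned \<open>\<i>\<close> into \<open>- \<i>\<close> in the
    term of \<open>a\<close>.\<close>
  show ?thesis
    unfolding has_vector_derivative_iff_quotient split
    using tendsto_add[OF lim1 lim2] 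
    unfolding r1 r2 syml[OF ia exp_decay_integrable[OF b(1)]] sym[OF ia exp_decay_integrable[OF b(2)]]
    by (simp add: algebra_simps)
qed

text \<open>The doubling identity is a derivative at positive scale. Integrated over time it
  survives the limit of small scale, since the smoothed pairings are bounded uniformly in scale and
  time and converge at each time.\<close>

lemma weak_schrodinger_pairing:
  assumes sa: "weak_schrodinger a p" and sb: "weak_schrodinger b q" and T: "T \<ge> 0"
  shows "((\<lambda>t. \<i> * ((LINT x|lborel. cnj (p t x) * b t x) - (LINT x|lborel. cnj (a t x) * q t x))) has_integral
     (LINT x|lborel. cnj (a T x) * b T x) - (LINT x|lborel. cnj (a 0 x) * b 0 x)) {0..T}"
proof -
  note a = weak_schrodingerD[OF sa] and b = weak_schrodingerD[OF sb]
  note cb = continuous_bump(1)[of UNIV]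
  define \<beta> where "\<beta> = (LINT x|lborel. bump x)"
  have \<beta>: "\<beta> > 0" unfolding \<beta>_def by (rule integral_bump_pos)
  \<comment> \<open>Scale \<open>1 / (n + 1)\<close>, normalised by the Jacobian and the integral of
    \<open>bump\<close>, so that \<open>K n v w\<close> tends to the integral of
    \<open>v * w\<close>.\<close>
  define K where "K n v w = of_real (real (Suc n) ^ 3) * (LINT z|lborel. cv bump (1 / real (Suc n)) v z * w z) / of_real \<beta>" 
    for n and v w :: "real^3 \<Rightarrow> complex"
  have Klim: "(\<lambda>n. K n (\<lambda>x. cnj (v t x)) (w t)) \<longlonglongrightarrow> (LINT x|lborel. cnj (v t x) * w t x)" if vv: "exp_decay v" and ww: "exp_decay w" for v w t
  proof -
    obtain C where C: "\<And>t x. norm (v t x) \<le> C" using exp_decay_bounded[OF vv] by metis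
    have "(\<lambda>n. K n (\<lambda>x. cnj (v t x)) (w t)) \<longlonglongrightarrow> of_real \<beta> * (LINT x|lborel. cnj (v t x) * w t x) / of_real \<beta>"
      unfolding K_def \<beta>_def
      by (intro tendsto_divide tendsto_const cv_limit[where C=C] exp_decay_slice(1)[OF exp_decay_cnj[OF vv]]
          exp_decay_integrable[OF exp_decay_cnj[OF vv]] exp_decay_integrable[OF ww])
        (use C \<beta> in \<open>auto simp: \<beta>_def\<close>)
    then show ?thesis using \<beta> by simp
  qed
  have Kbd: "\<exists>B. \<forall>n t. norm (K n (\<lambda>x. cnj (v t x)) (w t)) \<le> B" if vv: "exp_decay v" and ww: "exp_decay w" for v w
  proof -
    obtain C where C: "\<And>t x. norm (v t x) \<le> C" "C > 0" using exp_decay_bounded[OF vv] by metis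
    obtain E where E: "\<And>t. (LINT x|lborel. norm (w t x)) \<le> E" using exp_decay_integral_bounded[OF ww] by metis
    have "norm (K n (\<lambda>x. cnj (v t x)) (w t)) \<le> C * E" for n t
    proof -
      have m: "(\<lambda>x. cnj (v t x)) \<in> borel_measurable borel" using exp_decay_measurable[OF exp_decay_cnj[OF vv]] .
      have 1: "norm (of_real (real (Suc n) ^ 3) * cv bump (1 / real (Suc n)) (\<lambda>x. cnj (v t x)) z) \<le> \<beta> * C" for z
        unfolding \<beta>_def by (rule cv_bump_bound) (use m C in auto)
      have k: "K n (\<lambda>x. cnj (v t x)) (w t) =
          (LINT z|lborel. (of_real (real (Suc n) ^ 3) * cv bump (1 / real (Suc n)) (\<lambda>x. cnj (v t x)) z) * w t z) / of_real \<beta>"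
        by (simp add: K_def mult.assoc)
      have i: "integrable lborel (\<lambda>z. (of_real (real (Suc n) ^ 3) * cv bump (1 / real (Suc n)) (\<lambda>x. cnj (v t x)) z) * w t z)"
        using exp_decay_integrable[OF exp_decay_cv_mult[OF cb bump_abs_le exp_decay_cnj[OF vv] ww]] by (simp add: mult.assoc)
      have "norm (LINT z|lborel. (of_real (real (Suc n) ^ 3) * cv bump (1 / real (Suc n)) (\<lambda>x. cnj (v t x)) z) * w t z)
          \<le> (LINT z|lborel. \<beta> * C * norm (w t z))"
        by (rule order_trans[OF integral_norm_bound])
          (intro integral_mono integrable_norm i integrable_mult_right exp_decay_integrable ww;
            unfold norm_mult[of "_ * _" "w t _"]; intro mult_right_mono 1 norm_ge_zero)
      also have "\<dots> \<le> \<beta> * C * E" using E[of t] \<beta> C(2) by simp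
      finally show ?thesis using \<beta> unfolding k by (simp add: norm_divide divide_le_eq mult_ac)
    qed
    then show ?thesis by blast
  qed
  obtain B1 where B1: "\<And>n t. norm (K n (\<lambda>x. cnj (p t x)) (b t)) \<le> B1" using Kbd[OF a(2) b(1)] by metis
  obtain B2 where B2: "\<And>n t. norm (K n (\<lambda>x. cnj (a t x)) (q t)) \<le> B2" using Kbd[OF a(1) b(2)] by metis
  show ?thesis
  proof (rule has_integral_dominated_convergence)
    show "((\<lambda>t. \<i> * (K n (\<lambda>x. cnj (p t x)) (b t) - K n (\<lambda>x. cnj (a t x)) (q t))) has_integral
        K n (\<lambda>x. cnj (a T x)) (b T) - K n (\<lambda>x. cnj (a 0 x)) (b 0)) {0..T}" for n
    proof (rule fundamental_theorem_of_calculus[OF T])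
      fix t
      let ?e = "1 / real (Suc n)"
      have "((\<lambda>t. (of_real (real (Suc n) ^ 3) / of_real \<beta>) * (LINT z|lborel. cv bump ?e (\<lambda>y. cnj (a t y)) z * b t z)) has_vector_derivative
        (of_real (real (Suc n) ^ 3) / of_real \<beta>) * (\<i> * ((LINT z|lborel. cv bump ?e (\<lambda>y. cnj (p t y)) z * b t z) - (LINT z|lborel. cv bump ?e (\<lambda>y. cnj (a t y)) z * q t z)))) (at t)"
        by (intro has_vector_derivative_mult_right weak_schrodinger_doubling[OF sa sb]) simp
      then show "((\<lambda>t. K n (\<lambda>x. cnj (a t x)) (b t)) has_vector_derivative
        \<i> * (K n (\<lambda>x. cnj (p t x)) (b t) - K n (\<lambda>x. cnj (a t x)) (q t))) (at t within {0..T})"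
        unfolding K_def
        by (auto simp: algebra_simps diff_divide_distrib intro: has_vector_derivative_at_within)
    qed
    show "\<forall>t\<in>{0..T}. norm (\<i> * (K n (\<lambda>x. cnj (p t x)) (b t) - K n (\<lambda>x. cnj (a t x)) (q t))) \<le> B1 + B2" for n
      using order_trans[OF norm_triangle_ineq4 add_mono[OF B1 B2]] by (simp add: norm_mult)
    show "\<forall>t\<in>{0..T}. (\<lambda>n. \<i> * (K n (\<lambda>x. cnj (p t x)) (b t) - K n (\<lambda>x. cnj (a t x)) (q t))) \<longlonglongrightarrow>
       \<i> * ((LINT x|lborel. cnj (p t x) * b t x) - (LINT x|lborel. cnj (a t x) * q t x))"
      by (intro ballI tendsto_intros Klim a b)
    show "(\<lambda>n. K n (\<lambda>x. cnj (a T x)) (b T) - K n (\<lambda>x. cnj (a 0 x)) (b 0)) \<longlonglongrightarrow>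
      (LINT x|lborel. cnj (a T x) * b T x) - (LINT x|lborel. cnj (a 0 x) * b 0 x)"
      by (intro tendsto_intros Klim a b)
  qed auto
qed

section \<open>Symmetries of weak solutions and growth of their square integral\<close>

lemma cv_translate:
  assumes \<kappa>: "continuous_on UNIV \<kappa>" and [measurable]: "v \<in> borel_measurable borel"
  shows "cv \<kappa> \<epsilon> (\<lambda>y. v (c + y)) z = cv \<kappa> \<epsilon> v (c + z)"
proof -
  have "continuous_on UNIV (\<lambda>y. \<kappa> ((1 / \<epsilon>) *\<^sub>R (y - (c + z))))"
    by (rule continuous_on_compose2[OF \<kappa>]) (auto intro!: continuous_intros)
  then have [measurable]: "(\<lambda>y. \<kappa> ((1 / \<epsilon>) *\<^sub>R (y - (c + z)))) \<in> borel_measurable borel"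
    by (rule borel_measurable_continuous_onI)
  show ?thesis
    unfolding cv_def
    using integral_translate[of "\<lambda>y. of_real (\<kappa> ((1 / \<epsilon>) *\<^sub>R (y - (c + z)))) * v y" c] by simp
qed

lemma cv_scale:
  assumes \<kappa>: "continuous_on UNIV \<kappa>" and [measurable]: "v \<in> borel_measurable borel" and s: "s > 0"
  shows "cv \<kappa> \<epsilon> (\<lambda>y. v (s *\<^sub>R y)) z = of_real (1 / s ^ 3) * cv \<kappa> (s * \<epsilon>) v (s *\<^sub>R z)"
proof -
  let ?g = "\<lambda>y. of_real (\<kappa> ((1 / (s * \<epsilon>)) *\<^sub>R (y - s *\<^sub>R z))) * v y"
  have "continuous_on UNIV (\<lambda>y. \<kappa> ((1 / (s * \<epsilon>)) *\<^sub>R (y - s *\<^sub>R z)))"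
    by (rule continuous_on_compose2[OF \<kappa>]) (auto intro!: continuous_intros)
  then have [measurable]: "(\<lambda>y. \<kappa> ((1 / (s * \<epsilon>)) *\<^sub>R (y - s *\<^sub>R z))) \<in> borel_measurable borel"
    by (rule borel_measurable_continuous_onI)
  have "(1 / (s * \<epsilon>)) *\<^sub>R (s *\<^sub>R y - s *\<^sub>R z) = (1 / \<epsilon>) *\<^sub>R (y - z)" for y :: "real^3"
    using s by (simp add: scaleR_diff_right[symmetric])
  then have "cv \<kappa> \<epsilon> (\<lambda>y. v (s *\<^sub>R y)) z = (LINT y|lborel. ?g (s *\<^sub>R y))" unfolding cv_def by simp
  also have "\<dots> = (1 / s ^ 3) *\<^sub>R (LINT y|lborel. ?g y)"
    by (subst integral_scale) (use s in auto)
  finally show ?thesis by (simp only: cv_def scaleR_conv_of_real)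
qed

lemma weak_schrodingerI:
  assumes "exp_decay w" "exp_decay g" "\<And>\<epsilon> z t. \<epsilon> > 0 \<Longrightarrow> ((\<lambda>t. cv bump \<epsilon> (w t) z) has_vector_derivative
        \<i> * (of_real (1 / \<epsilon>\<^sup>2) * cv bump_laplacian \<epsilon> (w t) z - cv bump \<epsilon> (g t) z)) (at t)"
  shows "weak_schrodinger w g"
  unfolding weak_schrodinger_def using assms by simp

lemma weak_schrodinger_translate:
  assumes "weak_schrodinger w g"
  shows "weak_schrodinger (\<lambda>t x. w t (c + x)) (\<lambda>t x. g t (c + x))"
proof -
  note w = weak_schrodingerD[OF assms]
  note tr = cv_translate[OF continuous_bump(1) exp_decay_measurable[OF w(1)], where c=c]
    cv_translate[OF continuous_bump(1) exp_decay_measurable[OF w(2)], where c=c]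
    cv_translate[OF continuous_bump(4) exp_decay_measurable[OF w(1)], where c=c]
  have "((\<lambda>t. cv bump \<epsilon> (\<lambda>x. w t (c + x)) z) has_vector_derivative
        \<i> * (of_real (1 / \<epsilon>\<^sup>2) * cv bump_laplacian \<epsilon> (\<lambda>x. w t (c + x)) z - cv bump \<epsilon> (\<lambda>x. g t (c + x)) z)) (at t)"
    if "\<epsilon> > 0" for \<epsilon> z t
    unfolding tr by (rule w(3)[OF that])
  then show ?thesis by (rule weak_schrodingerI[OF exp_decay_translate[OF w(1)] exp_decay_translate[OF w(2)]])
qed

lemma cv_diff:
  assumes "continuous_on UNIV \<kappa>" "\<And>x. \<bar>\<kappa> x\<bar> \<le> M" "integrable lborel v" "integrable lborel w"
  shows "cv \<kappa> \<epsilon> (\<lambda>x. v x - w x) z = cv \<kappa> \<epsilon> v z - cv \<kappa> \<epsilon> w z"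
  unfolding cv_def right_diff_distrib
  by (intro Bochner_Integration.integral_diff cv_integrable[OF assms(1,2)] assms)

lemma weak_schrodinger_diff:
  assumes "weak_schrodinger a p" "weak_schrodinger b q"
  shows "weak_schrodinger (\<lambda>t x. b t x - a t x) (\<lambda>t x. q t x - p t x)"
proof -
  note a = weak_schrodingerD[OF assms(1)] and b = weak_schrodingerD[OF assms(2)]
  obtain L where L: "\<And>x. \<bar>bump_laplacian x\<bar> \<le> L" using bump_laplacian_bounded by metis
  note d = cv_diff[OF continuous_bump(1) bump_abs_le] and dl = cv_diff[OF continuous_bump(4) L]
  have "((\<lambda>t. cv bump \<epsilon> (b t) z - cv bump \<epsilon> (a t) z) has_vector_derivative
     \<i> * (of_real (1 / \<epsilon>\<^sup>2) * (cv bump_laplacian \<epsilon> (b t) z - cv bump_laplacian \<epsilon> (a t) z) - (cv bump \<epsilon> (q t) z - cv bump \<epsilon> (p t) z))) (at t)"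
    if "\<epsilon> > 0" for \<epsilon> z t
    using has_vector_derivative_diff[OF b(3)[OF that, of z t] a(3)[OF that, of z t]] by (simp add: algebra_simps)
  then show ?thesis
    unfolding weak_schrodinger_def using a b
    by (simp add: d[OF exp_decay_integrable exp_decay_integrable] dl[OF exp_decay_integrable exp_decay_integrable] exp_decay_diff)
qed

text \<open>Rescaling space by \<open>s\<close> turns the scale \<open>\<epsilon>\<close> into
  \<open>s * \<epsilon>\<close>, and the factor \<open>s\<^sup>2\<close> from the time derivative
  restores \<open>1 / \<epsilon>\<^sup>2\<close> in front of the Laplacian. The forcing has no such
  compensation and keeps \<open>s\<^sup>2\<close>.\<close>

lemma weak_schrodinger_scale:
  assumes "weak_schrodinger w g" and s: "s \<ge> 1"
  shows "weak_schrodinger (\<lambda>t x. w (s\<^sup>2 * t) (s *\<^sub>R x)) (\<lambda>t x. of_real (s\<^sup>2) * g (s\<^sup>2 * t) (s *\<^sub>R x))"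
proof -
  note w = weak_schrodingerD[OF assms(1)]
  have s0: "s > 0" using s by simp
  have ew: "exp_decay (\<lambda>t x. w (s\<^sup>2 * t) (s *\<^sub>R x))" by (intro exp_decay_scale[OF exp_decay_time[OF w(1)]] s continuous_intros)
  have eg: "exp_decay (\<lambda>t x. g (s\<^sup>2 * t) (s *\<^sub>R x))" by (intro exp_decay_scale[OF exp_decay_time[OF w(2)]] s continuous_intros)
  note sc = cv_scale[OF continuous_bump(1) exp_decay_measurable[OF w(1)] s0] cv_scale[OF continuous_bump(1) exp_decay_measurable[OF w(2)] s0]
    cv_scale[OF continuous_bump(4) exp_decay_measurable[OF w(1)] s0]
  have cm: "cv bump \<epsilon> (\<lambda>x. of_real (s\<^sup>2) * v x) z = of_real (s\<^sup>2) * cv bump \<epsilon> v z" for v \<epsilon> z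
    unfolding cv_def by (subst integral_mult_right_zero[symmetric]) (simp add: mult_ac)
  have "((\<lambda>t. of_real (1 / s ^ 3) * cv bump (s * \<epsilon>) (w (s\<^sup>2 * t)) (s *\<^sub>R z)) has_vector_derivative
     \<i> * (of_real (1 / \<epsilon>\<^sup>2) * (of_real (1 / s ^ 3) * cv bump_laplacian (s * \<epsilon>) (w (s\<^sup>2 * t)) (s *\<^sub>R z))
        - of_real (s\<^sup>2) * (of_real (1 / s ^ 3) * cv bump (s * \<epsilon>) (g (s\<^sup>2 * t)) (s *\<^sub>R z)))) (at t)"
    if \<epsilon>: "\<epsilon> > 0" for \<epsilon> z t
  proof -
    have "s * \<epsilon> > 0" using s0 \<epsilon> by simp
    note d = w(3)[OF this, of "s *\<^sub>R z" "s\<^sup>2 * t"]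
    have "((\<lambda>t. s\<^sup>2 * t) has_vector_derivative s\<^sup>2) (at t)" by (auto intro!: derivative_eq_intros)
    from vector_diff_chain_at[OF this d]
    have "((\<lambda>t. cv bump (s * \<epsilon>) (w (s\<^sup>2 * t)) (s *\<^sub>R z)) has_vector_derivative
       s\<^sup>2 *\<^sub>R (\<i> * (of_real (1 / (s * \<epsilon>)\<^sup>2) * cv bump_laplacian (s * \<epsilon>) (w (s\<^sup>2 * t)) (s *\<^sub>R z)
         - cv bump (s * \<epsilon>) (g (s\<^sup>2 * t)) (s *\<^sub>R z)))) (at t)"
      by (simp add: o_def)
    note d' = has_vector_derivative_mult_right[OF this, of "of_real (1 / s ^ 3)"]
    have eq: "of_real (1 / s ^ 3) * (s\<^sup>2 *\<^sub>R (\<i> * (of_real (1 / (s * \<epsilon>)\<^sup>2) * X - Y))) =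
      \<i> * (of_real (1 / \<epsilon>\<^sup>2) * (of_real (1 / s ^ 3) * X) - of_real (s\<^sup>2) * (of_real (1 / s ^ 3) * Y))" for X Y :: complex
    proof -
      have "s\<^sup>2 * (1 / (s * \<epsilon>)\<^sup>2) = 1 / \<epsilon>\<^sup>2" using s0 by (simp add: power_mult_distrib)
      then have "of_real (1 / \<epsilon>\<^sup>2) = (of_real (s\<^sup>2) * of_real (1 / (s * \<epsilon>)\<^sup>2) :: complex)"
        by (simp only: of_real_mult[symmetric])
      then show ?thesis by (simp only: scaleR_conv_of_real) (simp only: algebra_simps)
    qed
    show ?thesis using d' unfolding eq .
  qed
  then show ?thesis
    by (intro weak_schrodingerI ew exp_decay_cmult[OF eg]) (simp only: sc cm)
qed

text \<open>Integral form, because the pairing identity controls \<open>N\<close> only through time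
  integrals. The right side \<open>Y\<close> of the inequality is differentiable and dominates
  \<open>N\<close>, so \<open>Y t * exp (- c * t)\<close> does not increase.\<close>

lemma gronwall_integral:
  fixes N :: "real \<Rightarrow> real"
  assumes N: "continuous_on {0..T} N" and c: "c \<ge> 0" and T: "T \<ge> 0"
    and le: "\<And>t. 0 \<le> t \<Longrightarrow> t \<le> T \<Longrightarrow> N t \<le> A + c * integral {0..t} N"
  shows "N T \<le> A * exp (c * T)"
proof -
  define Y where "Y t = A + c * integral {0..t} N" for t
  have dY: "(Y has_real_derivative c * N t) (at t within {0..T})" if "t \<in> {0..T}" for t
    unfolding Y_def
    using integral_has_real_derivative[OF N that] by (auto intro!: derivative_eq_intros)
  have "Y T * exp (- c * T) \<le> Y 0 * exp (- c * 0)"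
  proof (rule DERIV_nonpos_imp_decreasing_open[of 0 T "\<lambda>t. Y t * exp (- c * t)"])
    have d: "((\<lambda>t. Y t * exp (- c * t)) has_real_derivative (c * N t - c * Y t) * exp (- c * t)) (at t within {0..T})"
      if "t \<in> {0..T}" for t
      by (rule derivative_eq_intros dY[OF that] refl)+ (simp add: algebra_simps)
    then show "continuous_on {0..T} (\<lambda>t. Y t * exp (- c * t))"
      by (rule DERIV_continuous_on)
    show "\<exists>y. ((\<lambda>t. Y t * exp (- c * t)) has_real_derivative y) (at t) \<and> y \<le> 0" if "0 < t" "t < T" for t
    proof (intro exI conjI)
      show "((\<lambda>t. Y t * exp (- c * t)) has_real_derivative (c * N t - c * Y t) * exp (- c * t)) (at t)"
        using d[of t] that by (simp add: at_within_Icc_at)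
      show "(c * N t - c * Y t) * exp (- c * t) \<le> 0"
        using le[of t] that c by (auto simp: Y_def intro!: mult_nonpos_nonneg mult_left_mono)
    qed
  qed (use T in auto)
  then have "Y T \<le> A * exp (c * T)"
    by (simp add: Y_def exp_minus field_simps)
  then show ?thesis using le[of T] T by (simp add: Y_def)
qed

text \<open>Paired with itself, \<open>w\<close> changes its square integral only through the
  forcing. The part of \<open>r\<close> proportional to \<open>w\<close> feeds Gronwall. The rest
  enters through the integral of \<open>norm (w t x) * norm (g t x)\<close>, so that for bounded
  \<open>w\<close> a small \<open>g\<close> counts to first order in its size.\<close>

lemma weak_schrodinger_l2_growth:
  assumes w: "weak_schrodinger w r" and L: "L \<ge> 0" and T: "T \<ge> 0" and g: "exp_decay g"
    and r: "\<And>t x. 0 \<le> t \<Longrightarrow> t \<le> T \<Longrightarrow> norm (r t x) \<le> L * norm (w t x) + norm (g t x)"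
    and K: "\<And>t. 0 \<le> t \<Longrightarrow> t \<le> T \<Longrightarrow> (LINT x|lborel. 2 * norm (w t x) * norm (g t x)) \<le> K"
  shows "(LINT x|lborel. (norm (w T x))\<^sup>2) \<le> ((LINT x|lborel. (norm (w 0 x))\<^sup>2) + K * T) * exp (2 * L * T)"
proof -
  note wD = weak_schrodingerD[OF w]
  define N where "N t = (LINT x|lborel. (norm (w t x))\<^sup>2)" for t
  have eN: "exp_decay (\<lambda>t x. (norm (w t x))\<^sup>2)" using exp_decay_power[OF exp_decay_norm[OF wD(1)], of 2] by simp
  have cN: "continuous_on S N" for S unfolding N_def by (rule exp_decay_integral_continuous[OF eN])
  have K0: "K \<ge> 0"
    using order_trans[OF Bochner_Integration.integral_nonneg K[of 0]] T by simp
  have cw: "(LINT x|lborel. cnj (w t x) * w t x) = of_real (N t)" for t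
    unfolding N_def integral_complex_of_real[symmetric]
    by (rule Bochner_Integration.integral_cong[OF refl]) (simp only: complex_norm_square mult.commute)
  have step: "N t \<le> (N 0 + K * T) + (2 * L) * integral {0..t} N" if t: "0 \<le> t" "t \<le> T" for t
  proof -
    let ?D = "\<lambda>t. \<i> * ((LINT x|lborel. cnj (r t x) * w t x) - (LINT x|lborel. cnj (w t x) * r t x))"
    have hi: "((\<lambda>t. Re (?D t)) has_integral N t - N 0) {0..t}"
      using has_integral_Re[OF weak_schrodinger_pairing[OF w w t(1)]] by (simp only: cw minus_complex.sel Re_complex_of_real)
    have hN: "((\<lambda>t. 2 * L * N t + K) has_integral 2 * L * integral {0..t} N + K * t) {0..t}"
      using has_integral_add[OF has_integral_mult_right[OF integrable_integral[OF integrable_continuous_real[OF cN]]] has_integral_const_real[of K 0 t], of "2 * L"] t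
      by (simp add: mult.commute)
    have "N t - N 0 \<le> 2 * L * integral {0..t} N + K * t"
    proof (rule has_integral_le[OF hi hN])
      fix s assume s: "s \<in> {0..t}"
      have e1: "exp_decay (\<lambda>t x. cnj (r t x) * w t x)" and e2: "exp_decay (\<lambda>t x. cnj (w t x) * r t x)"
        using exp_decay_mult exp_decay_cnj wD(1,2) by blast+
      have e3: "exp_decay (\<lambda>t x. norm (w t x) * norm (g t x))"
        by (intro exp_decay_mult exp_decay_norm wD g)
      have "Re (?D s) \<le> norm (?D s)" by (rule complex_Re_le_cmod)
      also have "\<dots> = norm (LINT x|lborel. cnj (r s x) * w s x - cnj (w s x) * r s x)"
        using exp_decay_integrable[OF e1, of s] exp_decay_integrable[OF e2, of s] by (simp add: norm_mult)
      also have "\<dots> \<le> (LINT x|lborel. norm (cnj (r s x) * w s x - cnj (w s x) * r s x))"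
        by (rule integral_norm_bound)
      also have "\<dots> \<le> (LINT x|lborel. 2 * L * (norm (w s x))\<^sup>2 + 2 * norm (w s x) * norm (g s x))"
      proof (rule integral_mono)
        show "integrable lborel (\<lambda>x. norm (cnj (r s x) * w s x - cnj (w s x) * r s x))"
          using exp_decay_integrable[OF e1, of s] exp_decay_integrable[OF e2, of s] by auto
        show "integrable lborel (\<lambda>x. 2 * L * (norm (w s x))\<^sup>2 + 2 * norm (w s x) * norm (g s x))"
          using exp_decay_integrable[OF eN, of s] exp_decay_integrable[OF e3, of s] by (auto simp: mult.assoc)
        fix x
        have "norm (cnj (r s x) * w s x - cnj (w s x) * r s x) \<le> 2 * (norm (w s x) * norm (r s x))"
          using norm_triangle_ineq4[of "cnj (r s x) * w s x" "cnj (w s x) * r s x"]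
          by (simp add: norm_mult mult.commute[of "cmod (r s x)"])
        also have "\<dots> \<le> 2 * (norm (w s x) * (L * norm (w s x) + norm (g s x)))"
          using r[of s x] s t by (intro mult_left_mono) auto
        finally show "norm (cnj (r s x) * w s x - cnj (w s x) * r s x) \<le> 2 * L * (norm (w s x))\<^sup>2 + 2 * norm (w s x) * norm (g s x)"
          by (simp add: algebra_simps power2_eq_square)
      qed
      also have "\<dots> = 2 * L * N s + (LINT x|lborel. 2 * norm (w s x) * norm (g s x))"
        unfolding N_def using exp_decay_integrable[OF eN, of s] exp_decay_integrable[OF e3, of s] by (simp add: mult.assoc)
      also have "\<dots> \<le> 2 * L * N s + K" using K[of s] s t by simp
      finally show "Re (?D s) \<le> 2 * L * N s + K" .
    qed
    moreover have "K * t \<le> K * T" using K0 t by (intro mult_left_mono)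
    ultimately show ?thesis by simp
  qed
  show ?thesis
    using gronwall_integral[OF cN _ T step] L by (simp add: N_def)
qed

section \<open>Exponentially decaying solutions of the cubic-quintic equation\<close>

lemma integrable_compact_support:
  fixes f :: "real^3 \<Rightarrow> 'b::{banach,second_countable_topology}"
  assumes "continuous_on UNIV f" "\<And>x. norm x \<ge> R \<Longrightarrow> f x = 0"
  shows "integrable lborel f"
proof -
  have "integrable lborel (\<lambda>x. indicator (cball 0 R) x *\<^sub>R f x)"
    by (rule borel_integrable_compact) (auto intro: continuous_on_subset[OF assms(1)])
  moreover have "(\<lambda>x. indicator (cball 0 R) x *\<^sub>R f x) = f"
  proof
    show "indicator (cball 0 R) x *\<^sub>R f x = f x" for x
      using assms(2)[of x] by (cases "x \<in> cball 0 R") auto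
  qed
  ultimately show ?thesis by simp
qed

lemma integral_by_parts:
  fixes \<phi> g :: "real^3 \<Rightarrow> complex"
  assumes d: "ddir j \<phi> \<phi>'" "ddir j g g'"
    and c: "continuous_on UNIV \<phi>" "continuous_on UNIV \<phi>'" "continuous_on UNIV g" "continuous_on UNIV g'"
    and z: "\<And>x. norm x \<ge> R \<Longrightarrow> \<phi> x = 0" "\<And>x. norm x \<ge> R \<Longrightarrow> \<phi>' x = 0"
  shows "(LINT x|lborel. \<phi> x * g' x) = - (LINT x|lborel. \<phi>' x * g x)"
proof -
  have "(LINT x|lborel. \<phi> x * g' x + \<phi>' x * g x) = 0"
    by (rule integral_ddir_eq_0[OF ddir_mult[OF d], where R=R]) (auto intro!: continuous_intros c simp: z)
  moreover have "integrable lborel (\<lambda>x. \<phi> x * g' x)" "integrable lborel (\<lambda>x. \<phi>' x * g x)"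
    by (rule integrable_compact_support[where R=R]; auto intro!: continuous_intros c simp: z)+
  ultimately show ?thesis by (simp add: add_eq_0_iff)
qed

lemma Ck2D:
  assumes "Ck 2 v"
  shows "v differentiable (at x)" "pdiff j v differentiable (at x)" "continuous_on S (pdiff k (pdiff j v))"
    "continuous_on S v" "continuous_on S (pdiff j v)" "ddir j v (pdiff j v)" "ddir k (pdiff j v) (pdiff k (pdiff j v))"
proof -
  have *: "v differentiable (at x)" "pdiff j v differentiable (at x)" "continuous_on UNIV (pdiff k (pdiff j v))" for x j k
    using assms by (auto simp: numeral_2_eq_2)
  then show "v differentiable (at x)" "pdiff j v differentiable (at x)" "continuous_on S (pdiff k (pdiff j v))"
    using continuous_on_subset[OF *(3), of S] by auto
  show "continuous_on S v" "continuous_on S (pdiff j v)"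
    using * by (auto intro!: continuous_at_imp_continuous_on differentiable_imp_continuous_within)
  show "ddir j v (pdiff j v)" "ddir k (pdiff j v) (pdiff k (pdiff j v))"
    using * ddir_pdiff unfolding ddir_def by blast+
qed

text \<open>In the density \<open>\<rho> = |z|^2\<close> both powers become polynomial. The factor
  in front of \<open>z\<close> is thereby visibly real, which is what conserves mass.\<close>

definition power_profile :: "real \<Rightarrow> real \<Rightarrow> real \<Rightarrow> real" where
  "power_profile lam1 lam2 \<rho> = lam1 * \<rho> - lam2 * \<rho>\<^sup>2"

definition nonlinearity :: "real \<Rightarrow> real \<Rightarrow> complex \<Rightarrow> complex" where
  "nonlinearity lam1 lam2 z = of_real (power_profile lam1 lam2 ((cmod z)\<^sup>2)) * z"

lemma abs_normsq_diff_le: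
  fixes a b :: complex
  assumes "cmod a \<le> C" "cmod b \<le> C"
  shows "\<bar>(cmod b)\<^sup>2 - (cmod a)\<^sup>2\<bar> \<le> 2 * C * cmod (b - a)"
proof -
  have "(cmod b)\<^sup>2 - (cmod a)\<^sup>2 = (cmod b + cmod a) * (cmod b - cmod a)"
    by (simp add: power2_eq_square algebra_simps)
  moreover have "\<bar>(cmod b + cmod a) * (cmod b - cmod a)\<bar> \<le> (2 * C) * cmod (b - a)"
    unfolding abs_mult using assms norm_triangle_ineq3[of b a] norm_ge_zero[of a] norm_ge_zero[of b] by (intro mult_mono; linarith)
  ultimately show ?thesis by simp
qed

lemma abs_power_profile_diff_le:
  assumes "0 \<le> \<rho>" "\<rho> \<le> D" "0 \<le> \<sigma>" "\<sigma> \<le> D"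
  shows "\<bar>power_profile lam1 lam2 \<sigma> - power_profile lam1 lam2 \<rho>\<bar> \<le> (\<bar>lam1\<bar> + 2 * \<bar>lam2\<bar> * D) * \<bar>\<sigma> - \<rho>\<bar>"
proof -
  have "power_profile lam1 lam2 \<sigma> - power_profile lam1 lam2 \<rho> = (lam1 - lam2 * (\<rho> + \<sigma>)) * (\<sigma> - \<rho>)"
    by (simp add: power_profile_def algebra_simps power2_eq_square)
  moreover have "\<bar>lam1 - lam2 * (\<rho> + \<sigma>)\<bar> \<le> \<bar>lam1\<bar> + 2 * \<bar>lam2\<bar> * D"
  proof -
    have "\<bar>lam2\<bar> * (\<rho> + \<sigma>) \<le> \<bar>lam2\<bar> * (2 * D)" using assms by (intro mult_left_mono) auto
    moreover have "\<bar>lam2 * (\<rho> + \<sigma>)\<bar> = \<bar>lam2\<bar> * (\<rho> + \<sigma>)" using assms by (simp add: abs_mult)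
    ultimately show ?thesis by linarith
  qed
  ultimately show ?thesis by (simp add: abs_mult mult_right_mono)
qed

lemma nonlinearity_lipschitz:
  fixes C :: real
  assumes "C \<ge> 0"
  obtains L where "L \<ge> 0"
    "\<And>a b. cmod a \<le> C \<Longrightarrow> cmod b \<le> C \<Longrightarrow> cmod (nonlinearity lam1 lam2 b - nonlinearity lam1 lam2 a) \<le> L * cmod (b - a)"
    "\<And>a. cmod a \<le> C \<Longrightarrow> \<bar>power_profile lam1 lam2 ((cmod a)\<^sup>2)\<bar> \<le> L"
proof -
  \<comment> \<open>\<open>A\<close> is a Lipschitz constant of the profile on
    \<open>[0, C\<^sup>2]\<close>; as the profile vanishes at 0, \<open>A * C\<^sup>2\<close> bounds
    it there. The two summands of \<open>L\<close> answer to the splitting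
    \<open>k b * (b - a) + (k b - k a) * a\<close>.\<close>
  define A where "A = \<bar>lam1\<bar> + 2 * \<bar>lam2\<bar> * C\<^sup>2"
  define L where "L = A * C\<^sup>2 + A * (2 * C) * C"
  have A: "A \<ge> 0" by (simp add: A_def)
  have L: "L \<ge> 0" "A * C\<^sup>2 \<le> L" using A assms by (auto simp: L_def)
  have sq: "0 \<le> (cmod a)\<^sup>2" "(cmod a)\<^sup>2 \<le> C\<^sup>2" if "cmod a \<le> C" for a
    using that by (auto intro: power_mono)
  have k: "\<bar>power_profile lam1 lam2 ((cmod a)\<^sup>2)\<bar> \<le> A * C\<^sup>2" if "cmod a \<le> C" for a
    using abs_power_profile_diff_le[of 0 "C\<^sup>2" "(cmod a)\<^sup>2" lam1 lam2] sq[OF that] A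
      mult_left_mono[of "(cmod a)\<^sup>2" "C\<^sup>2" A]
    by (simp add: power_profile_def A_def)
  have "cmod (nonlinearity lam1 lam2 b - nonlinearity lam1 lam2 a) \<le> L * cmod (b - a)" if a: "cmod a \<le> C" and b: "cmod b \<le> C" for a b
  proof -
    let ?k = "\<lambda>z. power_profile lam1 lam2 ((cmod z)\<^sup>2)"
    have "nonlinearity lam1 lam2 b - nonlinearity lam1 lam2 a = of_real (?k b) * (b - a) + of_real (?k b - ?k a) * a"
      by (simp add: nonlinearity_def algebra_simps)
    then have "cmod (nonlinearity lam1 lam2 b - nonlinearity lam1 lam2 a) \<le> \<bar>?k b\<bar> * cmod (b - a) + \<bar>?k b - ?k a\<bar> * cmod a"
      using norm_triangle_ineq[of "of_real (?k b) * (b - a)" "of_real (?k b - ?k a) * a"] by (simp add: norm_mult flip: of_real_diff)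
    also have "\<dots> \<le> A * C\<^sup>2 * cmod (b - a) + (A * (2 * C * cmod (b - a))) * C"
    proof (intro add_mono mult_mono)
      show "\<bar>?k b - ?k a\<bar> \<le> A * (2 * C * cmod (b - a))"
        using abs_power_profile_diff_le[OF sq[OF a] sq[OF b], of lam1 lam2]
          mult_left_mono[OF abs_normsq_diff_le[OF a b] A] by (simp add: A_def)
    qed (use k[OF b] a A assms in auto)
    also have "\<dots> = L * cmod (b - a)" by (simp add: L_def algebra_simps)
    finally show ?thesis .
  qed
  with k L that[of L] show ?thesis by (meson order_trans)
qed

text \<open>Decay of \<open>u\<close> itself is what a breather with \<open>\<alpha>' = 0\<close>
  offers, so the time derivative and the space derivatives are merely continuous here. The equation
  is solved for \<open>ut\<close>.\<close>

locale decaying_nls =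
  fixes lam1 lam2 :: real and u ut :: "real \<Rightarrow> real^3 \<Rightarrow> complex"
  assumes C2: "\<And>t. Ck 2 (u t)"
    and ut_continuous: "continuous_on UNIV (\<lambda>(t, x). ut t x)"
    and ut_derivative: "\<And>t x. ((\<lambda>s. u s x) has_vector_derivative ut t x) (at t)"
    and equation: "\<And>t x. ut t x = \<i> * (laplacian (u t) x - nonlinearity lam1 lam2 (u t x))"
    and decay: "\<exists>C \<gamma>. \<gamma> > 0 \<and> (\<forall>t x. cmod (u t x) \<le> C * exp (- \<gamma> * norm x))"
begin

lemma ut_local_bound:
  obtains M where "M \<ge> 0" "\<And>t x. \<bar>t - t0\<bar> \<le> 1 \<Longrightarrow> norm x \<le> R \<Longrightarrow> cmod (ut t x) \<le> M"
proof -
  have "compact ((\<lambda>(t, x). ut t x) ` ({t0 - 1..t0 + 1} \<times> cball 0 R))"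
    by (intro compact_continuous_image continuous_on_subset[OF ut_continuous] compact_Times) auto
  then obtain M where "\<forall>y\<in>(\<lambda>(t, x). ut t x) ` ({t0 - 1..t0 + 1} \<times> cball 0 R). norm y \<le> M"
    by (auto dest!: compact_imp_bounded simp: bounded_iff)
  then have "cmod (ut t x) \<le> \<bar>M\<bar>" if "\<bar>t - t0\<bar> \<le> 1" "norm x \<le> R" for t x
  proof -
    have "(t, x) \<in> {t0 - 1..t0 + 1} \<times> cball 0 R" using that by (auto simp: abs_le_iff)
    with \<open>\<forall>y\<in>_. norm y \<le> M\<close> have "cmod (ut t x) \<le> M" by (metis (no_types, lifting) case_prod_conv image_eqI)
    then show ?thesis by simp
  qed
  then show ?thesis using that[of "\<bar>M\<bar>"] by auto
qed

text \<open>A solution is given by regular slices and a jointly continuous time derivative. The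
  latter is locally bounded, which makes \<open>u\<close> locally Lipschitz in time, uniformly for
  nearby points of space; continuity of the slice at \<open>t0\<close> does the rest.\<close>

lemma u_continuous: "continuous_on UNIV (\<lambda>(t, x). u t x)"
proof -
  have "continuous (at (t0, x0)) (\<lambda>(t, x). u t x)" for t0 x0
    unfolding continuous_at
  proof -
    obtain M where M: "M \<ge> 0" "\<And>t x. \<bar>t - t0\<bar> \<le> 1 \<Longrightarrow> norm x \<le> norm x0 + 1 \<Longrightarrow> cmod (ut t x) \<le> M"
      using ut_local_bound by metis
    have ev: "\<forall>\<^sub>F p in at (t0, x0). cmod (u (fst p) (snd p) - u t0 (snd p)) \<le> M * \<bar>fst p - t0\<bar>"
    proof -
      have "cmod (u (fst p) (snd p) - u t0 (snd p)) \<le> M * \<bar>fst p - t0\<bar>" if "dist p (t0, x0) < 1" for p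
      proof (rule mean_value_bound[where f'="\<lambda>t. ut t (snd p)"])
        fix s assume "s \<in> closed_segment t0 (fst p)"
        moreover have "\<bar>fst p - t0\<bar> \<le> 1" using that dist_fst_le[of p "(t0, x0)"] by (simp add: dist_real_def)
        ultimately have "\<bar>s - t0\<bar> \<le> 1" by (auto simp: closed_segment_eq_real_ivl split: if_splits)
        moreover have "norm (snd p) \<le> norm x0 + 1"
          using that dist_snd_le[of p "(t0, x0)"] norm_triangle_ineq2[of "snd p" x0] by (simp add: dist_norm)
        ultimately show "cmod (ut s (snd p)) \<le> M" by (rule M(2))
      qed (rule ut_derivative)
      then show ?thesis by (auto simp: eventually_at intro!: exI[of _ 1])
    qed
    have "((\<lambda>p. M * \<bar>fst p - t0\<bar>) \<longlongrightarrow> M * \<bar>fst (t0, x0) - t0\<bar>) (at (t0, x0))"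
      by (intro tendsto_intros)
    then have "((\<lambda>p. M * \<bar>fst p - t0\<bar>) \<longlongrightarrow> 0) (at (t0, x0))" by simp
    from Lim_null_comparison[OF ev this]
    have 1: "((\<lambda>p. u (fst p) (snd p) - u t0 (snd p)) \<longlongrightarrow> 0) (at (t0, x0))" .
    have "isCont (u t0) x0" using Ck2D(4)[OF C2, of UNIV t0] by (simp add: continuous_on_eq_continuous_at)
    then have 2: "((\<lambda>p. u t0 (snd p)) \<longlongrightarrow> u t0 x0) (at (t0, x0))"
      by (intro isCont_tendsto_compose[of _ "u t0"]) (auto intro!: tendsto_eq_intros)
    from tendsto_add[OF 1 2] show "((\<lambda>(t, x). u t x) \<longlongrightarrow> (case (t0, x0) of (t, x) \<Rightarrow> u t x)) (at (t0, x0))"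
      by (simp add: split_def)
  qed
  then show ?thesis by (auto intro: continuous_at_imp_continuous_on)
qed

lemma exp_decay_u: "exp_decay u"
  using u_continuous decay by (simp add: exp_decay_def)

abbreviation "f t x \<equiv> nonlinearity lam1 lam2 (u t x)"

lemma exp_decay_profile: "exp_decay (\<lambda>t x. complex_of_real (power_profile lam1 lam2 ((cmod (u t x))\<^sup>2)))"
proof -
  have "exp_decay (\<lambda>t x. lam1 * (cmod (u t x))\<^sup>2 - lam2 * ((cmod (u t x))\<^sup>2)\<^sup>2)"
    by (intro exp_decay_diff exp_decay_cmult exp_decay_power exp_decay_norm exp_decay_u) auto
  from exp_decay_of_real[OF this] show ?thesis by (simp add: power_profile_def)
qed

lemma exp_decay_f: "exp_decay f"
  unfolding nonlinearity_def by (intro exp_decay_mult exp_decay_profile exp_decay_u)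

lemma laplacian_u: "laplacian (u t) x = f t x - \<i> * ut t x"
  unfolding equation by (simp add: right_diff_distrib flip: mult.assoc)

lemma laplacian_continuous: "continuous_on UNIV (\<lambda>(t, x). laplacian (u t) x)"
proof -
  have "continuous_on UNIV (\<lambda>p. (case p of (t, x) \<Rightarrow> f t x) - \<i> * (case p of (t, x) \<Rightarrow> ut t x))"
    by (intro continuous_intros exp_decay_continuous[OF exp_decay_f] ut_continuous)
  then show ?thesis by (simp add: laplacian_u split_def)
qed

text \<open>Nothing bounds \<open>ut\<close> at infinity; the bounded support of
  \<open>\<phi>\<close> reduces the majorant to \<open>ut_local_bound\<close>.\<close>

lemma test_pairing_derivative:
  assumes \<phi>: "continuous_on UNIV \<phi>" and z: "\<And>x. norm x \<ge> R \<Longrightarrow> \<phi> x = 0"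
  shows "((\<lambda>t. LINT x|lborel. \<phi> x * u t x) has_vector_derivative (LINT x|lborel. \<phi> x * ut t0 x)) (at t0)"
proof -
  obtain M where M: "M \<ge> 0" "\<And>t x. \<bar>t - t0\<bar> \<le> 1 \<Longrightarrow> norm x \<le> R \<Longrightarrow> cmod (ut t x) \<le> M"
    using ut_local_bound by metis
  show ?thesis
  proof (rule has_vector_derivative_integral[where w="\<lambda>x. M * cmod (\<phi> x)"])
    show "((\<lambda>t. \<phi> x * u t x) has_vector_derivative \<phi> x * ut t x) (at t)" for t x
      by (intro has_vector_derivative_mult_right ut_derivative)
    show "norm (\<phi> x * ut t x) \<le> M * cmod (\<phi> x)" if "\<bar>t - t0\<bar> \<le> 1" for t x
    proof (cases "norm x \<ge> R")
      case False
      then show ?thesis using M(2)[OF that, of x] by (simp add: norm_mult mult.commute[of M] mult_left_mono)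
    qed (simp add: z)
    show "integrable lborel (\<lambda>x. \<phi> x * u t x)" for t
      by (rule integrable_compact_support[where R=R]) (auto intro!: continuous_intros \<phi> exp_decay_slice(1)[OF exp_decay_u] simp: z)
    have "continuous_on UNIV (\<lambda>x. \<phi> x * ut t0 x)"
      by (intro continuous_intros \<phi> joint_continuous_slice(1)[OF ut_continuous])
    then show "(\<lambda>x. \<phi> x * ut t0 x) \<in> borel_measurable borel" by (rule borel_measurable_continuous_onI)
    show "integrable lborel (\<lambda>x. M * cmod (\<phi> x))"
      by (rule integrable_compact_support[where R=R]) (auto intro!: continuous_intros \<phi> simp: z)
  qed
qed

text \<open>Two integrations by parts against a translated and dilated bump put both derivatives on
  the bump, each at the price of \<open>1 / \<epsilon>\<close>.\<close>

lemma weak_u: "weak_schrodinger u f"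
proof (rule weak_schrodingerI[OF exp_decay_u exp_decay_f])
  fix \<epsilon> :: real and z t assume \<epsilon>: "\<epsilon> > 0"
  define \<phi> where "\<phi> y = complex_of_real (bump ((1 / \<epsilon>) *\<^sub>R (y - z)))" for y
  define \<phi>1 where "\<phi>1 j y = complex_of_real ((1 / \<epsilon>) *\<^sub>R bump_d j ((1 / \<epsilon>) *\<^sub>R (y - z)))" for j y
  define \<phi>2 where "\<phi>2 j y = complex_of_real ((1 / \<epsilon>) *\<^sub>R (1 / \<epsilon>) *\<^sub>R bump_dd j ((1 / \<epsilon>) *\<^sub>R (y - z)))" for j y
  have d: "ddir j \<phi> (\<phi>1 j)" for j
    unfolding \<phi>_def[abs_def] \<phi>1_def[abs_def] by (rule ddir_of_real[OF ddir_affine[OF ddir_bump]])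
  have d': "ddir j (\<phi>1 j) (\<phi>2 j)" for j
  proof -
    have "ddir j (\<lambda>x. (1 / \<epsilon>) *\<^sub>R bump_d j ((1 / \<epsilon>) *\<^sub>R (x - z))) (\<lambda>x. (1 / \<epsilon>) *\<^sub>R (1 / \<epsilon>) *\<^sub>R bump_dd j ((1 / \<epsilon>) *\<^sub>R (x - z)))"
      using ddir_affine[OF ddir_bump_d, of j "1 / \<epsilon>" z] unfolding ddir_def
      by (intro allI bounded_linear.has_vector_derivative[OF bounded_linear_scaleR_right]) blast
    from ddir_of_real[OF this] show ?thesis unfolding \<phi>1_def[abs_def] \<phi>2_def[abs_def] .
  qed
  define R where "R = norm z + \<epsilon>"
  have big: "norm ((1 / \<epsilon>) *\<^sub>R (y - z)) \<ge> 1" if "norm y \<ge> R" for y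
  proof -
    have "norm (y - z) \<ge> \<epsilon>" using that norm_triangle_ineq2[of y z] by (simp add: R_def)
    then show ?thesis using \<epsilon> by (simp add: divide_simps)
  qed
  have zero: "\<phi> y = 0" "\<phi>1 j y = 0" "\<phi>2 j y = 0" if "norm y \<ge> R" for y j
    using bump_eq_0[OF big[OF that]] by (simp_all add: \<phi>_def \<phi>1_def \<phi>2_def)
  have aff: "continuous_on UNIV (\<lambda>y. (1 / \<epsilon>) *\<^sub>R (y - z))" by (intro continuous_intros)
  note comp = continuous_on_compose2[OF continuous_bump(1) aff subset_UNIV] continuous_on_compose2[OF continuous_bump(2) aff subset_UNIV]
    continuous_on_compose2[OF continuous_bump(3) aff subset_UNIV]
  have cont: "continuous_on UNIV \<phi>" "continuous_on UNIV (\<phi>1 j)" "continuous_on UNIV (\<phi>2 j)" for j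
    unfolding \<phi>_def[abs_def] \<phi>1_def[abs_def] \<phi>2_def[abs_def]
    by (intro continuous_on_of_real continuous_on_scaleR continuous_on_const comp)+
  have ibp: "(LINT x|lborel. \<phi> x * pdiff j (pdiff j (u t)) x) = (LINT x|lborel. \<phi>2 j x * u t x)" for j
    using integral_by_parts[OF d Ck2D(7)[OF C2] cont(1,2) Ck2D(5)[OF C2] Ck2D(3)[OF C2] zero(1,2)]
      integral_by_parts[OF d' Ck2D(6)[OF C2] cont(2,3) Ck2D(4)[OF C2] Ck2D(5)[OF C2] zero(2,3)]
    by simp
  have i1: "integrable lborel (\<lambda>x. \<phi> x * laplacian (u t) x)"
    by (rule integrable_compact_support[where R=R])
      (auto intro!: continuous_intros cont joint_continuous_slice(1)[OF laplacian_continuous] simp: zero)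
  have i2: "integrable lborel (\<lambda>x. \<phi> x * f t x)"
    by (rule integrable_compact_support[where R=R])
      (auto intro!: continuous_intros cont exp_decay_slice(1)[OF exp_decay_f] simp: zero)
  have "(LINT x|lborel. \<phi> x * laplacian (u t) x) = (\<Sum>j\<in>UNIV. LINT x|lborel. \<phi> x * pdiff j (pdiff j (u t)) x)"
    unfolding laplacian_def sum_distrib_left
    by (rule Bochner_Integration.integral_sum)
      (rule integrable_compact_support[where R=R], auto intro!: continuous_intros cont Ck2D(3)[OF C2] simp: zero)
  also have "\<dots> = (LINT x|lborel. (\<Sum>j\<in>UNIV. \<phi>2 j x * u t x))"
    unfolding ibp
    by (rule Bochner_Integration.integral_sum[symmetric])
      (rule integrable_compact_support[where R=R], auto intro!: continuous_intros cont Ck2D(4)[OF C2] simp: zero)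
  also have "\<dots> = (LINT x|lborel. of_real (1 / \<epsilon>\<^sup>2) * (of_real (bump_laplacian ((1 / \<epsilon>) *\<^sub>R (x - z))) * u t x))"
    by (rule Bochner_Integration.integral_cong[OF refl])
      (simp add: \<phi>2_def bump_laplacian_def sum_distrib_right sum_distrib_left power2_eq_square sum_divide_distrib)
  also have "\<dots> = of_real (1 / \<epsilon>\<^sup>2) * cv bump_laplacian \<epsilon> (u t) z"
    unfolding cv_def by (rule integral_mult_right_zero)
  finally have lap: "(LINT x|lborel. \<phi> x * laplacian (u t) x) = of_real (1 / \<epsilon>\<^sup>2) * cv bump_laplacian \<epsilon> (u t) z" .
  have "(LINT x|lborel. \<phi> x * ut t x) = (LINT x|lborel. \<i> * (\<phi> x * laplacian (u t) x - \<phi> x * f t x))"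
    by (rule Bochner_Integration.integral_cong[OF refl]) (simp add: equation algebra_simps)
  also have "\<dots> = \<i> * ((LINT x|lborel. \<phi> x * laplacian (u t) x) - (LINT x|lborel. \<phi> x * f t x))"
    using i1 i2 by simp
  finally have "(LINT x|lborel. \<phi> x * ut t x) = \<i> * (of_real (1 / \<epsilon>\<^sup>2) * cv bump_laplacian \<epsilon> (u t) z - cv bump \<epsilon> (f t) z)"
    unfolding lap by (simp add: cv_def \<phi>_def)
  then show "((\<lambda>t. cv bump \<epsilon> (u t) z) has_vector_derivative
      \<i> * (of_real (1 / \<epsilon>\<^sup>2) * cv bump_laplacian \<epsilon> (u t) z - cv bump \<epsilon> (f t) z)) (at t)"
    using test_pairing_derivative[OF cont(1) zero(1), where ?t0.0=t] by (simp add: cv_def \<phi>_def)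
qed

text \<open>\<open>cnj (f t x) * u t x\<close> is real, so the two pairings coincide and the time
  integrand vanishes. No gradient is involved.\<close>

lemma mass_conservation:
  assumes "t \<ge> 0" shows "mass (u t) = mass (u 0)"
proof -
  have "(LINT x|lborel. cnj (f t x) * u t x) = (LINT x|lborel. cnj (u t x) * f t x)" for t
    by (rule Bochner_Integration.integral_cong[OF refl]) (simp add: nonlinearity_def)
  then have "((\<lambda>t. 0::complex) has_integral
     (LINT x|lborel. cnj (u t x) * u t x) - (LINT x|lborel. cnj (u 0 x) * u 0 x)) {0..t}"
    using weak_schrodinger_pairing[OF weak_u weak_u assms] by simp
  then have "(LINT x|lborel. cnj (u t x) * u t x) = (LINT x|lborel. cnj (u 0 x) * u 0 x)"
    using has_integral_unique[OF has_integral_0] by fastforce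
  moreover have "(LINT x|lborel. cnj (u t x) * u t x) = of_real (mass (u t))" for t
    unfolding mass_def integral_complex_of_real[symmetric]
    by (rule Bochner_Integration.integral_cong[OF refl]) (simp only: complex_norm_square mult.commute)
  ultimately show ?thesis by simp
qed

end

section \<open>Square integrability of the gradient\<close>

text \<open>Values in \<open>ennreal\<close> let integrals be exchanged later, before any integral
  of the derivative is known to be finite.\<close>

lemma norm_increment_le_nn_integral:
  fixes h :: "real \<Rightarrow> complex"
  assumes ab: "a \<le> b" and d: "\<And>r. (h has_vector_derivative h' r) (at r)" and c: "continuous_on UNIV h'"
  shows "ennreal (cmod (h b - h a)) \<le> (\<integral>\<^sup>+r. ennreal (cmod (h' r)) * indicator {a..b} r \<partial>lborel)"
proof -
  have hb: "has_bochner_integral lborel (\<lambda>r. indicator {a..b} r *\<^sub>R h' r) (h b - h a)"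
    by (rule has_bochner_integral_FTC_Icc[OF ab])
      (auto intro: has_vector_derivative_at_within[OF d] continuous_on_subset[OF c])
  then have "h b - h a = (LINT r|lborel. indicator {a..b} r *\<^sub>R h' r)" "integrable lborel (\<lambda>r. indicator {a..b} r *\<^sub>R h' r)"
    by (auto simp: has_bochner_integral_iff)
  then have "ennreal (cmod (h b - h a)) \<le> (\<integral>\<^sup>+r. ennreal (cmod (indicator {a..b} r *\<^sub>R h' r)) \<partial>lborel)"
    using integral_norm_bound_ennreal by metis
  also have "\<dots> = (\<integral>\<^sup>+r. ennreal (cmod (h' r)) * indicator {a..b} r \<partial>lborel)"
    by (intro nn_integral_cong) (auto simp: indicator_def)
  finally show ?thesis .
qed

text \<open>Cauchy-Schwarz along the segment, exchange of integrals, translation invariance.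
  Together with \<open>gradient_bound_of_translations\<close> it expresses square integrability of a
  derivative through translates; these are again solutions, so the property can be carried along the
  flow without differentiating the equation.\<close>

lemma translation_increment:
  fixes g :: "real^3 \<Rightarrow> complex"
  assumes d: "ddir j g g'" and g: "continuous_on UNIV g'" and e: "\<epsilon> \<ge> 0"
  shows "(\<integral>\<^sup>+x. ennreal ((cmod (g (\<epsilon> *\<^sub>R axis j 1 + x) - g x))\<^sup>2) \<partial>lborel)
    \<le> ennreal (\<epsilon>\<^sup>2) * (\<integral>\<^sup>+x. ennreal ((cmod (g' x))\<^sup>2) \<partial>lborel)"
proof -
  let ?e = "axis j 1 :: real^3"
  have cl: "continuous_on UNIV (\<lambda>r. g' (x + r *\<^sub>R ?e))" for x
    by (rule continuous_on_compose2[OF g]) (auto intro!: continuous_intros)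
  have [measurable]: "g' \<in> borel_measurable borel" using g by (rule borel_measurable_continuous_onI)
  have [measurable]: "(\<lambda>r. g' (x + r *\<^sub>R ?e)) \<in> borel_measurable borel" for x
    using cl by (rule borel_measurable_continuous_onI)
  have pt: "ennreal ((cmod (g (\<epsilon> *\<^sub>R ?e + x) - g x))\<^sup>2)
     \<le> ennreal \<epsilon> * (\<integral>\<^sup>+r. ennreal ((cmod (g' (x + r *\<^sub>R ?e)))\<^sup>2) * indicator {0..\<epsilon>} r \<partial>lborel)" for x
  proof -
    have "ennreal (cmod (g (\<epsilon> *\<^sub>R ?e + x) - g x)) \<le> (\<integral>\<^sup>+r. ennreal (cmod (g' (x + r *\<^sub>R ?e))) * indicator {0..\<epsilon>} r \<partial>lborel)"
      using norm_increment_le_nn_integral[OF e ddirD[OF d] cl, of x] by (simp add: add.commute)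
    also have "\<dots> = (\<integral>\<^sup>+r. (ennreal (cmod (g' (x + r *\<^sub>R ?e))) * indicator {0..\<epsilon>} r) * indicator {0..\<epsilon>} r \<partial>lborel)"
      by (intro nn_integral_cong) (auto simp: indicator_def)
    finally have "ennreal ((cmod (g (\<epsilon> *\<^sub>R ?e + x) - g x))\<^sup>2)
      \<le> (\<integral>\<^sup>+r. (ennreal (cmod (g' (x + r *\<^sub>R ?e))) * indicator {0..\<epsilon>} r) * indicator {0..\<epsilon>} r \<partial>lborel)\<^sup>2"
      by (simp add: ennreal_power[symmetric] power_mono)
    also have "\<dots> \<le> (\<integral>\<^sup>+r. (ennreal (cmod (g' (x + r *\<^sub>R ?e))) * indicator {0..\<epsilon>} r)\<^sup>2 \<partial>lborel) * (\<integral>\<^sup>+r. (indicator {0..\<epsilon>} r)\<^sup>2 \<partial>lborel)"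
      by (rule Cauchy_Schwarz_nn_integral) auto
    also have "(\<integral>\<^sup>+r. (indicator {0..\<epsilon>} r)\<^sup>2 \<partial>lborel) = (\<integral>\<^sup>+r. indicator {0..\<epsilon>} r \<partial>lborel)"
      by (intro nn_integral_cong) (auto simp: indicator_def)
    also have "\<dots> = ennreal \<epsilon>" using e by simp
    also have "(\<integral>\<^sup>+r. (ennreal (cmod (g' (x + r *\<^sub>R ?e))) * indicator {0..\<epsilon>} r)\<^sup>2 \<partial>lborel)
      = (\<integral>\<^sup>+r. ennreal ((cmod (g' (x + r *\<^sub>R ?e)))\<^sup>2) * indicator {0..\<epsilon>} r \<partial>lborel)"
      by (intro nn_integral_cong) (auto simp: indicator_def ennreal_power)
    finally show ?thesis by (simp add: mult.commute)
  qed
  have "continuous_on UNIV (\<lambda>p. g' (fst p + snd p *\<^sub>R ?e))"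
    by (rule continuous_on_compose2[OF g]) (auto intro!: continuous_intros)
  then have [measurable]: "(\<lambda>p. g' (fst p + snd p *\<^sub>R ?e)) \<in> borel_measurable (lborel \<Otimes>\<^sub>M lborel)"
    by (simp add: lborel_prod borel_measurable_continuous_onI)
  have "(\<integral>\<^sup>+x. ennreal ((cmod (g (\<epsilon> *\<^sub>R ?e + x) - g x))\<^sup>2) \<partial>lborel)
    \<le> (\<integral>\<^sup>+x. ennreal \<epsilon> * (\<integral>\<^sup>+r. ennreal ((cmod (g' (x + r *\<^sub>R ?e)))\<^sup>2) * indicator {0..\<epsilon>} r \<partial>lborel) \<partial>lborel)"
    by (intro nn_integral_mono pt)
  also have "\<dots> = ennreal \<epsilon> * (\<integral>\<^sup>+x. (\<integral>\<^sup>+r. ennreal ((cmod (g' (x + r *\<^sub>R ?e)))\<^sup>2) * indicator {0..\<epsilon>} r \<partial>lborel) \<partial>lborel)"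
    by (rule nn_integral_cmult) measurable
  also have "(\<integral>\<^sup>+x. (\<integral>\<^sup>+r. ennreal ((cmod (g' (x + r *\<^sub>R ?e)))\<^sup>2) * indicator {0..\<epsilon>} r \<partial>lborel) \<partial>lborel)
    = (\<integral>\<^sup>+r. (\<integral>\<^sup>+x. ennreal ((cmod (g' (x + r *\<^sub>R ?e)))\<^sup>2) * indicator {0..\<epsilon>} r \<partial>lborel) \<partial>lborel)"
    by (rule lborel_pair.Fubini'[symmetric]) measurable
  also have "\<dots> = (\<integral>\<^sup>+r. (\<integral>\<^sup>+x. ennreal ((cmod (g' x))\<^sup>2) \<partial>lborel) * indicator {0..\<epsilon>} r \<partial>lborel)"
  proof (rule nn_integral_cong)
    fix r
    have "(\<integral>\<^sup>+x. ennreal ((cmod (g' (x + r *\<^sub>R ?e)))\<^sup>2) * indicator {0..\<epsilon>} r \<partial>lborel)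
       = (\<integral>\<^sup>+x. ennreal ((cmod (g' (r *\<^sub>R ?e + x)))\<^sup>2) \<partial>lborel) * indicator {0..\<epsilon>} r"
      by (subst nn_integral_multc[symmetric]) (auto simp: add.commute)
    also have "(\<integral>\<^sup>+x. ennreal ((cmod (g' (r *\<^sub>R ?e + x)))\<^sup>2) \<partial>lborel) = (\<integral>\<^sup>+x. ennreal ((cmod (g' x))\<^sup>2) \<partial>lborel)"
      by (rule nn_integral_translate) simp
    finally show "(\<integral>\<^sup>+x. ennreal ((cmod (g' (x + r *\<^sub>R ?e)))\<^sup>2) * indicator {0..\<epsilon>} r \<partial>lborel) =
       (\<integral>\<^sup>+x. ennreal ((cmod (g' x))\<^sup>2) \<partial>lborel) * indicator {0..\<epsilon>} r" .
  qed
  also have "\<dots> = (\<integral>\<^sup>+x. ennreal ((cmod (g' x))\<^sup>2) \<partial>lborel) * ennreal \<epsilon>"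
    using e by (subst nn_integral_cmult) auto
  also have "ennreal \<epsilon> * ((\<integral>\<^sup>+x. ennreal ((cmod (g' x))\<^sup>2) \<partial>lborel) * ennreal \<epsilon>) = ennreal (\<epsilon>\<^sup>2) * (\<integral>\<^sup>+x. ennreal ((cmod (g' x))\<^sup>2) \<partial>lborel)"
    using e by (simp add: power2_eq_square ennreal_mult mult_ac)
  finally show ?thesis .
qed

text \<open>Fatou along the steps \<open>1 / (n + 1)\<close>: the squared difference quotients
  converge to the squared derivative while their integrals stay below \<open>K\<close>.\<close>

lemma gradient_bound_of_translations:
  fixes g :: "real^3 \<Rightarrow> complex"
  assumes d: "ddir j g g'" and m: "continuous_on UNIV g"
    and b: "\<And>\<epsilon>. 0 < \<epsilon> \<Longrightarrow> \<epsilon> \<le> 1 \<Longrightarrow> (\<integral>\<^sup>+x. ennreal ((cmod (g (\<epsilon> *\<^sub>R axis j 1 + x) - g x))\<^sup>2) \<partial>lborel) \<le> ennreal (\<epsilon>\<^sup>2) * K"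
  shows "(\<integral>\<^sup>+x. ennreal ((cmod (g' x))\<^sup>2) \<partial>lborel) \<le> K"
proof -
  let ?e = "axis j 1 :: real^3"
  define X where "X n x = ennreal ((cmod ((g (x + (1 / real (Suc n)) *\<^sub>R ?e) - g x) /\<^sub>R (1 / real (Suc n))))\<^sup>2)" for n x
  have [measurable]: "g \<in> borel_measurable borel" using m by (rule borel_measurable_continuous_onI)
  have [measurable]: "X n \<in> borel_measurable lborel" for n unfolding X_def by measurable
  have lim: "(\<lambda>n. X n x) \<longlonglongrightarrow> ennreal ((cmod (g' x))\<^sup>2)" for x
  proof -
    have "((\<lambda>h. (g (x + h *\<^sub>R ?e) - g x) /\<^sub>R h) \<longlongrightarrow> g' x) (at 0)"
      using d by (simp add: ddir_def has_vector_derivative_iff_quotient)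
    moreover have "filterlim (\<lambda>n. 1 / real (Suc n)) (at 0) sequentially"
      using LIMSEQ_Suc[OF lim_1_over_n] by (auto simp: filterlim_at)
    ultimately have "(\<lambda>n. (g (x + (1 / real (Suc n)) *\<^sub>R ?e) - g x) /\<^sub>R (1 / real (Suc n))) \<longlonglongrightarrow> g' x"
      by (rule filterlim_compose)
    then show ?thesis unfolding X_def by (intro tendsto_ennrealI tendsto_power tendsto_norm)
  qed
  have bd: "(\<integral>\<^sup>+x. X n x \<partial>lborel) \<le> K" for n
  proof -
    define \<epsilon> where "\<epsilon> = 1 / real (Suc n)"
    have \<epsilon>: "0 < \<epsilon>" "\<epsilon> \<le> 1" by (auto simp: \<epsilon>_def)
    have "(\<integral>\<^sup>+x. X n x \<partial>lborel) = (\<integral>\<^sup>+x. ennreal (inverse (\<epsilon>\<^sup>2)) * ennreal ((cmod (g (\<epsilon> *\<^sub>R ?e + x) - g x))\<^sup>2) \<partial>lborel)"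
    proof (intro nn_integral_cong)
      fix x
      have "(cmod ((g (x + \<epsilon> *\<^sub>R ?e) - g x) /\<^sub>R \<epsilon>))\<^sup>2 = inverse (\<epsilon>\<^sup>2) * (cmod (g (\<epsilon> *\<^sub>R ?e + x) - g x))\<^sup>2"
        using \<epsilon> by (simp add: power_mult_distrib power_inverse add.commute)
      then have "X n x = ennreal (inverse (\<epsilon>\<^sup>2) * (cmod (g (\<epsilon> *\<^sub>R ?e + x) - g x))\<^sup>2)"
        unfolding X_def \<epsilon>_def[symmetric] by (simp only:)
      also have "\<dots> = ennreal (inverse (\<epsilon>\<^sup>2)) * ennreal ((cmod (g (\<epsilon> *\<^sub>R ?e + x) - g x))\<^sup>2)"
        by (rule ennreal_mult) auto
      finally show "X n x = ennreal (inverse (\<epsilon>\<^sup>2)) * ennreal ((cmod (g (\<epsilon> *\<^sub>R ?e + x) - g x))\<^sup>2)" .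
    qed
    also have "\<dots> = ennreal (inverse (\<epsilon>\<^sup>2)) * (\<integral>\<^sup>+x. ennreal ((cmod (g (\<epsilon> *\<^sub>R ?e + x) - g x))\<^sup>2) \<partial>lborel)"
      by (rule nn_integral_cmult) measurable
    also have "\<dots> \<le> ennreal (inverse (\<epsilon>\<^sup>2)) * (ennreal (\<epsilon>\<^sup>2) * K)"
      by (intro mult_left_mono b \<epsilon>) auto
    also have "\<dots> = ennreal (inverse (\<epsilon>\<^sup>2) * \<epsilon>\<^sup>2) * K"
      by (simp add: mult.assoc[symmetric] ennreal_mult)
    also have "\<dots> = K" using \<epsilon> by simp
    finally show ?thesis .
  qed
  have "(\<integral>\<^sup>+x. ennreal ((cmod (g' x))\<^sup>2) \<partial>lborel) = (\<integral>\<^sup>+x. liminf (\<lambda>n. X n x) \<partial>lborel)"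
    using lim_imp_Liminf[OF _ lim] by simp
  also have "\<dots> \<le> liminf (\<lambda>n. \<integral>\<^sup>+x. X n x \<partial>lborel)" by (rule nn_integral_liminf) simp
  also have "\<dots> \<le> K" using bd by (intro Liminf_le) (auto intro!: always_eventually)
  finally show ?thesis .
qed

lemma has_vector_derivative_ray:
  assumes "\<And>x. v differentiable (at x)"
  shows "((\<lambda>r. v (r *\<^sub>R x)) has_vector_derivative (\<Sum>j\<in>UNIV. of_real (x $ j) * pdiff j v (r *\<^sub>R x))) (at r)"
proof -
  let ?F = "frechet_derivative v (at (r *\<^sub>R x))"
  have hd: "(v has_derivative ?F) (at (r *\<^sub>R x))"
    using assms by (simp add: frechet_derivative_works)
  moreover have "((\<lambda>r. r *\<^sub>R x) has_vector_derivative x) (at r)"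
    by (auto intro!: derivative_eq_intros)
  ultimately have "((v \<circ> (\<lambda>r. r *\<^sub>R x)) has_vector_derivative ?F x) (at r)"
    by (intro vector_derivative_diff_chain_within) (auto intro: has_derivative_at_withinI)
  moreover have "?F x = (\<Sum>j\<in>UNIV. of_real (x $ j) * pdiff j v (r *\<^sub>R x))"
  proof -
    interpret bounded_linear ?F by (rule has_derivative_bounded_linear[OF hd])
    have "?F x = ?F (\<Sum>j\<in>UNIV. x $ j *\<^sub>R axis j 1)"
      by (simp only: basis_expansion[of x, unfolded scalar_mult_eq_scaleR])
    also have "\<dots> = (\<Sum>j\<in>UNIV. x $ j *\<^sub>R ?F (axis j 1))" by (simp add: sum scaleR)
    finally show ?thesis by (simp add: pdiff_def scaleR_conv_of_real)
  qed
  ultimately show ?thesis by (simp add: o_def)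
qed

lemma sq_exp_le:
  fixes \<gamma> r :: real
  assumes "\<gamma> > 0" "r \<ge> 0"
  shows "r\<^sup>2 * exp (- 2 * \<gamma> * r) \<le> 2 / \<gamma>\<^sup>2 * exp (- \<gamma> * r)"
proof -
  have "(\<gamma> * r)\<^sup>2 \<le> 2 * exp (\<gamma> * r)"
    using exp_lower_Taylor_quadratic[of "\<gamma> * r"] mult_nonneg_nonneg[of \<gamma> r] assms by linarith
  then have "r\<^sup>2 \<le> 2 / \<gamma>\<^sup>2 * exp (\<gamma> * r)" using assms by (simp add: field_simps power_mult_distrib)
  then have "r\<^sup>2 * exp (- 2 * \<gamma> * r) \<le> 2 / \<gamma>\<^sup>2 * exp (\<gamma> * r) * exp (- 2 * \<gamma> * r)" by (intro mult_right_mono) auto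
  also have "\<dots> = 2 / \<gamma>\<^sup>2 * exp (- \<gamma> * r)" by (simp add: mult.assoc flip: exp_add)
  finally show ?thesis .
qed

text \<open>Bounding both factors of the square by the increment along the ray would give
  \<open>(s - 1)\<^sup>2\<close>, but needs \<open>x \<cdot> \<nabla>v\<close> in
  \<open>L^2\<close>. Instead one factor is bounded by the decay of \<open>v\<close>, which absorbs
  the weight \<open>norm x\<close>, and the other yields a single factor
  \<open>s - 1\<close>.\<close>

lemma dilation_increment:
  fixes v :: "real^3 \<Rightarrow> complex"
  assumes C2: "Ck 2 v" and dec: "\<gamma> > 0" "\<And>x. cmod (v x) \<le> C * exp (- \<gamma> * norm x)"
    and grad: "\<And>j. (\<integral>\<^sup>+x. ennreal ((cmod (pdiff j v x))\<^sup>2) \<partial>lborel) < \<infinity>"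
  obtains K where "K \<ge> 0" "\<And>s. s \<ge> 1 \<Longrightarrow> (\<integral>\<^sup>+x. ennreal ((cmod (v (s *\<^sub>R x) - v x))\<^sup>2) \<partial>lborel) \<le> ennreal ((s - 1) * K)"
proof -
  note D = Ck2D[OF C2]
  \<comment> \<open>The decaying half of \<open>2 a b \<le> a\<^sup>2 + b\<^sup>2\<close> as applied
    in \<open>hB\<close>: 3 counts the coordinates, \<open>2 / \<gamma>\<^sup>2\<close> comes from
    \<open>sq_exp_le\<close>.\<close>
  define W where "W x = 3 * C\<^sup>2 * (2 / \<gamma>\<^sup>2 * exp (- \<gamma> * norm x))" for x :: "real^3"
  define G where "G x = (\<Sum>j\<in>UNIV. (cmod (pdiff j v x))\<^sup>2)" for x
  have C: "C \<ge> 0" using dec(2)[of 0] norm_ge_zero[of "v 0"] by (simp del: norm_ge_zero)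
  have W0: "W x \<ge> 0" and G0: "G x \<ge> 0" for x by (auto simp: W_def G_def sum_nonneg)
  have cG: "continuous_on UNIV G" unfolding G_def by (intro continuous_intros D)
  have [measurable]: "G \<in> borel_measurable borel" using cG by (rule borel_measurable_continuous_onI)
  have [measurable]: "W \<in> borel_measurable borel" unfolding W_def by measurable
  have fG: "(\<integral>\<^sup>+x. ennreal (G x) \<partial>lborel) < \<infinity>"
  proof -
    have [measurable]: "pdiff j v \<in> borel_measurable borel" for j
      using D(5) by (rule borel_measurable_continuous_onI)
    have "(\<integral>\<^sup>+x. ennreal (G x) \<partial>lborel) = (\<Sum>j\<in>UNIV. (\<integral>\<^sup>+x. ennreal ((cmod (pdiff j v x))\<^sup>2) \<partial>lborel))"
      unfolding G_def by (subst nn_integral_sum[symmetric]) (auto simp: sum_ennreal)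
    also have "\<dots> < \<infinity>" using grad by simp
    finally show ?thesis .
  qed
  have fW: "(\<integral>\<^sup>+x. ennreal (W x) \<partial>lborel) < \<infinity>"
  proof -
    have "integrable lborel W" unfolding W_def
      using integrable_exp_norm[OF dec(1), where 'a="real^3"] by simp
    then show ?thesis using W0 by (simp add: nn_integral_eq_integral)
  qed
  define K where "K = enn2real (\<integral>\<^sup>+x. ennreal (W x) \<partial>lborel) + enn2real (\<integral>\<^sup>+x. ennreal (G x) \<partial>lborel)"
  have K: "ennreal K = (\<integral>\<^sup>+x. ennreal (W x) \<partial>lborel) + (\<integral>\<^sup>+x. ennreal (G x) \<partial>lborel)"
    unfolding K_def using fW fG by (simp add: ennreal_plus less_top)
  have "(\<integral>\<^sup>+x. ennreal ((cmod (v (s *\<^sub>R x) - v x))\<^sup>2) \<partial>lborel) \<le> ennreal ((s - 1) * K)" if s: "s \<ge> 1" for s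
  proof -
    have pt: "ennreal ((cmod (v (s *\<^sub>R x) - v x))\<^sup>2) \<le> (\<integral>\<^sup>+r. ennreal (W x + G (r *\<^sub>R x)) * indicator {1..s} r \<partial>lborel)" for x
    proof -
      define h' where "h' r = (\<Sum>j\<in>UNIV. of_real (x $ j) * pdiff j v (r *\<^sub>R x))" for r
      have ch: "continuous_on UNIV h'"
        unfolding h'_def by (intro continuous_intros continuous_on_compose2[OF D(5)[of UNIV]]) auto
      then have [measurable]: "h' \<in> borel_measurable borel" by (rule borel_measurable_continuous_onI)
      define B where "B = 2 * C * exp (- \<gamma> * norm x)"
      have B: "B \<ge> 0" using C by (simp add: B_def)
      have le: "cmod (v (s *\<^sub>R x) - v x) \<le> B"
      proof -
        have "\<gamma> * norm x \<le> \<gamma> * (s * norm x)" using s dec(1) mult_right_mono[of 1 s "norm x"] by (intro mult_left_mono) auto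
        then have "C * exp (- \<gamma> * norm (s *\<^sub>R x)) \<le> C * exp (- \<gamma> * norm x)" using C s by (intro mult_left_mono) auto
        then show ?thesis
          using norm_triangle_ineq4[of "v (s *\<^sub>R x)" "v x"] dec(2)[of x] dec(2)[of "s *\<^sub>R x"] unfolding B_def by linarith
      qed
      have hB: "B * cmod (h' r) \<le> W x + G (r *\<^sub>R x)" for r
      proof -
        have "cmod (h' r) \<le> (\<Sum>j\<in>UNIV. cmod (of_real (x $ j) * pdiff j v (r *\<^sub>R x)))"
          unfolding h'_def by (rule norm_sum)
        also have "\<dots> \<le> (\<Sum>j\<in>UNIV. norm x * cmod (pdiff j v (r *\<^sub>R x)))"
          by (intro sum_mono) (auto simp: norm_mult component_le_norm_cart intro!: mult_right_mono)
        finally have "B * cmod (h' r) \<le> B * (\<Sum>j\<in>UNIV. norm x * cmod (pdiff j v (r *\<^sub>R x)))"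
          using B by (rule mult_left_mono)
        also have "\<dots> = (\<Sum>j\<in>UNIV. 2 * (C * exp (- \<gamma> * norm x) * norm x) * cmod (pdiff j v (r *\<^sub>R x)))"
          by (simp add: B_def sum_distrib_left mult_ac)
        also have "\<dots> \<le> (\<Sum>j\<in>(UNIV::3 set). (C * exp (- \<gamma> * norm x) * norm x)\<^sup>2 + (cmod (pdiff j v (r *\<^sub>R x)))\<^sup>2)"
          by (intro sum_mono sum_squares_bound)
        also have "\<dots> = 3 * (C * exp (- \<gamma> * norm x) * norm x)\<^sup>2 + G (r *\<^sub>R x)"
          by (simp add: sum.distrib G_def)
        also have "(C * exp (- \<gamma> * norm x) * norm x)\<^sup>2 = C\<^sup>2 * ((norm x)\<^sup>2 * exp (- 2 * \<gamma> * norm x))"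
          by (simp add: power_mult_distrib power2_eq_square mult_ac flip: exp_add)
        also have "3 * (C\<^sup>2 * ((norm x)\<^sup>2 * exp (- 2 * \<gamma> * norm x))) + G (r *\<^sub>R x) \<le> W x + G (r *\<^sub>R x)"
          using mult_left_mono[OF sq_exp_le[OF dec(1) norm_ge_zero[of x]], of "C\<^sup>2"] by (simp add: W_def)
        finally show ?thesis .
      qed
      have "(cmod (v (s *\<^sub>R x) - v x))\<^sup>2 \<le> B * cmod (v (s *\<^sub>R x) - v x)"
        using le by (simp add: power2_eq_square mult_right_mono)
      then have "ennreal ((cmod (v (s *\<^sub>R x) - v x))\<^sup>2) \<le> ennreal B * ennreal (cmod (v (s *\<^sub>R x) - v (1 *\<^sub>R x)))"
        using B by (simp add: ennreal_mult[symmetric] ennreal_leI)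
      also have "\<dots> \<le> ennreal B * (\<integral>\<^sup>+r. ennreal (cmod (h' r)) * indicator {1..s} r \<partial>lborel)"
        by (intro mult_left_mono norm_increment_le_nn_integral[OF s _ ch, of "\<lambda>r. v (r *\<^sub>R x)"])
          (auto simp: h'_def intro: has_vector_derivative_ray D(1))
      also have "\<dots> = (\<integral>\<^sup>+r. ennreal B * (ennreal (cmod (h' r)) * indicator {1..s} r) \<partial>lborel)"
        by (rule nn_integral_cmult[symmetric]) measurable
      also have "\<dots> \<le> (\<integral>\<^sup>+r. ennreal (W x + G (r *\<^sub>R x)) * indicator {1..s} r \<partial>lborel)"
        using hB B by (intro nn_integral_mono) (auto simp: indicator_def ennreal_mult[symmetric] intro!: ennreal_leI)
      finally show ?thesis .
    qed
    have "continuous_on UNIV (\<lambda>p. G (snd p *\<^sub>R fst p))"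
      by (rule continuous_on_compose2[OF cG]) (auto intro!: continuous_intros)
    then have [measurable]: "(\<lambda>p. G (snd p *\<^sub>R fst p)) \<in> borel_measurable (lborel \<Otimes>\<^sub>M lborel)"
      by (simp add: lborel_prod borel_measurable_continuous_onI)
    have "(\<integral>\<^sup>+x. ennreal ((cmod (v (s *\<^sub>R x) - v x))\<^sup>2) \<partial>lborel)
      \<le> (\<integral>\<^sup>+x. (\<integral>\<^sup>+r. ennreal (W x + G (r *\<^sub>R x)) * indicator {1..s} r \<partial>lborel) \<partial>lborel)"
      by (intro nn_integral_mono pt)
    also have "\<dots> = (\<integral>\<^sup>+r. (\<integral>\<^sup>+x. ennreal (W x + G (r *\<^sub>R x)) * indicator {1..s} r \<partial>lborel) \<partial>lborel)"
      by (rule lborel_pair.Fubini'[symmetric]) measurable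
    also have "\<dots> \<le> (\<integral>\<^sup>+r. ennreal K * indicator {1..s} r \<partial>lborel)"
    proof (rule nn_integral_mono)
      fix r :: real
      show "(\<integral>\<^sup>+x. ennreal (W x + G (r *\<^sub>R x)) * indicator {1..s} r \<partial>lborel) \<le> ennreal K * indicator {1..s} r"
      proof (cases "r \<in> {1..s}")
        case True
        then have "(\<integral>\<^sup>+x. ennreal (W x + G (r *\<^sub>R x)) \<partial>lborel) = (\<integral>\<^sup>+x. ennreal (W x) \<partial>lborel) + (\<integral>\<^sup>+x. ennreal (G (r *\<^sub>R x)) \<partial>lborel)"
          using W0 G0 by (simp add: nn_integral_add)
        \<comment> \<open>Since \<open>r \<ge> 1\<close>, the Jacobian \<open>1 / r ^ 3\<close> is
          at most 1 and the bound does not depend on \<open>r\<close>.\<close>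
        also have "\<dots> \<le> ennreal K"
          unfolding K using True by (intro add_left_mono nn_integral_scale_le[of "\<lambda>x. ennreal (G x)"]) auto
        finally show ?thesis using True by simp
      qed simp
    qed
    also have "\<dots> = ennreal ((s - 1) * K)"
      using s by (subst nn_integral_cmult) (auto simp: ennreal_mult' mult.commute K_def)
    finally show ?thesis .
  qed
  moreover have "K \<ge> 0" by (simp add: K_def)
  ultimately show ?thesis using that by blast
qed

context decaying_nls
begin

lemma nonlinearity_lipschitz_along:
  obtains L where "L \<ge> 0" "\<And>t x s y. cmod (f t x - f s y) \<le> L * cmod (u t x - u s y)"
    "\<And>t x. \<bar>power_profile lam1 lam2 ((cmod (u t x))\<^sup>2)\<bar> \<le> L"
proof -
  obtain C where C: "C > 0" "\<And>t x. cmod (u t x) \<le> C" using exp_decay_bounded[OF exp_decay_u] by metis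
  from nonlinearity_lipschitz[OF less_imp_le[OF C(1)], of lam1 lam2] C(2) that show ?thesis by metis
qed

text \<open>The difference of \<open>u\<close> and its translate by \<open>\<epsilon>\<close> along
  an axis is a weak solution whose forcing is at most \<open>L\<close> times the difference.
  Gronwall keeps its square integral of order \<open>\<epsilon>\<^sup>2\<close>, and difference
  quotients recover the gradient at time \<open>t\<close>.\<close>

lemma gradient_square_integrable:
  assumes grad: "\<And>j. (\<integral>\<^sup>+x. ennreal ((cmod (pdiff j (u 0) x))\<^sup>2) \<partial>lborel) < \<infinity>"
  obtains K where "K \<ge> 0" "\<And>j t. 0 \<le> t \<Longrightarrow> t \<le> T \<Longrightarrow> (\<integral>\<^sup>+x. ennreal ((cmod (pdiff j (u t) x))\<^sup>2) \<partial>lborel) \<le> ennreal K"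
proof -
  obtain L where L: "L \<ge> 0" "\<And>t x s y. cmod (f t x - f s y) \<le> L * cmod (u t x - u s y)"
    using nonlinearity_lipschitz_along by metis
  define N where "N j = enn2real (\<integral>\<^sup>+x. ennreal ((cmod (pdiff j (u 0) x))\<^sup>2) \<partial>lborel)" for j
  have N: "(\<integral>\<^sup>+x. ennreal ((cmod (pdiff j (u 0) x))\<^sup>2) \<partial>lborel) = ennreal (N j)" for j
    unfolding N_def using grad[of j] by (simp add: less_top)
  have main: "(\<integral>\<^sup>+x. ennreal ((cmod (pdiff j (u t) x))\<^sup>2) \<partial>lborel) \<le> ennreal (N j * exp (2 * L * t))" if t: "0 \<le> t" for j t
  proof (rule gradient_bound_of_translations[OF Ck2D(6)[OF C2] Ck2D(4)[OF C2]])
    fix \<epsilon> :: real assume \<epsilon>: "0 < \<epsilon>" "\<epsilon> \<le> 1"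
    let ?c = "\<epsilon> *\<^sub>R axis j 1 :: real^3"
    define w where "w t x = u t (?c + x) - u t x" for t x
    have ww: "weak_schrodinger w (\<lambda>t x. f t (?c + x) - f t x)"
      unfolding w_def by (rule weak_schrodinger_diff[OF weak_u weak_schrodinger_translate[OF weak_u]])
    have ew: "exp_decay (\<lambda>t x. (cmod (w t x))\<^sup>2)"
      using exp_decay_power[OF exp_decay_norm[OF weak_schrodingerD(1)[OF ww]], of 2] by simp
    have nn: "(\<integral>\<^sup>+x. ennreal ((cmod (w t x))\<^sup>2) \<partial>lborel) = ennreal (LINT x|lborel. (cmod (w t x))\<^sup>2)" for t
      by (rule nn_integral_eq_integral[OF exp_decay_integrable[OF ew]]) simp
    have ez: "exp_decay (\<lambda>t x. 0::real)" by (rule exp_decay_dominated[OF exp_decay_u, where K=0]) auto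
    have "(LINT x|lborel. (cmod (w t x))\<^sup>2) \<le> ((LINT x|lborel. (cmod (w 0 x))\<^sup>2) + 0 * t) * exp (2 * L * t)"
      by (rule weak_schrodinger_l2_growth[OF ww L(1) t ez]) (use L(2) in \<open>auto simp: w_def\<close>)
    then have "ennreal (LINT x|lborel. (cmod (w t x))\<^sup>2) \<le> ennreal ((LINT x|lborel. (cmod (w 0 x))\<^sup>2) * exp (2 * L * t))"
      by (intro ennreal_leI) simp
    also have "\<dots> = ennreal (LINT x|lborel. (cmod (w 0 x))\<^sup>2) * ennreal (exp (2 * L * t))"
      by (intro ennreal_mult) (auto intro: Bochner_Integration.integral_nonneg)
    also have "ennreal (LINT x|lborel. (cmod (w 0 x))\<^sup>2) \<le> ennreal (\<epsilon>\<^sup>2) * ennreal (N j)"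
      unfolding nn[symmetric] N[symmetric] unfolding w_def
      by (rule translation_increment[OF Ck2D(6)[OF C2] Ck2D(5)[OF C2]]) (use \<epsilon> in simp)
    finally show "(\<integral>\<^sup>+x. ennreal ((cmod (u t (?c + x) - u t x))\<^sup>2) \<partial>lborel) \<le> ennreal (\<epsilon>\<^sup>2) * ennreal (N j * exp (2 * L * t))"
      by (simp add: nn[unfolded w_def] w_def mult_right_mono ennreal_mult' mult.assoc N_def ennreal_mult)
  qed
  define K where "K = (\<Sum>j\<in>UNIV. N j) * exp (2 * L * T)"
  have N0: "N j \<ge> 0" for j by (simp add: N_def)
  have "(\<integral>\<^sup>+x. ennreal ((cmod (pdiff j (u t) x))\<^sup>2) \<partial>lborel) \<le> ennreal K" if t: "0 \<le> t" "t \<le> T" for j t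
  proof (rule order_trans[OF main[OF t(1)]], rule ennreal_leI)
    have "N j \<le> (\<Sum>j\<in>UNIV. N j)" using N0 by (intro member_le_sum) auto
    then show "N j * exp (2 * L * t) \<le> K"
      unfolding K_def using t L N0 by (intro mult_mono) (auto intro!: mult_left_mono sum_nonneg)
  qed
  moreover have "K \<ge> 0" using N0 by (simp add: K_def sum_nonneg)
  ultimately show ?thesis using that by blast
qed

end

lemma borel_measurable_cnj [measurable]:
  "g \<in> borel_measurable M \<Longrightarrow> (\<lambda>x. cnj (g x)) \<in> borel_measurable M"
  by (rule borel_measurable_continuous_on[of cnj]) (intro continuous_intros)

lemma Cauchy_Schwarz_integral:
  fixes a b :: "'a::euclidean_space \<Rightarrow> complex"
  assumes [measurable]: "a \<in> borel_measurable borel" "b \<in> borel_measurable borel"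
    and a: "integrable lborel (\<lambda>x. (cmod (a x))\<^sup>2)" and b: "integrable lborel (\<lambda>x. (cmod (b x))\<^sup>2)"
  shows "integrable lborel (\<lambda>x. a x * b x)"
    "cmod (LINT x|lborel. a x * b x) \<le> sqrt (LINT x|lborel. (cmod (a x))\<^sup>2) * sqrt (LINT x|lborel. (cmod (b x))\<^sup>2)"
proof -
  show i: "integrable lborel (\<lambda>x. a x * b x)"
  proof (rule Bochner_Integration.integrable_bound[OF Bochner_Integration.integrable_add[OF a b]])
    show "AE x in lborel. norm (a x * b x) \<le> norm ((cmod (a x))\<^sup>2 + (cmod (b x))\<^sup>2)"
    proof (rule AE_I2)
      fix x
      have "2 * (cmod (a x) * cmod (b x)) \<le> (cmod (a x))\<^sup>2 + (cmod (b x))\<^sup>2"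
        using sum_squares_bound[of "cmod (a x)" "cmod (b x)"] by (simp add: mult.assoc)
      moreover have "0 \<le> cmod (a x) * cmod (b x)" by simp
      ultimately have "cmod (a x) * cmod (b x) \<le> (cmod (a x))\<^sup>2 + (cmod (b x))\<^sup>2" by linarith
      then show "norm (a x * b x) \<le> norm ((cmod (a x))\<^sup>2 + (cmod (b x))\<^sup>2)"
        by (simp add: norm_mult)
    qed
  qed measurable
  define A where "A = (LINT x|lborel. (cmod (a x))\<^sup>2)"
  define B where "B = (LINT x|lborel. (cmod (b x))\<^sup>2)"
  have AB: "A \<ge> 0" "B \<ge> 0" by (simp_all add: A_def B_def)
  define I where "I = (LINT x|lborel. cmod (a x * b x))"
  have I: "I \<ge> 0" by (simp add: I_def)
  have "ennreal (I\<^sup>2) = (\<integral>\<^sup>+x. ennreal (cmod (a x * b x)) \<partial>lborel)\<^sup>2"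
    unfolding I_def by (subst nn_integral_eq_integral) (use i I in \<open>auto simp: ennreal_power I_def\<close>)
  also have "\<dots> = (\<integral>\<^sup>+x. ennreal (cmod (a x)) * ennreal (cmod (b x)) \<partial>lborel)\<^sup>2"
    by (simp add: norm_mult ennreal_mult)
  also have "\<dots> \<le> (\<integral>\<^sup>+x. (ennreal (cmod (a x)))\<^sup>2 \<partial>lborel) * (\<integral>\<^sup>+x. (ennreal (cmod (b x)))\<^sup>2 \<partial>lborel)"
    by (rule Cauchy_Schwarz_nn_integral) auto
  also have "(\<integral>\<^sup>+x. (ennreal (cmod (a x)))\<^sup>2 \<partial>lborel) = ennreal A"
    unfolding A_def by (subst nn_integral_eq_integral[symmetric]) (use a in \<open>auto simp: ennreal_power\<close>)
  also have "(\<integral>\<^sup>+x. (ennreal (cmod (b x)))\<^sup>2 \<partial>lborel) = ennreal B"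
    unfolding B_def by (subst nn_integral_eq_integral[symmetric]) (use b in \<open>auto simp: ennreal_power\<close>)
  finally have "ennreal (I\<^sup>2) \<le> ennreal (A * B)" using AB by (simp add: ennreal_mult)
  then have "I\<^sup>2 \<le> A * B" using AB by simp
  then have "I \<le> sqrt A * sqrt B" using I by (simp add: real_le_rsqrt flip: real_sqrt_mult)
  then show "cmod (LINT x|lborel. a x * b x) \<le> sqrt (LINT x|lborel. (cmod (a x))\<^sup>2) * sqrt (LINT x|lborel. (cmod (b x))\<^sup>2)"
    using integral_norm_bound[of lborel "\<lambda>x. a x * b x"] unfolding A_def B_def I_def by linarith
qed

section \<open>Time derivative of the pairing with the initial state\<close>

locale decaying_nls_h1 = decaying_nls +
  assumes grad0: "\<And>j. (\<integral>\<^sup>+x. ennreal ((cmod (pdiff j (u 0) x))\<^sup>2) \<partial>lborel) < \<infinity>"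
begin

definition kinetic :: real where
  "kinetic = (LINT x|lborel. (\<Sum>j\<in>UNIV. (cmod (pdiff j (u 0) x))\<^sup>2))"

lemma pdiff_measurable: "pdiff j (u t) \<in> borel_measurable borel"
  by (rule borel_measurable_continuous_onI[OF Ck2D(5)[OF C2]])

lemma gradient_bound:
  obtains K where "K \<ge> 0" "\<And>j t. 0 \<le> t \<Longrightarrow> t \<le> T \<Longrightarrow> integrable lborel (\<lambda>x. (cmod (pdiff j (u t) x))\<^sup>2)"
    "\<And>j t. 0 \<le> t \<Longrightarrow> t \<le> T \<Longrightarrow> (LINT x|lborel. (cmod (pdiff j (u t) x))\<^sup>2) \<le> K"
proof -
  obtain K where K: "K \<ge> 0" "\<And>j t. 0 \<le> t \<Longrightarrow> t \<le> T \<Longrightarrow> (\<integral>\<^sup>+x. ennreal ((cmod (pdiff j (u t) x))\<^sup>2) \<partial>lborel) \<le> ennreal K"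
    using gradient_square_integrable[OF grad0] by metis
  have i: "integrable lborel (\<lambda>x. (cmod (pdiff j (u t) x))\<^sup>2)" if "0 \<le> t" "t \<le> T" for j t
    using K(2)[OF that, of j] pdiff_measurable
    by (intro integrableI_nonneg) (auto intro: le_less_trans)
  moreover have "(LINT x|lborel. (cmod (pdiff j (u t) x))\<^sup>2) \<le> K" if "0 \<le> t" "t \<le> T" for j t
    using K(2)[OF that, of j] K(1) i[OF that, of j] by (simp add: nn_integral_eq_integral)
  ultimately show ?thesis using K(1) that by blast
qed

text \<open>Formally the integral of \<open>cnj (u 0 x) * (\<i> * ut r x)\<close>, integrated by
  parts once: two first derivatives, each square integrable, replace a Laplacian whose integrability
  is unknown.\<close>

definition energy_pairing :: "real \<Rightarrow> complex" where
  "energy_pairing r = (\<Sum>j\<in>UNIV. LINT x|lborel. cnj (pdiff j (u 0) x) * pdiff j (u r) x) + (LINT x|lborel. cnj (u 0 x) * f r x)"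

text \<open>A compactly supported replacement of \<open>cnj (u 0 x)\<close>, against which
  \<open>ut\<close> may be integrated and integration by parts is allowed. The \<open>x - 0\<close>
  keeps the shape that \<open>ddir_affine\<close> expects.\<close>

definition cutoff :: "nat \<Rightarrow> real^3 \<Rightarrow> complex" where
  "cutoff n x = of_real (bump ((1 / real (Suc n)) *\<^sub>R (x - 0))) * cnj (u 0 x)"

definition cutoff_d :: "nat \<Rightarrow> 3 \<Rightarrow> real^3 \<Rightarrow> complex" where
  "cutoff_d n j x = of_real (bump ((1 / real (Suc n)) *\<^sub>R (x - 0))) * cnj (pdiff j (u 0) x) +
     of_real ((1 / real (Suc n)) *\<^sub>R bump_d j ((1 / real (Suc n)) *\<^sub>R (x - 0))) * cnj (u 0 x)"

lemma ddir_cutoff: "ddir j (cutoff n) (cutoff_d n j)"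
  unfolding cutoff_def[abs_def] cutoff_d_def[abs_def]
  by (intro ddir_mult ddir_of_real ddir_affine ddir_bump ddir_cnj Ck2D(6)[OF C2])

lemma cutoff_eq_0:
  assumes "norm x \<ge> real (Suc n)" shows "cutoff n x = 0" "cutoff_d n j x = 0"
proof -
  have "norm ((1 / real (Suc n)) *\<^sub>R (x - 0)) \<ge> 1" using assms by (simp add: divide_simps)
  from bump_eq_0[OF this] show "cutoff n x = 0" "cutoff_d n j x = 0" by (simp_all add: cutoff_def cutoff_d_def)
qed

lemma continuous_cutoff: "continuous_on UNIV (cutoff n)" "continuous_on UNIV (cutoff_d n j)"
proof -
  have aff: "continuous_on UNIV (\<lambda>x::real^3. (1 / real (Suc n)) *\<^sub>R (x - 0))" by (intro continuous_intros)
  note comp = continuous_on_compose2[OF continuous_bump(1) aff subset_UNIV] continuous_on_compose2[OF continuous_bump(2) aff subset_UNIV]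
  show "continuous_on UNIV (cutoff n)" "continuous_on UNIV (cutoff_d n j)"
    unfolding cutoff_def[abs_def] cutoff_d_def[abs_def]
    by (intro continuous_on_of_real continuous_on_scaleR continuous_on_const continuous_on_mult continuous_on_add continuous_on_cnj
        comp Ck2D(4)[OF C2] Ck2D(5)[OF C2])+
qed

definition cutoff_error :: "nat \<Rightarrow> 3 \<Rightarrow> real" where
  "cutoff_error n j = (LINT x|lborel. (cmod (cutoff_d n j x - cnj (pdiff j (u 0) x)))\<^sup>2)"

lemma bump_scaled_tendsto: "(\<lambda>n. bump ((1 / real (Suc n)) *\<^sub>R (x - 0))) \<longlonglongrightarrow> 1"
proof -
  have "(\<lambda>n. (1 / real (Suc n)) *\<^sub>R (x - 0)) \<longlonglongrightarrow> 0 *\<^sub>R (x - 0)"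
    by (intro tendsto_intros LIMSEQ_Suc[OF lim_1_over_n])
  from continuous_on_tendsto_compose[OF continuous_bump(1)[of UNIV] this] show ?thesis
    by (simp add: bump_0)
qed

lemma square_integrable_u: "integrable lborel (\<lambda>x. (cmod (u t x))\<^sup>2)"
  using exp_decay_integrable[OF exp_decay_power[OF exp_decay_norm[OF exp_decay_u], of 2]] by simp

lemma grad0_integrable: "integrable lborel (\<lambda>x. (cmod (pdiff j (u 0) x))\<^sup>2)"
  using gradient_bound[of 0] by (metis order_refl)

text \<open>A majorant free of \<open>n\<close>: multiplying by the bump loses at most the gradient
  itself, and differentiating the bump costs at most \<open>M * cmod (u 0 x)\<close>, because the
  inner factor \<open>1 / (n + 1)\<close> is at most 1.\<close>

lemma cutoff_d_diff_bound:
  obtains M where "M \<ge> 0" "\<And>n x. (cmod (cutoff_d n j x - cnj (pdiff j (u 0) x)))\<^sup>2 \<le> 2 * (cmod (pdiff j (u 0) x))\<^sup>2 + 2 * M\<^sup>2 * (cmod (u 0 x))\<^sup>2"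
proof -
  obtain M where M: "M > 0" "\<And>x. \<bar>bump_d j x\<bar> \<le> M" using bump_d_bounded by metis
  have "(cmod (cutoff_d n j x - cnj (pdiff j (u 0) x)))\<^sup>2 \<le> 2 * (cmod (pdiff j (u 0) x))\<^sup>2 + 2 * M\<^sup>2 * (cmod (u 0 x))\<^sup>2" for n x
  proof -
    let ?y = "(1 / real (Suc n)) *\<^sub>R (x - 0)"
    let ?p = "cmod (pdiff j (u 0) x)" and ?q = "M * cmod (u 0 x)"
    have "cutoff_d n j x - cnj (pdiff j (u 0) x) = of_real (bump ?y - 1) * cnj (pdiff j (u 0) x) +
      of_real ((1 / real (Suc n)) *\<^sub>R bump_d j ?y) * cnj (u 0 x)"
      by (simp add: cutoff_d_def algebra_simps)
    then have "cmod (cutoff_d n j x - cnj (pdiff j (u 0) x)) \<le> cmod (of_real (bump ?y - 1) * cnj (pdiff j (u 0) x)) +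
      cmod (of_real ((1 / real (Suc n)) *\<^sub>R bump_d j ?y) * cnj (u 0 x))"
      by (metis norm_triangle_ineq)
    also have "\<dots> = \<bar>bump ?y - 1\<bar> * ?p + \<bar>(1 / real (Suc n)) *\<^sub>R bump_d j ?y\<bar> * cmod (u 0 x)"
      by (simp only: norm_mult norm_of_real complex_mod_cnj)
    also have "\<dots> \<le> 1 * ?p + M * cmod (u 0 x)"
    proof (intro add_mono mult_right_mono)
      show "\<bar>bump ?y - 1\<bar> \<le> 1" using bump_bounds[of ?y] by simp
      have "\<bar>(1 / real (Suc n)) *\<^sub>R bump_d j ?y\<bar> \<le> 1 * M"
        unfolding real_scaleR_def abs_mult by (intro mult_mono M(2)) auto
      then show "\<bar>(1 / real (Suc n)) *\<^sub>R bump_d j ?y\<bar> \<le> M" by simp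
    qed auto
    finally have "cmod (cutoff_d n j x - cnj (pdiff j (u 0) x)) \<le> ?p + ?q" by simp
    then have "(cmod (cutoff_d n j x - cnj (pdiff j (u 0) x)))\<^sup>2 \<le> (?p + ?q)\<^sup>2" by (intro power_mono) auto
    also have "\<dots> \<le> 2 * ?p\<^sup>2 + 2 * ?q\<^sup>2"
      using sum_squares_bound[of ?p ?q] by (simp add: power2_sum)
    finally show ?thesis by (simp add: power_mult_distrib)
  qed
  then show ?thesis using that[of M] M(1) by simp
qed

lemma cutoff_d_diff_integrable: "integrable lborel (\<lambda>x. (cmod (cutoff_d n j x - cnj (pdiff j (u 0) x)))\<^sup>2)"
proof -
  obtain M where M: "M \<ge> 0" "\<And>n x. (cmod (cutoff_d n j x - cnj (pdiff j (u 0) x)))\<^sup>2 \<le> 2 * (cmod (pdiff j (u 0) x))\<^sup>2 + 2 * M\<^sup>2 * (cmod (u 0 x))\<^sup>2"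
    using cutoff_d_diff_bound by metis
  have [measurable]: "cutoff_d n j \<in> borel_measurable borel" "pdiff j (u 0) \<in> borel_measurable borel"
    using continuous_cutoff(2) pdiff_measurable by (auto intro: borel_measurable_continuous_onI)
  have [measurable]: "(\<lambda>x. (cmod (cutoff_d n j x - cnj (pdiff j (u 0) x)))\<^sup>2) \<in> borel_measurable borel"
    by measurable
  show ?thesis
    by (rule Bochner_Integration.integrable_bound[where f="\<lambda>x. 2 * (cmod (pdiff j (u 0) x))\<^sup>2 + 2 * M\<^sup>2 * (cmod (u 0 x))\<^sup>2"])
      (use M(2) grad0_integrable square_integrable_u in auto)
qed

lemma cutoff_error_tendsto: "(\<lambda>n. cutoff_error n j) \<longlonglongrightarrow> 0"
proof -
  obtain M where M: "M \<ge> 0" "\<And>n x. (cmod (cutoff_d n j x - cnj (pdiff j (u 0) x)))\<^sup>2 \<le> 2 * (cmod (pdiff j (u 0) x))\<^sup>2 + 2 * M\<^sup>2 * (cmod (u 0 x))\<^sup>2"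
    using cutoff_d_diff_bound by metis
  obtain B where B: "B > 0" "\<And>x. \<bar>bump_d j x\<bar> \<le> B" using bump_d_bounded by metis
  have [measurable]: "cutoff_d n j \<in> borel_measurable borel" "pdiff j (u 0) \<in> borel_measurable borel" for n
    using continuous_cutoff(2) pdiff_measurable by (auto intro: borel_measurable_continuous_onI)
  have [measurable]: "(\<lambda>x. (cmod (cutoff_d n j x - cnj (pdiff j (u 0) x)))\<^sup>2) \<in> borel_measurable borel" for n
    by measurable
  have "(\<lambda>n. LINT x|lborel. (cmod (cutoff_d n j x - cnj (pdiff j (u 0) x)))\<^sup>2) \<longlonglongrightarrow> (LINT x|(lborel::(real^3) measure). 0)"
  proof (rule integral_dominated_convergence[where w="\<lambda>x. 2 * (cmod (pdiff j (u 0) x))\<^sup>2 + 2 * M\<^sup>2 * (cmod (u 0 x))\<^sup>2"])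
    show "AE x in lborel. (\<lambda>n. (cmod (cutoff_d n j x - cnj (pdiff j (u 0) x)))\<^sup>2) \<longlonglongrightarrow> 0"
    proof (rule AE_I2)
      fix x
      have "(\<lambda>n. (1 / real (Suc n)) *\<^sub>R bump_d j ((1 / real (Suc n)) *\<^sub>R (x - 0))) \<longlonglongrightarrow> 0"
      proof (rule Lim_null_comparison[OF always_eventually])
        show "\<forall>n. norm ((1 / real (Suc n)) *\<^sub>R bump_d j ((1 / real (Suc n)) *\<^sub>R (x - 0))) \<le> 1 / real (Suc n) * B"
          using B(2) by (auto simp: abs_mult intro!: divide_right_mono)
        show "(\<lambda>n. 1 / real (Suc n) * B) \<longlonglongrightarrow> 0"
          using tendsto_mult[OF LIMSEQ_Suc[OF lim_1_over_n] tendsto_const[of B]] by simp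
      qed
      then have "(\<lambda>n. cutoff_d n j x) \<longlonglongrightarrow> of_real 1 * cnj (pdiff j (u 0) x) + of_real 0 * cnj (u 0 x)"
        unfolding cutoff_d_def by (intro tendsto_intros bump_scaled_tendsto)
      then have "(\<lambda>n. (cmod (cutoff_d n j x - cnj (pdiff j (u 0) x)))\<^sup>2) \<longlonglongrightarrow> (cmod (cnj (pdiff j (u 0) x) - cnj (pdiff j (u 0) x)))\<^sup>2"
        by (intro tendsto_intros) simp
      then show "(\<lambda>n. (cmod (cutoff_d n j x - cnj (pdiff j (u 0) x)))\<^sup>2) \<longlonglongrightarrow> 0" by simp
    qed
  qed (use M(2) grad0_integrable square_integrable_u in auto)
  then show ?thesis by (simp add: cutoff_error_def)
qed

definition cutoff_pairing :: "nat \<Rightarrow> real \<Rightarrow> complex" where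
  "cutoff_pairing n r = (LINT x|lborel. cutoff n x * (\<i> * ut r x))"

lemma cutoff_pairing_eq:
  "cutoff_pairing n r = (\<Sum>j\<in>UNIV. LINT x|lborel. cutoff_d n j x * pdiff j (u r) x) + (LINT x|lborel. cutoff n x * f r x)"
proof -
  have i: "integrable lborel (\<lambda>x. cutoff n x * pdiff j (pdiff j (u r)) x)" for j
    by (rule integrable_compact_support[where R="real (Suc n)"])
      (auto intro!: continuous_on_mult continuous_cutoff Ck2D(3)[OF C2] simp: cutoff_eq_0)
  have i2: "integrable lborel (\<lambda>x. cutoff n x * f r x)"
    by (rule integrable_compact_support[where R="real (Suc n)"])
      (auto intro!: continuous_on_mult continuous_cutoff exp_decay_slice(1)[OF exp_decay_f] simp: cutoff_eq_0)
  have "cutoff_pairing n r = (LINT x|lborel. - (\<Sum>j\<in>UNIV. cutoff n x * pdiff j (pdiff j (u r)) x) + cutoff n x * f r x)"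
    unfolding cutoff_pairing_def
    by (rule Bochner_Integration.integral_cong[OF refl])
      (simp add: equation laplacian_def sum_distrib_left[symmetric] algebra_simps)
  also have "\<dots> = - (\<Sum>j\<in>UNIV. LINT x|lborel. cutoff n x * pdiff j (pdiff j (u r)) x) + (LINT x|lborel. cutoff n x * f r x)"
    using i i2 by (simp add: Bochner_Integration.integral_sum)
  also have "(\<lambda>j. LINT x|lborel. cutoff n x * pdiff j (pdiff j (u r)) x) = (\<lambda>j. - (LINT x|lborel. cutoff_d n j x * pdiff j (u r) x))"
    by (intro ext integral_by_parts[OF ddir_cutoff Ck2D(7)[OF C2] continuous_cutoff Ck2D(5)[OF C2] Ck2D(3)[OF C2] cutoff_eq_0])
  finally show ?thesis by (simp add: sum_negf)
qed

text \<open>With bounded support the pairing with \<open>ut\<close> is visibly continuous in time.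
  For \<open>energy_pairing\<close> only bounds on the gradient are at hand; it inherits continuity
  through a uniform limit.\<close>

lemma cutoff_pairing_continuous: "continuous_on S (cutoff_pairing n)"
proof -
  have "continuous (at r) (cutoff_pairing n)" for r
  proof -
    obtain M where M: "M \<ge> 0" "\<And>t x. \<bar>t - r\<bar> \<le> 1 \<Longrightarrow> norm x \<le> real (Suc n) \<Longrightarrow> cmod (ut t x) \<le> M"
      using ut_local_bound by metis
    have m: "(\<lambda>x. cutoff n x * (\<i> * ut t x)) \<in> borel_measurable borel" for t
      by (intro borel_measurable_continuous_onI continuous_intros continuous_cutoff joint_continuous_slice(1)[OF ut_continuous])
    show ?thesis
      unfolding continuous_at cutoff_pairing_def
    proof (rule tendsto_integral_at[where w="\<lambda>x. M * cmod (cutoff n x)"])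
      show "((\<lambda>t. cutoff n x * (\<i> * ut t x)) \<longlongrightarrow> cutoff n x * (\<i> * ut r x)) (at r)" for x
        using joint_continuous_slice(2)[OF ut_continuous, of UNIV x]
        by (intro tendsto_intros) (simp add: continuous_on_eq_continuous_at continuous_at)
      have "norm (cutoff n x * (\<i> * ut t x)) \<le> M * cmod (cutoff n x)" if "dist t r < 1" for t x
      proof (cases "norm x \<ge> real (Suc n)")
        case False
        then show ?thesis using M(2)[of t x] that
          by (simp add: norm_mult mult.commute[of M] mult_left_mono dist_real_def)
      qed (simp add: cutoff_eq_0)
      with m show "\<forall>\<^sub>F t in at r. (\<lambda>x. cutoff n x * (\<i> * ut t x)) \<in> borel_measurable borel \<and>
          (\<forall>x. norm (cutoff n x * (\<i> * ut t x)) \<le> M * cmod (cutoff n x))"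
        by (auto simp: eventually_at intro!: exI[of _ 1])
      show "integrable lborel (\<lambda>x. M * cmod (cutoff n x))"
        by (rule integrable_compact_support[where R="real (Suc n)"])
          (auto intro!: continuous_intros continuous_cutoff simp: cutoff_eq_0)
    qed (rule m)
  qed
  then show ?thesis by (auto intro: continuous_at_imp_continuous_on)
qed

text \<open>By Cauchy-Schwarz the gradient error splits into a factor depending on \<open>n\<close>
  alone and the \<open>L^2\<close> norm of the gradient of \<open>u r\<close>. The propagated bound
  on that norm over \<open>{0..1}\<close> makes the limit uniform in time.\<close>

lemma cutoff_uniform_limit:
  shows "uniform_limit {0..1} cutoff_pairing energy_pairing sequentially"
    "(\<lambda>n. LINT x|lborel. cutoff n x * u h x) \<longlonglongrightarrow> (LINT x|lborel. cnj (u 0 x) * u h x)"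
proof -
  obtain K where K: "K \<ge> 0" "\<And>j t. 0 \<le> t \<Longrightarrow> t \<le> 1 \<Longrightarrow> integrable lborel (\<lambda>x. (cmod (pdiff j (u t) x))\<^sup>2)"
    "\<And>j t. 0 \<le> t \<Longrightarrow> t \<le> 1 \<Longrightarrow> (LINT x|lborel. (cmod (pdiff j (u t) x))\<^sup>2) \<le> K"
    using gradient_bound[of 1] by metis
  obtain F where F: "F > 0" "\<And>t x. cmod (f t x) \<le> F" using exp_decay_bounded[OF exp_decay_f] by metis
  obtain U where U: "U > 0" "\<And>t x. cmod (u t x) \<le> U" using exp_decay_bounded[OF exp_decay_u] by metis
  have mc[measurable]: "cutoff n \<in> borel_measurable borel" "cutoff_d n j \<in> borel_measurable borel" for n j
    using continuous_cutoff by (auto intro: borel_measurable_continuous_onI)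
  have [measurable]: "u t \<in> borel_measurable borel" "f t \<in> borel_measurable borel" "pdiff j (u t) \<in> borel_measurable borel" for j t
    using exp_decay_measurable[OF exp_decay_u] exp_decay_measurable[OF exp_decay_f] pdiff_measurable by auto
  have iu: "integrable lborel (\<lambda>x. cmod (u 0 x))" using exp_decay_integrable[OF exp_decay_norm[OF exp_decay_u]] .
  have cb: "cmod (cutoff n x) \<le> cmod (u 0 x)" "cmod (cutoff n x - cnj (u 0 x)) \<le> cmod (u 0 x)" for n x
  proof -
    let ?y = "(1 / real (Suc n)) *\<^sub>R (x - 0)"
    show "cmod (cutoff n x) \<le> cmod (u 0 x)"
      unfolding cutoff_def norm_mult using bump_bounds[of ?y] by (simp add: mult_left_le_one_le)
    have "cutoff n x - cnj (u 0 x) = of_real (bump ?y - 1) * cnj (u 0 x)" by (simp add: cutoff_def algebra_simps)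
    then have "cmod (cutoff n x - cnj (u 0 x)) = \<bar>bump ?y - 1\<bar> * cmod (u 0 x)"
      by (simp only: norm_mult norm_of_real complex_mod_cnj)
    also have "\<dots> \<le> 1 * cmod (u 0 x)" using bump_bounds[of ?y] by (intro mult_right_mono) auto
    finally show "cmod (cutoff n x - cnj (u 0 x)) \<le> cmod (u 0 x)" by simp
  qed
  have ct: "(\<lambda>n. cutoff n x) \<longlonglongrightarrow> cnj (u 0 x)" for x
  proof -
    have "(\<lambda>n. cutoff n x) \<longlonglongrightarrow> of_real 1 * cnj (u 0 x)"
      unfolding cutoff_def by (intro tendsto_intros bump_scaled_tendsto)
    then show ?thesis by simp
  qed
  define B where "B n = (LINT x|lborel. cmod (cutoff n x - cnj (u 0 x)))" for n
  have iB: "integrable lborel (\<lambda>x. cmod (cutoff n x - cnj (u 0 x)))" for n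
    by (rule Bochner_Integration.integrable_bound[OF iu]) (use cb in auto)
  have B: "B \<longlonglongrightarrow> 0"
  proof -
    have "B \<longlonglongrightarrow> (LINT x|(lborel::(real^3) measure). 0)"
      unfolding B_def
    proof (rule integral_dominated_convergence[where w="\<lambda>x. cmod (u 0 x)"])
      have "(\<lambda>n. cmod (cutoff n x - cnj (u 0 x))) \<longlonglongrightarrow> cmod (cnj (u 0 x) - cnj (u 0 x))" for x
        by (intro tendsto_intros ct)
      then show "AE x in lborel. (\<lambda>n. cmod (cutoff n x - cnj (u 0 x))) \<longlonglongrightarrow> 0" by simp
    qed (use iu cb in auto)
    then show ?thesis by simp
  qed
  define \<delta> where "\<delta> n = (\<Sum>j\<in>(UNIV::3 set). sqrt (cutoff_error n j) * sqrt K) + F * B n" for n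
  have \<delta>: "\<delta> \<longlonglongrightarrow> 0"
  proof -
    have "\<delta> \<longlonglongrightarrow> (\<Sum>j\<in>(UNIV::3 set). sqrt 0 * sqrt K) + F * 0"
      unfolding \<delta>_def by (intro tendsto_intros cutoff_error_tendsto B)
    then show ?thesis by simp
  qed
  have le: "cmod (cutoff_pairing n r - energy_pairing r) \<le> \<delta> n" if r: "r \<in> {0..1}" for n r
  proof -
    have r': "0 \<le> r" "r \<le> 1" using r by auto
    have p: "cmod ((LINT x|lborel. cutoff_d n j x * pdiff j (u r) x) - (LINT x|lborel. cnj (pdiff j (u 0) x) * pdiff j (u r) x))
        \<le> sqrt (cutoff_error n j) * sqrt K" for j
    proof -
      have i1: "integrable lborel (\<lambda>x. cutoff_d n j x * pdiff j (u r) x)"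
        by (rule integrable_compact_support[where R="real (Suc n)"])
          (auto intro!: continuous_on_mult continuous_cutoff Ck2D(5)[OF C2] simp: cutoff_eq_0)
      have i2: "integrable lborel (\<lambda>x. cnj (pdiff j (u 0) x) * pdiff j (u r) x)"
        by (rule Cauchy_Schwarz_integral(1)) (use K(2)[OF r'] grad0_integrable in auto)
      have "(LINT x|lborel. cutoff_d n j x * pdiff j (u r) x) - (LINT x|lborel. cnj (pdiff j (u 0) x) * pdiff j (u r) x)
         = (LINT x|lborel. (cutoff_d n j x - cnj (pdiff j (u 0) x)) * pdiff j (u r) x)"
        using i1 i2 by (simp add: left_diff_distrib)
      also have "cmod \<dots> \<le> sqrt (cutoff_error n j) * sqrt (LINT x|lborel. (cmod (pdiff j (u r) x))\<^sup>2)"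
        unfolding cutoff_error_def
        by (rule Cauchy_Schwarz_integral(2)) (use K(2)[OF r'] cutoff_d_diff_integrable in auto)
      also have "\<dots> \<le> sqrt (cutoff_error n j) * sqrt K"
        using K(3)[OF r'] by (intro mult_left_mono) (auto simp: cutoff_error_def)
      finally show ?thesis .
    qed
    have q: "cmod ((LINT x|lborel. cutoff n x * f r x) - (LINT x|lborel. cnj (u 0 x) * f r x)) \<le> F * B n"
    proof -
      have i1: "integrable lborel (\<lambda>x. cutoff n x * f r x)"
        by (rule integrable_compact_support[where R="real (Suc n)"])
          (auto intro!: continuous_on_mult continuous_cutoff exp_decay_slice(1)[OF exp_decay_f] simp: cutoff_eq_0)
      have i2: "integrable lborel (\<lambda>x. cnj (u 0 x) * f r x)"
        using exp_decay_integrable[OF exp_decay_mult[OF exp_decay_time[OF exp_decay_cnj[OF exp_decay_u], of "\<lambda>_. 0"] exp_decay_f]] by simp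
      have "(LINT x|lborel. cutoff n x * f r x) - (LINT x|lborel. cnj (u 0 x) * f r x) = (LINT x|lborel. (cutoff n x - cnj (u 0 x)) * f r x)"
        using i1 i2 by (simp add: left_diff_distrib)
      also have "cmod \<dots> \<le> (LINT x|lborel. cmod ((cutoff n x - cnj (u 0 x)) * f r x))" by (rule integral_norm_bound)
      also have "\<dots> \<le> (LINT x|lborel. cmod (cutoff n x - cnj (u 0 x)) * F)"
      proof (rule integral_mono)
        show "integrable lborel (\<lambda>x. cmod ((cutoff n x - cnj (u 0 x)) * f r x))"
          using i1 i2 by (intro integrable_norm) (simp add: left_diff_distrib)
        show "cmod ((cutoff n x - cnj (u 0 x)) * f r x) \<le> cmod (cutoff n x - cnj (u 0 x)) * F" for x
          unfolding norm_mult by (intro mult_left_mono F) simp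
      qed (use iB in auto)
      finally show ?thesis by (simp add: B_def mult.commute)
    qed
    have "cutoff_pairing n r - energy_pairing r
       = (\<Sum>j\<in>UNIV. (LINT x|lborel. cutoff_d n j x * pdiff j (u r) x) - (LINT x|lborel. cnj (pdiff j (u 0) x) * pdiff j (u r) x))
         + ((LINT x|lborel. cutoff n x * f r x) - (LINT x|lborel. cnj (u 0 x) * f r x))"
      by (simp add: cutoff_pairing_eq energy_pairing_def sum_subtractf)
    also have "cmod \<dots> \<le> \<delta> n"
      unfolding \<delta>_def by (intro norm_triangle_le add_mono q order_trans[OF norm_sum] sum_mono p)
    finally show ?thesis .
  qed
  show "uniform_limit {0..1} cutoff_pairing energy_pairing sequentially"
  proof (rule uniform_limitI)
    fix e :: real assume "e > 0"
    with \<delta> have "\<forall>\<^sub>F n in sequentially. \<delta> n < e" by (rule order_tendstoD)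
    then show "\<forall>\<^sub>F n in sequentially. \<forall>r\<in>{0..1}. dist (cutoff_pairing n r) (energy_pairing r) < e"
      by eventually_elim (auto simp: dist_norm intro!: le_less_trans[OF le])
  qed
  show "(\<lambda>n. LINT x|lborel. cutoff n x * u h x) \<longlonglongrightarrow> (LINT x|lborel. cnj (u 0 x) * u h x)"
  proof (rule integral_dominated_convergence[where w="\<lambda>x. cmod (u 0 x) * U"])
    show "AE x in lborel. (\<lambda>n. cutoff n x * u h x) \<longlonglongrightarrow> cnj (u 0 x) * u h x"
      by (intro AE_I2 tendsto_intros ct)
    show "AE x in lborel. norm (cutoff n x * u h x) \<le> cmod (u 0 x) * U" for n
      unfolding norm_mult using cb(1) U(2) by (intro AE_I2 mult_mono) auto
  qed (use iu in auto)
qed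

lemma energy_pairing_0: "energy_pairing 0 = of_real (kinetic + (LINT x|lborel. power_profile lam1 lam2 ((cmod (u 0 x))\<^sup>2) * (cmod (u 0 x))\<^sup>2))"
proof -
  have "(LINT x|lborel. cnj (pdiff j (u 0) x) * pdiff j (u 0) x) = of_real (LINT x|lborel. (cmod (pdiff j (u 0) x))\<^sup>2)" for j
    unfolding integral_complex_of_real[symmetric]
    by (rule Bochner_Integration.integral_cong[OF refl]) (simp only: complex_norm_square mult.commute)
  moreover have "kinetic = (\<Sum>j\<in>UNIV. LINT x|lborel. (cmod (pdiff j (u 0) x))\<^sup>2)"
    unfolding kinetic_def by (rule Bochner_Integration.integral_sum) (rule grad0_integrable)
  moreover have "(LINT x|lborel. cnj (u 0 x) * f 0 x) = of_real (LINT x|lborel. power_profile lam1 lam2 ((cmod (u 0 x))\<^sup>2) * (cmod (u 0 x))\<^sup>2)"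
    unfolding integral_complex_of_real[symmetric]
  proof (rule Bochner_Integration.integral_cong[OF refl])
    fix x
    show "cnj (u 0 x) * f 0 x = of_real (power_profile lam1 lam2 ((cmod (u 0 x))\<^sup>2) * (cmod (u 0 x))\<^sup>2)"
      unfolding nonlinearity_def of_real_mult complex_norm_square by (simp only: mult_ac)
  qed
  ultimately show ?thesis by (simp add: energy_pairing_def)
qed

text \<open>For the cutoffs the increment is a time integral of \<open>cutoff_pairing\<close>.
  Uniform convergence passes this on to \<open>energy_pairing\<close>, whose continuity gives the
  derivative at 0. The limit is one-sided, as gradients are controlled forward in time.\<close>

lemma initial_velocity:
  "((\<lambda>h. (LINT x|lborel. cnj (u 0 x) * (u h x - u 0 x)) /\<^sub>R h) \<longlongrightarrow>
     - \<i> * of_real (kinetic + (LINT x|lborel. power_profile lam1 lam2 ((cmod (u 0 x))\<^sup>2) * (cmod (u 0 x))\<^sup>2))) (at_right 0)"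
proof -
  let ?Z = "\<lambda>h. LINT x|lborel. cnj (u 0 x) * u h x"
  have ce: "continuous_on {0..1} energy_pairing"
    by (rule uniform_limit_theorem[OF _ cutoff_uniform_limit(1)])
      (auto intro!: always_eventually cutoff_pairing_continuous)
  have Z: "?Z h - ?Z 0 = - \<i> * integral {0..h} energy_pairing" if h: "0 \<le> h" "h \<le> 1" for h
  proof -
    have fin: "(LINT x|lborel. cutoff n x * u h x) - (LINT x|lborel. cutoff n x * u 0 x) = - \<i> * integral {0..h} (cutoff_pairing n)" for n
    proof -
      have "((\<lambda>r. LINT x|lborel. cutoff n x * ut r x) has_integral
         (LINT x|lborel. cutoff n x * u h x) - (LINT x|lborel. cutoff n x * u 0 x)) {0..h}"
        by (rule fundamental_theorem_of_calculus[OF h(1)])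
          (rule has_vector_derivative_at_within[OF test_pairing_derivative[OF continuous_cutoff(1) cutoff_eq_0(1)]])
      moreover have "(LINT x|lborel. cutoff n x * ut r x) = - \<i> * cutoff_pairing n r" for r
      proof -
        have "(LINT x|lborel. cutoff n x * ut r x) = (LINT x|lborel. - \<i> * (cutoff n x * (\<i> * ut r x)))"
          by (rule Bochner_Integration.integral_cong[OF refl]) (simp add: algebra_simps)
        then show ?thesis unfolding cutoff_pairing_def by (simp only: integral_mult_right_zero)
      qed
      ultimately have "((\<lambda>r. - \<i> * cutoff_pairing n r) has_integral
         (LINT x|lborel. cutoff n x * u h x) - (LINT x|lborel. cutoff n x * u 0 x)) {0..h}"
        by (simp only:)
      then show ?thesis
        by (rule has_integral_unique[OF _ has_integral_mult_right[OF integrable_integral[OF integrable_continuous_real[OF cutoff_pairing_continuous]]]])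
    qed
    have ul: "uniform_limit (cbox 0 h) cutoff_pairing energy_pairing sequentially"
      by (rule uniform_limit_on_subset[OF cutoff_uniform_limit(1)]) (use h in auto)
    obtain I J where IJ: "\<And>n. (cutoff_pairing n has_integral I n) (cbox 0 h)" "(energy_pairing has_integral J) (cbox 0 h)" "I \<longlonglongrightarrow> J"
      using uniform_limit_integral_cbox[OF ul cutoff_pairing_continuous sequentially_bot] by blast
    have "(\<lambda>n. integral {0..h} (cutoff_pairing n)) \<longlonglongrightarrow> integral {0..h} energy_pairing"
      using IJ(3) unfolding integral_unique[OF IJ(1), unfolded cbox_interval] integral_unique[OF IJ(2), unfolded cbox_interval] .
    then have "(\<lambda>n. - \<i> * integral {0..h} (cutoff_pairing n)) \<longlonglongrightarrow> - \<i> * integral {0..h} energy_pairing"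
      by (intro tendsto_intros)
    moreover have "(\<lambda>n. - \<i> * integral {0..h} (cutoff_pairing n)) \<longlonglongrightarrow> ?Z h - ?Z 0"
      unfolding fin[symmetric] by (intro tendsto_diff cutoff_uniform_limit(2))
    ultimately show ?thesis using LIMSEQ_unique by blast
  qed
  have "((\<lambda>h. integral {0..h} energy_pairing) has_vector_derivative energy_pairing 0) (at 0 within {0..1})"
    by (rule integral_has_vector_derivative[OF ce]) simp
  then have "((\<lambda>h. norm (integral {0..h} energy_pairing - h *\<^sub>R energy_pairing 0) / norm h) \<longlongrightarrow> 0) (at_right 0)"
    by (simp add: has_vector_derivative_def has_derivative_iff_norm at_within_Icc_at_right)
  moreover have "\<forall>\<^sub>F h in at_right 0. norm (integral {0..h} energy_pairing - h *\<^sub>R energy_pairing 0) / norm h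
      = norm (integral {0..h} energy_pairing /\<^sub>R h - energy_pairing 0)"
  proof -
    have "norm (w - h *\<^sub>R e) / norm h = norm (w /\<^sub>R h - e)" if "h > 0" for h and w e :: complex
    proof -
      have "w /\<^sub>R h - e = (w - h *\<^sub>R e) /\<^sub>R h" using that by (simp add: scaleR_diff_right)
      then show ?thesis by (simp add: divide_inverse mult.commute)
    qed
    then show ?thesis by (simp add: eventually_at_filter)
  qed
  ultimately have "((\<lambda>h. norm (integral {0..h} energy_pairing /\<^sub>R h - energy_pairing 0)) \<longlongrightarrow> 0) (at_right 0)"
    by (rule Lim_transform_eventually)
  then have "((\<lambda>h. integral {0..h} energy_pairing /\<^sub>R h) \<longlongrightarrow> energy_pairing 0) (at_right 0)"
    by (simp add: tendsto_norm_zero_iff LIM_zero_iff)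
  then have "((\<lambda>h. - \<i> * (integral {0..h} energy_pairing /\<^sub>R h)) \<longlongrightarrow> - \<i> * energy_pairing 0) (at_right 0)"
    by (intro tendsto_intros)
  then show ?thesis
    unfolding energy_pairing_0
  proof (rule Lim_transform_eventually)
    have "- \<i> * (integral {0..h} energy_pairing /\<^sub>R h) = (LINT x|lborel. cnj (u 0 x) * (u h x - u 0 x)) /\<^sub>R h" if "0 < h" "h < 1" for h
    proof -
      have "integrable lborel (\<lambda>x. cnj (u 0 x) * u h x)" for h
        using exp_decay_integrable[OF exp_decay_mult[OF exp_decay_time[OF exp_decay_cnj[OF exp_decay_u], of "\<lambda>_. 0"] exp_decay_u]] by simp
      then have "(LINT x|lborel. cnj (u 0 x) * (u h x - u 0 x)) = ?Z h - ?Z 0"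
        by (simp add: right_diff_distrib)
      then show ?thesis using Z[of h] that by simp
    qed
    then show "\<forall>\<^sub>F h in at_right 0. - \<i> * (integral {0..h} energy_pairing /\<^sub>R h) = (LINT x|lborel. cnj (u 0 x) * (u h x - u 0 x)) /\<^sub>R h"
      by (auto simp: eventually_at intro!: exI[of _ 1])
  qed
qed

text \<open>By mass conservation the squared \<open>L^2\<close> distance to \<open>u 0\<close> is
  \<open>- 2\<close> times the real part of a pairing whose derivative at 0 is purely imaginary, so
  it is of smaller order than \<open>h\<close>. The boundary term of the virial identity lives on
  this gain.\<close>

lemma initial_increment:
  "((\<lambda>h. (LINT x|lborel. (cmod (u h x - u 0 x))\<^sup>2) / h) \<longlongrightarrow> 0) (at_right 0)"
proof -
  let ?Z = "\<lambda>h. LINT x|lborel. cnj (u 0 x) * (u h x - u 0 x)"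
  have eq: "(LINT x|lborel. (cmod (u h x - u 0 x))\<^sup>2) = - 2 * Re (?Z h)" if "h \<ge> 0" for h
  proof -
    have e: "exp_decay (\<lambda>h x. cnj (u 0 x) * (u h x - u 0 x))"
      using exp_decay_mult[OF exp_decay_time[OF exp_decay_cnj[OF exp_decay_u], of "\<lambda>_. 0"] exp_decay_diff[OF exp_decay_u exp_decay_time[OF exp_decay_u, of "\<lambda>_. 0"]]] by simp
    have "(cmod (u h x - u 0 x))\<^sup>2 = (cmod (u h x))\<^sup>2 - (cmod (u 0 x))\<^sup>2 - 2 * Re (cnj (u 0 x) * (u h x - u 0 x))" for x
      unfolding cmod_power2 by (simp add: power2_eq_square algebra_simps)
    then have "(LINT x|lborel. (cmod (u h x - u 0 x))\<^sup>2)
        = (LINT x|lborel. (cmod (u h x))\<^sup>2 - (cmod (u 0 x))\<^sup>2 - 2 * Re (cnj (u 0 x) * (u h x - u 0 x)))"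
      by (simp only:)
    also have "\<dots> = mass (u h) - mass (u 0) - 2 * (LINT x|lborel. Re (cnj (u 0 x) * (u h x - u 0 x)))"
      using square_integrable_u integrable_Re[OF exp_decay_integrable[OF e, of h]]
      by (simp only: mass_def Bochner_Integration.integral_diff Bochner_Integration.integrable_diff integrable_mult_right integral_mult_right_zero)
    finally have "(LINT x|lborel. (cmod (u h x - u 0 x))\<^sup>2) = mass (u h) - mass (u 0) - 2 * Re (?Z h)"
      by (simp only: integral_Re[OF exp_decay_integrable[OF e, of h]])
    then show ?thesis using mass_conservation[OF that] by simp
  qed
  have "((\<lambda>h. - 2 * Re (?Z h /\<^sub>R h)) \<longlongrightarrow> - 2 * Re (- \<i> * of_real (kinetic + (LINT x|lborel. power_profile lam1 lam2 ((cmod (u 0 x))\<^sup>2) * (cmod (u 0 x))\<^sup>2)))) (at_right 0)"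
    by (intro tendsto_intros initial_velocity)
  then have "((\<lambda>h. - 2 * Re (?Z h /\<^sub>R h)) \<longlongrightarrow> 0) (at_right 0)" by simp
  then show ?thesis
    by (rule Lim_transform_eventually) (auto simp: eventually_at_filter eq divide_inverse mult.commute)
qed

end

section \<open>The virial identity over one period\<close>

text \<open>The antiderivative of \<open>\<rho> * power_profile' \<rho>\<close>, that is, \<open>\<rho> * power_profile \<rho>\<close> minus the potential energy density.\<close>

definition virial_profile :: "real \<Rightarrow> real \<Rightarrow> real \<Rightarrow> real" where
  "virial_profile lam1 lam2 \<rho> = lam1 / 2 * \<rho>\<^sup>2 - 2 * lam2 / 3 * \<rho> ^ 3"

text \<open>With \<open>\<rho>\<close>, \<open>\<sigma>\<close> the squared moduli,
  \<open>Re (cnj a * b)\<close> is \<open>(\<rho> + \<sigma>) / 2\<close> minus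
  \<open>cmod (b - a) ^ 2 / 2\<close>. The derivative of \<open>virial_profile\<close> is
  \<open>\<rho>\<close> times that of \<open>power_profile\<close>, so the mean
  \<open>(\<rho> + \<sigma>) / 2\<close> acts as a trapezoidal rule with cubic error, here exactly
  \<open>- (lam2 / 6) * (\<sigma> - \<rho>) ^ 3\<close>. The other correction is a Lipschitz
  increment times a square.\<close>

lemma virial_profile_increment:
  fixes U :: real
  assumes U: "U \<ge> 0"
  obtains M where "M \<ge> 0" "\<And>a b. cmod a \<le> U \<Longrightarrow> cmod b \<le> U \<Longrightarrow>
    \<bar>(power_profile lam1 lam2 ((cmod a)\<^sup>2) - power_profile lam1 lam2 ((cmod b)\<^sup>2)) * Re (cnj a * b)
      - (virial_profile lam1 lam2 ((cmod a)\<^sup>2) - virial_profile lam1 lam2 ((cmod b)\<^sup>2))\<bar> \<le> M * cmod (b - a) ^ 3"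
    "\<And>a b. cmod a \<le> U \<Longrightarrow> cmod b \<le> U \<Longrightarrow>
    \<bar>power_profile lam1 lam2 ((cmod b)\<^sup>2) * Re (cnj a * b) - power_profile lam1 lam2 ((cmod a)\<^sup>2) * (cmod a)\<^sup>2\<bar>
      \<le> M * (cmod a * cmod (b - a))"
proof -
  define A where "A = \<bar>lam1\<bar> + 2 * \<bar>lam2\<bar> * U\<^sup>2"
  have A: "A \<ge> 0" by (simp add: A_def)
  define M where "M = \<bar>lam2\<bar> / 6 * (2 * U) ^ 3 + A * U + (A * U\<^sup>2 + A * (2 * U) * U)"
  have M: "M \<ge> 0" "\<bar>lam2\<bar> / 6 * (2 * U) ^ 3 + A * U \<le> M" "A * U\<^sup>2 + A * (2 * U) * U \<le> M"
    using A U by (auto simp: M_def)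
  have sq: "0 \<le> (cmod a)\<^sup>2" "(cmod a)\<^sup>2 \<le> U\<^sup>2" if "cmod a \<le> U" for a
    using that by (auto intro: power_mono)
  let ?k = "\<lambda>a. power_profile lam1 lam2 ((cmod a)\<^sup>2)" and ?v = "\<lambda>a. virial_profile lam1 lam2 ((cmod a)\<^sup>2)"
  have kd: "\<bar>?k b - ?k a\<bar> \<le> A * (2 * U * cmod (b - a))" if "cmod a \<le> U" "cmod b \<le> U" for a b
    using abs_power_profile_diff_le[OF sq[OF that(1)] sq[OF that(2)], of lam1 lam2]
      mult_left_mono[OF abs_normsq_diff_le[OF that] A] by (simp add: A_def)
  have "\<bar>(?k a - ?k b) * Re (cnj a * b) - (?v a - ?v b)\<bar> \<le> M * cmod (b - a) ^ 3" if ab: "cmod a \<le> U" "cmod b \<le> U" for a b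
  proof -
    define d where "d = cmod (b - a)"
    have re: "Re (cnj a * b) = ((cmod a)\<^sup>2 + (cmod b)\<^sup>2 - d\<^sup>2) / 2"
      unfolding d_def cmod_power2 by (simp add: power2_eq_square algebra_simps)
    have alg: "(power_profile lam1 lam2 \<rho> - power_profile lam1 lam2 \<sigma>) * ((\<rho> + \<sigma> - D) / 2)
       - (virial_profile lam1 lam2 \<rho> - virial_profile lam1 lam2 \<sigma>)
       = - (lam2 / 6) * (\<sigma> - \<rho>) ^ 3 + (power_profile lam1 lam2 \<sigma> - power_profile lam1 lam2 \<rho>) * (D / 2)" for \<rho> \<sigma> D
      by (simp add: power_profile_def virial_profile_def power2_eq_square power3_eq_cube field_simps)
    have c: "\<bar>- (lam2 / 6) * ((cmod b)\<^sup>2 - (cmod a)\<^sup>2) ^ 3\<bar> \<le> \<bar>lam2\<bar> / 6 * (2 * U * d) ^ 3"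
      using power_mono[OF abs_normsq_diff_le[OF ab], of 3]
      by (simp add: abs_mult power_abs d_def mult_left_mono)
    have e: "\<bar>(?k b - ?k a) * (d\<^sup>2 / 2)\<bar> \<le> A * (2 * U * d) * (d\<^sup>2 / 2)"
      unfolding abs_mult d_def using kd[OF ab] by (intro mult_mono) auto
    have "\<bar>(?k a - ?k b) * Re (cnj a * b) - (?v a - ?v b)\<bar> \<le> \<bar>lam2\<bar> / 6 * (2 * U * d) ^ 3 + A * (2 * U * d) * (d\<^sup>2 / 2)"
      unfolding re alg using c e by linarith
    also have "\<dots> = (\<bar>lam2\<bar> / 6 * (2 * U) ^ 3 + A * U) * d ^ 3"
      by (simp add: algebra_simps power2_eq_square power3_eq_cube)
    also have "\<dots> \<le> M * d ^ 3" using M by (intro mult_right_mono) (auto simp: d_def)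
    finally show ?thesis by (simp add: d_def)
  qed
  moreover have "\<bar>?k b * Re (cnj a * b) - ?k a * (cmod a)\<^sup>2\<bar> \<le> M * (cmod a * cmod (b - a))"
    if ab: "cmod a \<le> U" "cmod b \<le> U" for a b
  proof -
    define d where "d = cmod (b - a)"
    have "(cmod a)\<^sup>2 = Re (cnj a * a)" unfolding cmod_power2 by (simp add: power2_eq_square)
    then have eq: "?k b * Re (cnj a * b) - ?k a * (cmod a)\<^sup>2 = ?k b * Re (cnj a * (b - a)) + (?k b - ?k a) * (cmod a)\<^sup>2"
      by (simp add: algebra_simps)
    have kb: "\<bar>?k b\<bar> \<le> A * U\<^sup>2"
      using abs_power_profile_diff_le[of 0 "U\<^sup>2" "(cmod b)\<^sup>2" lam1 lam2] sq[OF ab(2)] A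
        mult_left_mono[of "(cmod b)\<^sup>2" "U\<^sup>2" A]
      by (simp add: power_profile_def A_def)
    have "\<bar>Re (cnj a * (b - a))\<bar> \<le> cmod a * d"
      using abs_Re_le_cmod[of "cnj a * (b - a)"] by (simp add: norm_mult d_def)
    then have "\<bar>?k b * Re (cnj a * (b - a))\<bar> \<le> (A * U\<^sup>2) * (cmod a * d)"
      unfolding abs_mult using kb A by (intro mult_mono) auto
    moreover have "\<bar>(?k b - ?k a) * (cmod a)\<^sup>2\<bar> \<le> (A * (2 * U * d)) * (U * cmod a)"
      unfolding abs_mult using kd[OF ab] ab A U
      by (intro mult_mono) (auto simp: d_def power2_eq_square intro!: mult_right_mono)
    ultimately have "\<bar>?k b * Re (cnj a * b) - ?k a * (cmod a)\<^sup>2\<bar> \<le> (A * U\<^sup>2) * (cmod a * d) + (A * (2 * U * d)) * (U * cmod a)"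
      unfolding eq by linarith
    also have "\<dots> = (A * U\<^sup>2 + A * (2 * U) * U) * (cmod a * d)" by (simp add: algebra_simps)
    also have "\<dots> \<le> M * (cmod a * d)" using M by (intro mult_right_mono) (auto simp: d_def)
    finally show ?thesis by (simp add: d_def)
  qed
  ultimately show ?thesis using M(1) that by blast
qed

section \<open>A solution compared with its parabolic dilates\<close>

context decaying_nls
begin

text \<open>The quantity \<open>Q\<close> of the overview; \<open>virial_integral\<close> is
  \<open>V\<close>.\<close>

definition profile_integral :: "real \<Rightarrow> real" where
  "profile_integral t = (LINT x|lborel. power_profile lam1 lam2 ((cmod (u t x))\<^sup>2) * (cmod (u t x))\<^sup>2)"

definition virial_integral :: "real \<Rightarrow> real" where
  "virial_integral t = (LINT x|lborel. virial_profile lam1 lam2 ((cmod (u t x))\<^sup>2))"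

lemma exp_decay_sq: "exp_decay (\<lambda>t x. (cmod (u t x))\<^sup>2)"
  using exp_decay_power[OF exp_decay_norm[OF exp_decay_u], of 2] by simp

lemma exp_decay_real_profile: "exp_decay (\<lambda>t x. power_profile lam1 lam2 ((cmod (u t x))\<^sup>2))"
  unfolding power_profile_def by (intro exp_decay_diff exp_decay_cmult exp_decay_power exp_decay_sq) auto

lemma exp_decay_virial: "exp_decay (\<lambda>t x. virial_profile lam1 lam2 ((cmod (u t x))\<^sup>2))"
  unfolding virial_profile_def by (intro exp_decay_diff exp_decay_cmult exp_decay_power exp_decay_sq) auto

lemma continuous_virial_integral: "continuous_on S virial_integral" "continuous_on S profile_integral"
  unfolding virial_integral_def profile_integral_def
  by (intro exp_decay_integral_continuous exp_decay_virial exp_decay_mult exp_decay_real_profile exp_decay_sq)+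

definition dilate :: "real \<Rightarrow> real \<Rightarrow> real^3 \<Rightarrow> complex" where
  "dilate s t x = u (s\<^sup>2 * t) (s *\<^sub>R x)"

lemma exp_decay_dilated:
  assumes "exp_decay w" "s \<ge> 1" shows "exp_decay (\<lambda>t x. w (s\<^sup>2 * t) (s *\<^sub>R x))"
  by (intro exp_decay_scale[OF exp_decay_time[OF assms(1)]] assms(2) continuous_intros)

lemma exp_decay_dilate: "s \<ge> 1 \<Longrightarrow> exp_decay (dilate s)"
  unfolding dilate_def[abs_def] by (rule exp_decay_dilated[OF exp_decay_u])

text \<open>Outside a large ball both functions are small by decay, and \<open>s > 1\<close> keeps
  the dilated point outside. Inside, \<open>u\<close> is uniformly continuous on a compact set that
  contains all dilated points with \<open>s < 2\<close>.\<close>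

lemma dilate_uniformly_close:
  assumes e: "e > 0"
  shows "\<forall>\<^sub>F s in at_right 1. \<forall>t\<in>{0..\<tau>}. \<forall>x. cmod (dilate s t x - u t x) \<le> e"
proof -
  obtain C \<gamma> where C: "C > 0" "\<gamma> > 0" "\<And>t x. cmod (u t x) \<le> C * exp (- \<gamma> * norm x)" using exp_decayE[OF exp_decay_u] by metis
  \<comment> \<open>Beyond radius \<open>R\<close> twice the decay bound is at most
    \<open>e\<close>; the absolute value keeps \<open>R\<close> nonnegative.\<close>
  define R where "R = \<bar>ln (2 * C / e)\<bar> / \<gamma>"
  have R: "R \<ge> 0" using C by (simp add: R_def)
  have small: "2 * (C * exp (- \<gamma> * r)) \<le> e" if "r \<ge> R" for r
  proof -
    have "\<gamma> * R \<le> \<gamma> * r" using that C by simp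
    moreover have "\<gamma> * R = \<bar>ln (2 * C / e)\<bar>" using C by (simp add: R_def)
    ultimately have "ln (2 * C / e) \<le> \<gamma> * r" by linarith
    then have "exp (ln (2 * C / e)) \<le> exp (\<gamma> * r)" by (simp only: exp_le_cancel_iff)
    then have "2 * C / e \<le> exp (\<gamma> * r)" using C e by simp
    then show ?thesis using e by (simp add: exp_minus field_simps)
  qed
  define \<tau>' where "\<tau>' = \<bar>\<tau>\<bar>"
  have "uniformly_continuous_on ({0..4 * \<tau>'} \<times> cball 0 (2 * R)) (\<lambda>(t, x). u t x)"
    by (intro compact_uniformly_continuous continuous_on_subset[OF u_continuous] compact_Times) auto
  then obtain \<delta> where \<delta>: "\<delta> > 0" "\<And>p p'. p \<in> {0..4 * \<tau>'} \<times> cball 0 (2 * R) \<Longrightarrow> p' \<in> {0..4 * \<tau>'} \<times> cball 0 (2 * R) \<Longrightarrow>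
     dist p' p < \<delta> \<Longrightarrow> dist (case p' of (t, x) \<Rightarrow> u t x) (case p of (t, x) \<Rightarrow> u t x) < e"
    unfolding uniformly_continuous_on_def using e by metis
  \<comment> \<open>The minimum with 1 keeps \<open>s < 2\<close>, hence
    \<open>s\<^sup>2 * t \<le> 4 * \<tau>'\<close> and
    \<open>s\<^sup>2 - 1 \<le> 3 * (s - 1)\<close>; the displacement in space-time is then at most
    \<open>(s - 1) * (3 * \<tau>' + R)\<close>, below \<open>\<delta>\<close>.\<close>
  define \<eta> where "\<eta> = min 1 (\<delta> / (3 * \<tau>' + R + 1))"
  have den: "3 * \<tau>' + R + 1 > 0" using R by (simp add: \<tau>'_def add_nonneg_pos)
  have \<eta>: "\<eta> > 0" using \<delta>(1) den by (simp add: \<eta>_def)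
  have "cmod (dilate s t x - u t x) \<le> e" if s: "1 < s" "s < 1 + \<eta>" and t: "t \<in> {0..\<tau>}" for s t x
  proof (cases "norm x \<le> R")
    case True
    have s2: "s < 2" using s by (simp add: \<eta>_def)
    have t': "0 \<le> t" "t \<le> \<tau>'" using t by (auto simp: \<tau>'_def)
    have ssq: "s\<^sup>2 \<le> 4" using power_mono[of s 2 2] s s2 by simp
    have m1: "s\<^sup>2 * t \<le> 4 * \<tau>'" using mult_mono[OF ssq t'(2)] t' by simp
    have m2: "s * norm x \<le> 2 * R" using mult_mono[of s 2 "norm x" R] True s s2 by simp
    have in1: "(s\<^sup>2 * t, s *\<^sub>R x) \<in> {0..4 * \<tau>'} \<times> cball 0 (2 * R)" using m1 m2 t' s by simp
    have in2: "(t, x) \<in> {0..4 * \<tau>'} \<times> cball 0 (2 * R)" using True t' R by simp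
    have sq: "s\<^sup>2 - 1 \<le> (s - 1) * 3"
    proof -
      have "s\<^sup>2 - 1 = (s - 1) * (s + 1)" by (simp add: power2_eq_square algebra_simps)
      also have "\<dots> \<le> (s - 1) * 3" using s s2 by (intro mult_left_mono) auto
      finally show ?thesis .
    qed
    have "dist (s\<^sup>2 * t, s *\<^sub>R x) (t, x) \<le> dist (s\<^sup>2 * t) t + dist (s *\<^sub>R x) x"
      unfolding dist_Pair_Pair by (rule sqrt_sum_squares_le_sum) auto
    also have "dist (s\<^sup>2 * t) t = (s\<^sup>2 - 1) * t"
    proof -
      have "s\<^sup>2 * t - t = (s\<^sup>2 - 1) * t" by (simp add: algebra_simps)
      moreover have "(s\<^sup>2 - 1) * t \<ge> 0" using s t' by simp
      ultimately show ?thesis by (simp add: dist_real_def)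
    qed
    also have "dist (s *\<^sub>R x) x = (s - 1) * norm x"
    proof -
      have "s *\<^sub>R x - x = (s - 1) *\<^sub>R x" by (simp add: algebra_simps)
      then show ?thesis using s by (simp add: dist_norm)
    qed
    also have "(s\<^sup>2 - 1) * t + (s - 1) * norm x \<le> ((s - 1) * 3) * \<tau>' + (s - 1) * R"
      using sq t' True s by (intro add_mono mult_mono) auto
    also have "\<dots> = (s - 1) * (3 * \<tau>' + R)" by (simp add: algebra_simps)
    also have "\<dots> < (s - 1) * (3 * \<tau>' + R + 1)" using s by simp
    also have "\<dots> \<le> \<delta>"
    proof -
      have "s - 1 \<le> \<delta> / (3 * \<tau>' + R + 1)" using s by (simp add: \<eta>_def)
      then show ?thesis using den by (simp add: pos_le_divide_eq)
    qed
    finally have "dist (s\<^sup>2 * t, s *\<^sub>R x) (t, x) < \<delta>" .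
    from \<delta>(2)[OF in2 in1 this] show ?thesis by (simp add: dist_norm dilate_def)
  next
    case False
    have "norm x \<le> norm (s *\<^sub>R x)" using s mult_right_mono[of 1 s "norm x"] by simp
    then have "C * exp (- \<gamma> * norm (s *\<^sub>R x)) \<le> C * exp (- \<gamma> * norm x)" using C by simp
    then have "cmod (dilate s t x - u t x) \<le> 2 * (C * exp (- \<gamma> * norm x))"
      using norm_triangle_ineq4[of "dilate s t x" "u t x"] C(3)[of "s\<^sup>2 * t" "s *\<^sub>R x"] C(3)[of t x]
      unfolding dilate_def by linarith
    with small[of "norm x"] False show ?thesis by linarith
  qed
  then show ?thesis using \<eta> by (auto simp: eventually_at_right_field intro!: exI[of _ "1 + \<eta>"])
qed

end

context decaying_nls_h1
begin

text \<open>The dilate solves the equation with \<open>s\<^sup>2\<close> in front of the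
  nonlinearity. The excess \<open>s\<^sup>2 - 1\<close> is a forcing of order \<open>s - 1\<close>,
  the remaining forcing is Lipschitz in the difference, and at time 0
  \<open>dilation_increment\<close> applies; Gronwall keeps the order \<open>s - 1\<close>.\<close>

lemma dilate_l2_close:
  obtains K where "K \<ge> 0" "\<And>s t. 1 \<le> s \<Longrightarrow> s \<le> 2 \<Longrightarrow> 0 \<le> t \<Longrightarrow> t \<le> \<tau> \<Longrightarrow>
     (LINT x|lborel. (cmod (dilate s t x - u t x))\<^sup>2) \<le> (s - 1) * K"
proof -
  obtain C \<gamma> where C: "C > 0" "\<gamma> > 0" "\<And>t x. cmod (u t x) \<le> C * exp (- \<gamma> * norm x)" using exp_decayE[OF exp_decay_u] by metis
  obtain K0 where K0: "K0 \<ge> 0" "\<And>s. s \<ge> 1 \<Longrightarrow> (\<integral>\<^sup>+x. ennreal ((cmod (u 0 (s *\<^sub>R x) - u 0 x))\<^sup>2) \<partial>lborel) \<le> ennreal ((s - 1) * K0)"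
    using dilation_increment[OF C2[of 0] C(2) C(3)[of 0] grad0] by blast
  obtain U where U: "U > 0" "\<And>t x. cmod (u t x) \<le> U" using exp_decay_bounded[OF exp_decay_u] by metis
  obtain F where F: "F > 0" "\<And>t. (LINT x|lborel. cmod (f t x)) \<le> F" using exp_decay_integral_bounded[OF exp_decay_f] by metis
  obtain L where L: "L \<ge> 0" "\<And>t x s y. cmod (f t x - f s y) \<le> L * cmod (u t x - u s y)"
    using nonlinearity_lipschitz_along by metis
  \<comment> \<open>\<open>12 = 2 * 2 * 3\<close>: the factor 2 of the growth lemma,
    \<open>cmod (w r x) \<le> 2 * U\<close>, and
    \<open>s\<^sup>2 - 1 \<le> 3 * (s - 1)\<close>.\<close>
  define K where "K = (K0 + 12 * U * F * \<bar>\<tau>\<bar>) * exp (2 * L * \<bar>\<tau>\<bar>)"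
  have "(LINT x|lborel. (cmod (dilate s t x - u t x))\<^sup>2) \<le> (s - 1) * K"
    if s: "1 \<le> s" "s \<le> 2" and t: "0 \<le> t" "t \<le> \<tau>" for s t
  proof -
    define w where "w t x = dilate s t x - u t x" for t x
    define g where "g t x = of_real (s\<^sup>2 - 1) * f (s\<^sup>2 * t) (s *\<^sub>R x)" for t x
    have ww: "weak_schrodinger w (\<lambda>t x. of_real (s\<^sup>2) * f (s\<^sup>2 * t) (s *\<^sub>R x) - f t x)"
      unfolding w_def dilate_def by (rule weak_schrodinger_diff[OF weak_u weak_schrodinger_scale[OF weak_u s(1)]])
    have ef: "exp_decay (\<lambda>t x. f (s\<^sup>2 * t) (s *\<^sub>R x))" by (rule exp_decay_dilated[OF exp_decay_f s(1)])
    have eg: "exp_decay g" unfolding g_def[abs_def] by (rule exp_decay_cmult[OF ef])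
    have ew: "exp_decay w" by (rule weak_schrodingerD(1)[OF ww])
    have ew2: "exp_decay (\<lambda>t x. (cmod (w t x))\<^sup>2)" using exp_decay_power[OF exp_decay_norm[OF ew], of 2] by simp
    have s3: "0 \<le> s\<^sup>2 - 1" "s\<^sup>2 - 1 \<le> 3 * (s - 1)"
    proof -
      have "s\<^sup>2 - 1 = (s + 1) * (s - 1)" by (simp add: power2_eq_square algebra_simps)
      moreover have "(s + 1) * (s - 1) \<le> 3 * (s - 1)" using s by (intro mult_right_mono) auto
      moreover have "0 \<le> (s + 1) * (s - 1)" using s by simp
      ultimately show "0 \<le> s\<^sup>2 - 1" "s\<^sup>2 - 1 \<le> 3 * (s - 1)" by linarith+
    qed
    have "(LINT x|lborel. (cmod (w t x))\<^sup>2) \<le> ((LINT x|lborel. (cmod (w 0 x))\<^sup>2) + (12 * U * F * (s - 1)) * t) * exp (2 * L * t)"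
    proof (rule weak_schrodinger_l2_growth[OF ww L(1) t(1) eg])
      fix r x assume "0 \<le> r" "r \<le> t"
      have eq: "of_real (s\<^sup>2) * f (s\<^sup>2 * r) (s *\<^sub>R x) - f r x = (f (s\<^sup>2 * r) (s *\<^sub>R x) - f r x) + g r x"
        by (simp add: g_def algebra_simps)
      show "cmod (of_real (s\<^sup>2) * f (s\<^sup>2 * r) (s *\<^sub>R x) - f r x) \<le> L * cmod (w r x) + cmod (g r x)"
        using norm_triangle_ineq[of "f (s\<^sup>2 * r) (s *\<^sub>R x) - f r x" "g r x"] L(2)[of "s\<^sup>2 * r" "s *\<^sub>R x" r x]
        unfolding eq w_def dilate_def by linarith
    next
      fix r assume "0 \<le> r" "r \<le> t"
      have wU: "cmod (w r x) \<le> 2 * U" for x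
        using norm_triangle_ineq4[of "dilate s r x" "u r x"] U(2)[of "s\<^sup>2 * r" "s *\<^sub>R x"] U(2)[of r x]
        unfolding w_def dilate_def by linarith
      have "(LINT x|lborel. 2 * cmod (w r x) * cmod (g r x)) \<le> (LINT x|lborel. 12 * U * (s - 1) * cmod (f (s\<^sup>2 * r) (s *\<^sub>R x)))"
      proof (rule integral_mono)
        show "integrable lborel (\<lambda>x. 2 * cmod (w r x) * cmod (g r x))"
          using exp_decay_integrable[OF exp_decay_mult[OF exp_decay_norm[OF ew] exp_decay_norm[OF eg]], of r] by (simp add: mult.assoc)
        show "integrable lborel (\<lambda>x. 12 * U * (s - 1) * cmod (f (s\<^sup>2 * r) (s *\<^sub>R x)))"
          using exp_decay_integrable[OF exp_decay_norm[OF ef], of r] by (intro integrable_mult_right)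
        fix x
        have "cmod (g r x) \<le> (3 * (s - 1)) * cmod (f (s\<^sup>2 * r) (s *\<^sub>R x))"
          unfolding g_def norm_mult norm_of_real using s3 by (intro mult_right_mono) auto
        then have "2 * cmod (w r x) * cmod (g r x) \<le> (2 * (2 * U)) * ((3 * (s - 1)) * cmod (f (s\<^sup>2 * r) (s *\<^sub>R x)))"
          using wU[of x] U(1) by (intro mult_mono) auto
        also have "\<dots> = 12 * U * (s - 1) * cmod (f (s\<^sup>2 * r) (s *\<^sub>R x))" by algebra
        finally show "2 * cmod (w r x) * cmod (g r x) \<le> 12 * U * (s - 1) * cmod (f (s\<^sup>2 * r) (s *\<^sub>R x))" .
      qed
      also have "\<dots> = 12 * U * (s - 1) * (1 / s ^ 3 * (LINT x|lborel. cmod (f (s\<^sup>2 * r) x)))"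
      proof -
        have "(LINT x|lborel. cmod (f (s\<^sup>2 * r) (s *\<^sub>R x))) = (1 / s ^ 3) *\<^sub>R (LINT x|lborel. cmod (f (s\<^sup>2 * r) x))"
          using integral_scale[OF exp_decay_measurable[OF exp_decay_norm[OF exp_decay_f]], of s "s\<^sup>2 * r"] s by simp
        then show ?thesis by simp
      qed
      also have "\<dots> \<le> 12 * U * (s - 1) * (1 * F)"
      proof (intro mult_left_mono mult_mono)
        show "1 / s ^ 3 \<le> 1" using s one_le_power[of s 3] by (simp add: divide_simps)
      qed (use F s U in auto)
      finally show "(LINT x|lborel. 2 * cmod (w r x) * cmod (g r x)) \<le> 12 * U * F * (s - 1)" by (simp add: mult_ac)
    qed
    also have "\<dots> \<le> ((s - 1) * K0 + (12 * U * F * (s - 1)) * \<bar>\<tau>\<bar>) * exp (2 * L * \<bar>\<tau>\<bar>)"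
    proof -
      have "ennreal (LINT x|lborel. (cmod (w 0 x))\<^sup>2) \<le> ennreal ((s - 1) * K0)"
        using K0(2)[OF s(1)] nn_integral_eq_integral[OF exp_decay_integrable[OF ew2, of 0]] by (simp add: w_def dilate_def)
      then have w0: "(LINT x|lborel. (cmod (w 0 x))\<^sup>2) \<le> (s - 1) * K0" using s K0 by simp
      have "(LINT x|lborel. (cmod (w 0 x))\<^sup>2) \<ge> 0" by simp
      then show ?thesis
        using w0 s t U F L K0 by (intro mult_mono add_mono) (auto intro!: mult_left_mono mult_nonneg_nonneg add_nonneg_nonneg)
    qed
    also have "\<dots> = (s - 1) * K" by (simp add: K_def algebra_simps)
    finally show ?thesis by (simp add: w_def)
  qed
  moreover have "K \<ge> 0" using K0 U F by (simp add: K_def)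
  ultimately show ?thesis using that by blast
qed

end

lemma tendsto_zero_of_eventually_le:
  fixes g :: "'a \<Rightarrow> real"
  assumes "\<And>e. e > 0 \<Longrightarrow> \<forall>\<^sub>F s in F. \<bar>g s\<bar> \<le> c * e"
  shows "(g \<longlongrightarrow> 0) F"
proof (rule tendstoI)
  fix e :: real assume e: "e > 0"
  define d where "d = e / (\<bar>c\<bar> + 1)"
  have d: "d > 0" using e by (simp add: d_def add_nonneg_pos)
  have "\<bar>c\<bar> * d < (\<bar>c\<bar> + 1) * d" using d by simp
  moreover have "(\<bar>c\<bar> + 1) * d = e" by (simp add: d_def add_nonneg_eq_0_iff)
  moreover have "c * d \<le> \<bar>c\<bar> * d" using d by (intro mult_right_mono) auto
  ultimately have "c * d < e" by linarith
  with assms[OF d] show "\<forall>\<^sub>F s in F. dist (g s) 0 < e"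
    by (auto elim!: eventually_mono simp: dist_real_def)
qed

lemma abs_integral_le:
  fixes g :: "real \<Rightarrow> real"
  assumes "continuous_on {0..\<tau>} g" "\<tau> \<ge> 0" "\<And>t. t \<in> {0..\<tau>} \<Longrightarrow> \<bar>g t\<bar> \<le> B"
  shows "\<bar>integral {0..\<tau>} g\<bar> \<le> B * \<tau>"
  using integral_bound[of 0 \<tau> g B] assms by auto

context decaying_nls_h1
begin

definition dilated_profile :: "real \<Rightarrow> real \<Rightarrow> real" where
  "dilated_profile s t = (LINT x|lborel. power_profile lam1 lam2 ((cmod (dilate s t x))\<^sup>2) * Re (cnj (u t x) * dilate s t x))"

definition virial_error :: "real \<Rightarrow> real \<Rightarrow> real" where
  "virial_error s t = (LINT x|lborel.
     (power_profile lam1 lam2 ((cmod (u t x))\<^sup>2) - power_profile lam1 lam2 ((cmod (dilate s t x))\<^sup>2)) * Re (cnj (u t x) * dilate s t x)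
      - (virial_profile lam1 lam2 ((cmod (u t x))\<^sup>2) - virial_profile lam1 lam2 ((cmod (dilate s t x))\<^sup>2)))"

lemma exp_decay_dilate_terms:
  assumes "s \<ge> 1"
  shows "exp_decay (\<lambda>t x. Re (cnj (u t x) * dilate s t x))"
    "exp_decay (\<lambda>t x. power_profile lam1 lam2 ((cmod (dilate s t x))\<^sup>2))"
    "exp_decay (\<lambda>t x. virial_profile lam1 lam2 ((cmod (dilate s t x))\<^sup>2))"
proof -
  show "exp_decay (\<lambda>t x. Re (cnj (u t x) * dilate s t x))"
    by (intro exp_decay_Re exp_decay_mult exp_decay_cnj exp_decay_u exp_decay_dilate assms)
  show "exp_decay (\<lambda>t x. power_profile lam1 lam2 ((cmod (dilate s t x))\<^sup>2))"
    unfolding dilate_def using exp_decay_dilated[OF exp_decay_real_profile assms] .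
  show "exp_decay (\<lambda>t x. virial_profile lam1 lam2 ((cmod (dilate s t x))\<^sup>2))"
    unfolding dilate_def using exp_decay_dilated[OF exp_decay_virial assms] .
qed

lemma continuous_dilated_profile:
  assumes "s \<ge> 1" shows "continuous_on S (dilated_profile s)" "continuous_on S (virial_error s)"
  unfolding dilated_profile_def virial_error_def
  by (intro exp_decay_integral_continuous exp_decay_mult exp_decay_diff exp_decay_dilate_terms[OF assms] exp_decay_real_profile exp_decay_virial)+

text \<open>Dilation multiplies the nonlinearity by \<open>s\<^sup>2 = 1 + (s\<^sup>2 - 1)\<close>.
  The summand 1 leaves a difference of profiles times a mixed product, which up to
  \<open>virial_error\<close> is a difference of values of \<open>virial_profile\<close>;
  \<open>1 / s ^ 3\<close> is the Jacobian of its dilated half.\<close>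

lemma dilated_pairing_integrand:
  assumes s: "s \<ge> 1"
  shows "Re (LINT x|lborel. cnj (f t x) * dilate s t x) - Re (LINT x|lborel. cnj (u t x) * (of_real (s\<^sup>2) * f (s\<^sup>2 * t) (s *\<^sub>R x)))
    = virial_integral t - 1 / s ^ 3 * virial_integral (s\<^sup>2 * t) - (s\<^sup>2 - 1) * dilated_profile s t + virial_error s t"
proof -
  have e1: "exp_decay (\<lambda>t x. cnj (f t x) * dilate s t x)" by (intro exp_decay_mult exp_decay_cnj exp_decay_f exp_decay_dilate s)
  have e2: "exp_decay (\<lambda>t x. cnj (u t x) * (of_real (s\<^sup>2) * f (s\<^sup>2 * t) (s *\<^sub>R x)))"
    by (intro exp_decay_mult[OF exp_decay_cnj[OF exp_decay_u]] exp_decay_cmult exp_decay_dilated[OF exp_decay_f s])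
  note d = exp_decay_dilate_terms[OF s]
  let ?k = "\<lambda>z. power_profile lam1 lam2 ((cmod z)\<^sup>2)" and ?v = "\<lambda>z. virial_profile lam1 lam2 ((cmod z)\<^sup>2)"
  let ?r = "\<lambda>x. Re (cnj (u t x) * dilate s t x)"
  have i: "integrable lborel (\<lambda>x. ?k (dilate s t x) * ?r x)" "integrable lborel (\<lambda>x. ?v (u t x))" "integrable lborel (\<lambda>x. ?v (dilate s t x))"
    "integrable lborel (\<lambda>x. (?k (u t x) - ?k (dilate s t x)) * ?r x - (?v (u t x) - ?v (dilate s t x)))"
    using exp_decay_integrable[OF exp_decay_mult[OF d(2) d(1)], of t] exp_decay_integrable[OF exp_decay_virial, of t] exp_decay_integrable[OF d(3), of t]
      exp_decay_integrable[OF exp_decay_diff[OF exp_decay_mult[OF exp_decay_diff[OF exp_decay_real_profile d(2)] d(1)] exp_decay_diff[OF exp_decay_virial d(3)]], of t] by auto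
  have sc: "(LINT x|lborel. ?v (dilate s t x)) = 1 / s ^ 3 * virial_integral (s\<^sup>2 * t)"
    using integral_scale[OF exp_decay_measurable[OF exp_decay_virial], of s "s\<^sup>2 * t"] s by (simp add: dilate_def virial_integral_def)
  have p1: "Re (cnj (f t x) * dilate s t x) = ?k (u t x) * ?r x" for x
    unfolding nonlinearity_def by (simp add: algebra_simps)
  have p2: "Re (cnj (u t x) * (of_real (s\<^sup>2) * f (s\<^sup>2 * t) (s *\<^sub>R x))) = s\<^sup>2 * (?k (dilate s t x) * ?r x)" for x
  proof -
    have eq: "cnj (u t x) * (of_real (s\<^sup>2) * f (s\<^sup>2 * t) (s *\<^sub>R x)) = of_real (s\<^sup>2 * ?k (dilate s t x)) * (cnj (u t x) * dilate s t x)"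
      unfolding nonlinearity_def dilate_def by simp
    have "Re (of_real c * z) = c * Re z" for c z by simp
    then show ?thesis unfolding eq by (simp only: mult.assoc)
  qed
  have "Re (LINT x|lborel. cnj (f t x) * dilate s t x) - Re (LINT x|lborel. cnj (u t x) * (of_real (s\<^sup>2) * f (s\<^sup>2 * t) (s *\<^sub>R x)))
     = (LINT x|lborel. Re (cnj (f t x) * dilate s t x) - Re (cnj (u t x) * (of_real (s\<^sup>2) * f (s\<^sup>2 * t) (s *\<^sub>R x))))"
    using exp_decay_integrable[OF e1, of t] exp_decay_integrable[OF e2, of t]
    by (simp only: integral_Re[symmetric] Bochner_Integration.integral_diff integrable_Re)
  also have "\<dots> = (LINT x|lborel. (?v (u t x) - ?v (dilate s t x)) - (s\<^sup>2 - 1) * (?k (dilate s t x) * ?r x)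
     + ((?k (u t x) - ?k (dilate s t x)) * ?r x - (?v (u t x) - ?v (dilate s t x))))"
    unfolding p1 p2 by (rule Bochner_Integration.integral_cong[OF refl]) (simp only: algebra_simps)
  also have "\<dots> = (virial_integral t - (LINT x|lborel. ?v (dilate s t x))) - (s\<^sup>2 - 1) * dilated_profile s t + virial_error s t"
    unfolding virial_integral_def dilated_profile_def virial_error_def
    using i by (simp only: Bochner_Integration.integral_add Bochner_Integration.integral_diff Bochner_Integration.integrable_diff
        integrable_mult_right integral_mult_right_zero)
  finally show ?thesis by (simp add: sc)
qed

text \<open>For the error, one of three factors \<open>cmod (dilate s t x - u t x)\<close> is
  uniformly at most \<open>e\<close>, and the remaining square integrates to order
  \<open>s - 1\<close>. It is therefore negligible against \<open>s - 1\<close>, uniformly over the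
  period.\<close>

lemma dilated_profile_close:
  obtains M where "\<And>e. e > 0 \<Longrightarrow> \<forall>\<^sub>F s in at_right 1. \<forall>t\<in>{0..\<tau>}. \<bar>dilated_profile s t - profile_integral t\<bar> \<le> M * e"
    "\<And>e. e > 0 \<Longrightarrow> \<forall>\<^sub>F s in at_right 1. \<forall>t\<in>{0..\<tau>}. \<bar>virial_error s t\<bar> \<le> M * e * (s - 1)"
proof -
  obtain U where U: "U > 0" "\<And>t x. cmod (u t x) \<le> U" using exp_decay_bounded[OF exp_decay_u] by metis
  have dU: "cmod (dilate s t x) \<le> U" for s t x using U(2) by (simp add: dilate_def)
  obtain N where N: "N \<ge> 0" 
    "\<And>a b. cmod a \<le> U \<Longrightarrow> cmod b \<le> U \<Longrightarrow> 
    \<bar>(power_profile lam1 lam2 ((cmod a)\<^sup>2) - power_profile lam1 lam2 ((cmod b)\<^sup>2)) * Re (cnj a * b)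
      - (virial_profile lam1 lam2 ((cmod a)\<^sup>2) - virial_profile lam1 lam2 ((cmod b)\<^sup>2))\<bar> \<le> N * cmod (b - a) ^ 3"
    "\<And>a b. cmod a \<le> U \<Longrightarrow> cmod b \<le> U \<Longrightarrow>
    \<bar>power_profile lam1 lam2 ((cmod b)\<^sup>2) * Re (cnj a * b) - power_profile lam1 lam2 ((cmod a)\<^sup>2) * (cmod a)\<^sup>2\<bar>
      \<le> N * (cmod a * cmod (b - a))"
    using virial_profile_increment[OF less_imp_le[OF U(1)], of lam1 lam2] by blast
  obtain B where B: "B > 0" "\<And>t. (LINT x|lborel. cmod (u t x)) \<le> B" using exp_decay_integral_bounded[OF exp_decay_u] by metis
  obtain K where K: "K \<ge> 0" "\<And>s t. 1 \<le> s \<Longrightarrow> s \<le> 2 \<Longrightarrow> 0 \<le> t \<Longrightarrow> t \<le> \<tau> \<Longrightarrow>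
     (LINT x|lborel. (cmod (dilate s t x - u t x))\<^sup>2) \<le> (s - 1) * K" using dilate_l2_close by blast
  define M where "M = N * B + N * K"
  have M: "N * B \<le> M" "N * K \<le> M" using N B K by (auto simp: M_def)
  have r: "\<forall>\<^sub>F s in at_right (1::real). 1 \<le> s \<and> s \<le> 2"
    by (auto simp: eventually_at_right_field intro!: exI[of _ 2])
  have 1: "\<forall>\<^sub>F s in at_right 1. \<forall>t\<in>{0..\<tau>}. \<bar>dilated_profile s t - profile_integral t\<bar> \<le> M * e" if e: "e > 0" for e
    using dilate_uniformly_close[OF e, of \<tau>] r
  proof eventually_elim
    case (elim s)
    show ?case
    proof
      fix t assume t: "t \<in> {0..\<tau>}"
      have s: "s \<ge> 1" using elim by simp
      let ?D = "\<lambda>x. power_profile lam1 lam2 ((cmod (dilate s t x))\<^sup>2) * Re (cnj (u t x) * dilate s t x)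
         - power_profile lam1 lam2 ((cmod (u t x))\<^sup>2) * (cmod (u t x))\<^sup>2"
      note e1 = exp_decay_mult[OF exp_decay_dilate_terms(2)[OF s] exp_decay_dilate_terms(1)[OF s]]
        and e2 = exp_decay_mult[OF exp_decay_real_profile exp_decay_sq]
      have "dilated_profile s t - profile_integral t = (LINT x|lborel. ?D x)"
        using exp_decay_integrable[OF e1, of t] exp_decay_integrable[OF e2, of t] by (simp add: dilated_profile_def profile_integral_def)
      then have "\<bar>dilated_profile s t - profile_integral t\<bar> \<le> (LINT x|lborel. \<bar>?D x\<bar>)"
        using integral_norm_bound[of lborel ?D] by simp
      also have "\<dots> \<le> (LINT x|lborel. (N * e) * cmod (u t x))"
      proof (rule integral_mono)
        show "integrable lborel (\<lambda>x. \<bar>?D x\<bar>)"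
          using exp_decay_integrable[OF e1, of t] exp_decay_integrable[OF e2, of t] by auto
        show "integrable lborel (\<lambda>x. (N * e) * cmod (u t x))"
          using exp_decay_integrable[OF exp_decay_norm[OF exp_decay_u], of t] by (intro integrable_mult_right)
        fix x
        have "\<bar>?D x\<bar> \<le> N * (cmod (u t x) * cmod (dilate s t x - u t x))" by (rule N(3)[OF U(2) dU])
        also have "\<dots> \<le> N * (cmod (u t x) * e)"
          using elim t N(1) by (intro mult_left_mono) auto
        finally show "\<bar>?D x\<bar> \<le> (N * e) * cmod (u t x)" by (simp add: mult_ac)
      qed
      also have "\<dots> \<le> (N * e) * B" using B N e by (simp add: mult_left_mono)
      also have "\<dots> \<le> M * e" using M(1) e mult_right_mono[of "N * B" M e] by (simp add: mult_ac)
      finally show "\<bar>dilated_profile s t - profile_integral t\<bar> \<le> M * e" .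
    qed
  qed
  have 2: "\<forall>\<^sub>F s in at_right 1. \<forall>t\<in>{0..\<tau>}. \<bar>virial_error s t\<bar> \<le> M * e * (s - 1)" if e: "e > 0" for e
    using dilate_uniformly_close[OF e, of \<tau>] r
  proof eventually_elim
    case (elim s)
    show ?case
    proof
      fix t assume t: "t \<in> {0..\<tau>}"
      have s: "s \<ge> 1" using elim by simp
      let ?D = "\<lambda>x. (power_profile lam1 lam2 ((cmod (u t x))\<^sup>2) - power_profile lam1 lam2 ((cmod (dilate s t x))\<^sup>2)) * Re (cnj (u t x) * dilate s t x)
        - (virial_profile lam1 lam2 ((cmod (u t x))\<^sup>2) - virial_profile lam1 lam2 ((cmod (dilate s t x))\<^sup>2))"
      have e1: "exp_decay (\<lambda>t x. (power_profile lam1 lam2 ((cmod (u t x))\<^sup>2) - power_profile lam1 lam2 ((cmod (dilate s t x))\<^sup>2)) * Re (cnj (u t x) * dilate s t x)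
        - (virial_profile lam1 lam2 ((cmod (u t x))\<^sup>2) - virial_profile lam1 lam2 ((cmod (dilate s t x))\<^sup>2)))"
        by (intro exp_decay_mult exp_decay_diff exp_decay_dilate_terms[OF s] exp_decay_real_profile exp_decay_virial)
      have e2: "exp_decay (\<lambda>t x. (cmod (dilate s t x - u t x))\<^sup>2)"
        by (intro exp_decay_power exp_decay_norm exp_decay_diff exp_decay_dilate s exp_decay_u) simp
      have "\<bar>virial_error s t\<bar> \<le> (LINT x|lborel. \<bar>?D x\<bar>)"
        unfolding virial_error_def using integral_norm_bound[of lborel ?D] by simp
      also have "\<dots> \<le> (LINT x|lborel. (N * e) * (cmod (dilate s t x - u t x))\<^sup>2)"
      proof (rule integral_mono)
        show "integrable lborel (\<lambda>x. \<bar>?D x\<bar>)" using exp_decay_integrable[OF e1, of t] by auto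
        show "integrable lborel (\<lambda>x. (N * e) * (cmod (dilate s t x - u t x))\<^sup>2)"
          using exp_decay_integrable[OF e2, of t] by (intro integrable_mult_right)
        fix x
        have "\<bar>?D x\<bar> \<le> N * cmod (dilate s t x - u t x) ^ 3" by (rule N(2)[OF U(2) dU])
        also have "\<dots> = N * (cmod (dilate s t x - u t x) * (cmod (dilate s t x - u t x))\<^sup>2)"
          by (simp add: power3_eq_cube power2_eq_square)
        also have "\<dots> \<le> N * (e * (cmod (dilate s t x - u t x))\<^sup>2)"
          using elim t N(1) by (intro mult_left_mono mult_right_mono) auto
        finally show "\<bar>?D x\<bar> \<le> (N * e) * (cmod (dilate s t x - u t x))\<^sup>2" by (simp add: mult_ac)
      qed
      also have "\<dots> \<le> (N * e) * ((s - 1) * K)" using K(2)[of s t] elim t N e by (simp add: mult_left_mono)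
      also have "\<dots> = (N * K) * (e * (s - 1))" by (simp add: mult_ac)
      also have "\<dots> \<le> M * (e * (s - 1))" using M(2) e s by (intro mult_right_mono) auto
      finally show "\<bar>virial_error s t\<bar> \<le> M * e * (s - 1)" by (simp add: mult_ac)
    qed
  qed
  show ?thesis using that 1 2 by blast
qed

text \<open>Replacing \<open>cnj (u 0 x)\<close> by its dilate turns the pairing into
  \<open>1 / s ^ 3 * Z (h s)\<close>, governed by \<open>initial_velocity\<close>. The replacement
  costs \<open>W s\<close>, at most the root of \<open>O(s - 1)\<close> times the root of
  \<open>o(s - 1)\<close> by \<open>initial_increment\<close>. The factor \<open>2 * \<tau>\<close>
  is the limit of \<open>h s / (s - 1)\<close>.\<close>

lemma boundary_term_limit:
  assumes \<tau>: "\<tau> > 0"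
  shows "((\<lambda>s. Im (LINT x|lborel. cnj (u 0 x) * (u ((s\<^sup>2 - 1) * \<tau>) (s *\<^sub>R x) - u 0 (s *\<^sub>R x))) / (s - 1)) \<longlongrightarrow>
     - 2 * \<tau> * (kinetic + profile_integral 0)) (at_right 1)"
proof -
  define h where "h s = (s\<^sup>2 - 1) * \<tau>" for s :: real
  define w where "w h x = u h x - u 0 x" for h x
  define Z where "Z h = (LINT x|lborel. cnj (u 0 x) * w h x)" for h
  define W where "W s = (LINT x|lborel. (cnj (u 0 x) - cnj (u 0 (s *\<^sub>R x))) * w (h s) (s *\<^sub>R x))" for s
  define Y where "Y h = (LINT x|lborel. (cmod (w h x))\<^sup>2)" for h
  have ew: "exp_decay w" unfolding w_def[abs_def] by (intro exp_decay_diff exp_decay_u exp_decay_time[OF exp_decay_u, of "\<lambda>_. 0"] continuous_on_const)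
  have ev: "\<forall>\<^sub>F s in at_right (1::real). 1 < s \<and> s < 2"
    by (auto simp: eventually_at_right_field intro!: exI[of _ 2])
  have hlim: "filterlim h (at_right 0) (at_right 1)"
    unfolding filterlim_at
  proof
    show "\<forall>\<^sub>F s in at_right 1. h s \<in> {0<..} \<and> h s \<noteq> 0"
      using ev
    proof eventually_elim
      case (elim s)
      then have "s\<^sup>2 - 1 > 0" using one_less_power[of s 2] by simp
      then have "h s > 0" unfolding h_def using \<tau> by (rule mult_pos_pos)
      then show ?case by simp
    qed
    have "(h \<longlongrightarrow> (1\<^sup>2 - 1) * \<tau>) (at_right 1)" unfolding h_def by (intro tendsto_intros)
    then show "(h \<longlongrightarrow> 0) (at_right 1)" by simp
  qed
  have hq: "h s = (s - 1) * ((s + 1) * \<tau>)" for s by (simp add: h_def power2_eq_square algebra_simps)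
  obtain K where K: "K \<ge> 0" "\<And>s t. 1 \<le> s \<Longrightarrow> s \<le> 2 \<Longrightarrow> 0 \<le> t \<Longrightarrow> t \<le> 0 \<Longrightarrow>
     (LINT x|lborel. (cmod (dilate s t x - u t x))\<^sup>2) \<le> (s - 1) * K" using dilate_l2_close[of 0] by blast
  have dec: "(LINT x|lborel. cnj (u 0 x) * (u (h s) (s *\<^sub>R x) - u 0 (s *\<^sub>R x))) = of_real (1 / s ^ 3) * Z (h s) + W s"
    and Wb: "cmod (W s) \<le> sqrt ((s - 1) * K) * sqrt (Y (h s))" if s: "1 < s" "s < 2" for s
  proof -
    have s1: "s \<ge> 1" using s by simp
    have ws: "exp_decay (\<lambda>t x. w t (s *\<^sub>R x))" by (rule exp_decay_scale[OF ew s1])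
    have u0: "exp_decay (\<lambda>t x. u 0 x)" by (rule exp_decay_time[OF exp_decay_u, of "\<lambda>_. 0"]) simp
    have u0s: "exp_decay (\<lambda>t x. u 0 (s *\<^sub>R x))" by (rule exp_decay_scale[OF u0 s1])
    have i1: "integrable lborel (\<lambda>x. cnj (u 0 (s *\<^sub>R x)) * w (h s) (s *\<^sub>R x))"
      using exp_decay_integrable[OF exp_decay_mult[OF exp_decay_cnj[OF u0s] ws]] .
    have i2: "integrable lborel (\<lambda>x. (cnj (u 0 x) - cnj (u 0 (s *\<^sub>R x))) * w (h s) (s *\<^sub>R x))"
      using exp_decay_integrable[OF exp_decay_mult[OF exp_decay_diff[OF exp_decay_cnj[OF u0] exp_decay_cnj[OF u0s]] ws]] .
    have sc: "(LINT x|lborel. cnj (u 0 (s *\<^sub>R x)) * w (h s) (s *\<^sub>R x)) = (1 / s ^ 3) *\<^sub>R Z (h s)"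
      using integral_scale[OF exp_decay_measurable[OF exp_decay_mult[OF exp_decay_cnj[OF u0] ew]], of s "h s"] s by (simp add: Z_def)
    have "(LINT x|lborel. cnj (u 0 x) * (u (h s) (s *\<^sub>R x) - u 0 (s *\<^sub>R x)))
       = (LINT x|lborel. cnj (u 0 (s *\<^sub>R x)) * w (h s) (s *\<^sub>R x) + (cnj (u 0 x) - cnj (u 0 (s *\<^sub>R x))) * w (h s) (s *\<^sub>R x))"
      by (rule Bochner_Integration.integral_cong[OF refl]) (simp add: w_def algebra_simps)
    also have "\<dots> = (1 / s ^ 3) *\<^sub>R Z (h s) + W s"
      unfolding W_def sc[symmetric] by (rule Bochner_Integration.integral_add[OF i1 i2])
    finally show "(LINT x|lborel. cnj (u 0 x) * (u (h s) (s *\<^sub>R x) - u 0 (s *\<^sub>R x))) = of_real (1 / s ^ 3) * Z (h s) + W s"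
      by (simp only: scaleR_conv_of_real)
    have e1: "exp_decay (\<lambda>t x. (cmod (cnj (u 0 x) - cnj (u 0 (s *\<^sub>R x))))\<^sup>2)"
      by (intro exp_decay_power exp_decay_norm exp_decay_diff exp_decay_cnj u0 u0s) simp
    have e2: "exp_decay (\<lambda>t x. (cmod (w t (s *\<^sub>R x)))\<^sup>2)" by (intro exp_decay_power exp_decay_norm ws) simp
    have "cmod (W s) \<le> sqrt (LINT x|lborel. (cmod (cnj (u 0 x) - cnj (u 0 (s *\<^sub>R x))))\<^sup>2) * sqrt (LINT x|lborel. (cmod (w (h s) (s *\<^sub>R x)))\<^sup>2)"
      unfolding W_def
      using exp_decay_measurable[OF exp_decay_diff[OF exp_decay_cnj[OF u0] exp_decay_cnj[OF u0s]]] exp_decay_measurable[OF ws] exp_decay_integrable[OF e1] exp_decay_integrable[OF e2]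
      by (intro Cauchy_Schwarz_integral(2)) auto
    also have "\<dots> \<le> sqrt ((s - 1) * K) * sqrt (Y (h s))"
    proof (intro mult_mono real_sqrt_le_mono)
      have "(cmod (cnj (u 0 x) - cnj (u 0 (s *\<^sub>R x))))\<^sup>2 = (cmod (dilate s 0 x - u 0 x))\<^sup>2" for x
        by (simp add: dilate_def norm_minus_commute flip: complex_cnj_diff)
      then show "(LINT x|lborel. (cmod (cnj (u 0 x) - cnj (u 0 (s *\<^sub>R x))))\<^sup>2) \<le> (s - 1) * K"
        using K(2)[of s 0] s by simp
      have ew2: "exp_decay (\<lambda>t x. (cmod (w t x))\<^sup>2)" by (intro exp_decay_power exp_decay_norm ew) simp
      have "(LINT x|lborel. (cmod (w (h s) (s *\<^sub>R x)))\<^sup>2) = (1 / s ^ 3) * Y (h s)"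
        using integral_scale[OF exp_decay_measurable[OF ew2], of s "h s"] s by (simp add: Y_def)
      also have "\<dots> \<le> 1 * Y (h s)"
        using s1 one_le_power[of s 3] by (intro mult_right_mono) (auto simp: Y_def divide_simps)
      finally show "(LINT x|lborel. (cmod (w (h s) (s *\<^sub>R x)))\<^sup>2) \<le> Y (h s)" by simp
    qed (use K s in auto)
    finally show "cmod (W s) \<le> sqrt ((s - 1) * K) * sqrt (Y (h s))" .
  qed
  have "((\<lambda>s. Y (h s) / h s) \<longlongrightarrow> 0) (at_right 1)"
    using filterlim_compose[OF initial_increment hlim] by (simp add: Y_def w_def)
  then have "((\<lambda>s. sqrt (K * (Y (h s) / h s * ((s + 1) * \<tau>)))) \<longlongrightarrow> sqrt (K * (0 * ((1 + 1) * \<tau>)))) (at_right 1)"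
    by (intro tendsto_intros)
  then have Ylim: "((\<lambda>s. sqrt (K * (Y (h s) / h s * ((s + 1) * \<tau>)))) \<longlongrightarrow> 0) (at_right 1)" by simp
  have Wlim: "((\<lambda>s. Im (W s) / (s - 1)) \<longlongrightarrow> 0) (at_right 1)"
  proof (rule Lim_null_comparison[OF _ Ylim])
    show "\<forall>\<^sub>F s in at_right 1. norm (Im (W s) / (s - 1)) \<le> sqrt (K * (Y (h s) / h s * ((s + 1) * \<tau>)))"
      using ev
    proof eventually_elim
      case (elim s)
      have "norm (Im (W s) / (s - 1)) \<le> cmod (W s) / (s - 1)"
        using abs_Im_le_cmod[of "W s"] elim by (simp add: divide_right_mono)
      also have "\<dots> \<le> (sqrt ((s - 1) * K) * sqrt (Y (h s))) / (s - 1)"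
        using Wb[of s] elim by (simp add: divide_right_mono)
      also have "\<dots> = sqrt (((s - 1) * K) * Y (h s)) / sqrt ((s - 1)\<^sup>2)"
        using elim by (simp add: real_sqrt_mult)
      also have "\<dots> = sqrt ((((s - 1) * K) * Y (h s)) / (s - 1)\<^sup>2)" by (rule real_sqrt_divide[symmetric])
      also have "(((s - 1) * K) * Y (h s)) / (s - 1)\<^sup>2 = K * (Y (h s) / h s * ((s + 1) * \<tau>))"
        unfolding hq using elim \<tau> by (simp add: power2_eq_square)
      finally show ?case .
    qed
  qed
  have "((\<lambda>s. Z (h s) /\<^sub>R h s) \<longlongrightarrow> - \<i> * of_real (kinetic + profile_integral 0)) (at_right 1)"
    using filterlim_compose[OF initial_velocity hlim] by (simp only: Z_def w_def profile_integral_def)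
  then have "((\<lambda>s. 1 / s ^ 3 * (Im (Z (h s) /\<^sub>R h s) * ((s + 1) * \<tau>)) + Im (W s) / (s - 1)) \<longlongrightarrow>
     1 / 1 ^ 3 * (Im (- \<i> * of_real (kinetic + profile_integral 0)) * ((1 + 1) * \<tau>)) + 0) (at_right 1)"
    by (intro tendsto_intros Wlim) auto
  then have "((\<lambda>s. 1 / s ^ 3 * (Im (Z (h s) /\<^sub>R h s) * ((s + 1) * \<tau>)) + Im (W s) / (s - 1)) \<longlongrightarrow>
     - 2 * \<tau> * (kinetic + profile_integral 0)) (at_right 1)"
    by (simp add: algebra_simps)
  then show ?thesis
  proof (rule Lim_transform_eventually)
    show "\<forall>\<^sub>F s in at_right 1. 1 / s ^ 3 * (Im (Z (h s) /\<^sub>R h s) * ((s + 1) * \<tau>)) + Im (W s) / (s - 1)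
      = Im (LINT x|lborel. cnj (u 0 x) * (u ((s\<^sup>2 - 1) * \<tau>) (s *\<^sub>R x) - u 0 (s *\<^sub>R x))) / (s - 1)"
      using ev
    proof eventually_elim
      case (elim s)
      have i: "Im (of_real (1 / s ^ 3) * Z (h s) + W s) = 1 / s ^ 3 * Im (Z (h s)) + Im (W s)"
        by (simp only: plus_complex.sel times_complex.sel Re_complex_of_real Im_complex_of_real)
      have q: "Im (Z (h s)) / (s - 1) = Im (Z (h s) /\<^sub>R h s) * ((s + 1) * \<tau>)"
        unfolding hq using elim \<tau> by (simp add: divide_simps)
      have "1 / s ^ 3 * (Im (Z (h s) /\<^sub>R h s) * ((s + 1) * \<tau>)) + Im (W s) / (s - 1) = Im (of_real (1 / s ^ 3) * Z (h s) + W s) / (s - 1)"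
        unfolding i q[symmetric] by (simp add: add_divide_distrib)
      then show ?case using dec[of s] elim unfolding h_def[symmetric] by simp
    qed
  qed
qed

lemma virial_identity:
  assumes \<tau>: "\<tau> > 0" and per: "\<And>t x. u (t + \<tau>) x = u t x"
  shows "2 * \<tau> * (kinetic + profile_integral 0 - virial_integral 0)
    + integral {0..\<tau>} (\<lambda>t. 5 * virial_integral t - 2 * profile_integral t) = 0"
proof -
  \<comment> \<open>Starting at \<open>-1\<close> makes \<open>P\<close> differentiable from both
    sides at every \<open>y \<ge> 0\<close>, including 0, so the chain rule applies at
    \<open>s\<^sup>2 * t\<close> for \<open>t \<ge> 0\<close>.\<close>
  define P where "P y = integral {-1..y} virial_integral" for y
  have dP: "(P has_real_derivative virial_integral y) (at y)" if "y > -1" for y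
  proof -
    have "(P has_real_derivative virial_integral y) (at y within {-1..y + 1})"
      unfolding P_def by (rule integral_has_real_derivative[OF continuous_virial_integral(1)]) (use that in auto)
    then show ?thesis using that by (simp add: at_within_Icc_at)
  qed
  have N0: "virial_integral \<tau> = virial_integral 0" using per[of 0] by (simp add: virial_integral_def)
  have Pint: "(virial_integral has_integral P \<tau> - P 0) {0..\<tau>}"
    by (rule fundamental_theorem_of_calculus)
      (use \<tau> in \<open>auto intro!: has_field_derivative_at_within dP simp flip: has_real_derivative_iff_has_vector_derivative\<close>)
  have Qint: "(profile_integral has_integral integral {0..\<tau>} profile_integral) {0..\<tau>}"
    by (intro integrable_integral integrable_continuous_real continuous_virial_integral)
  define A where "A s = Im (LINT x|lborel. cnj (u 0 x) * (u ((s\<^sup>2 - 1) * \<tau>) (s *\<^sub>R x) - u 0 (s *\<^sub>R x)))" for s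
  define IX where "IX s = integral {0..\<tau>} (dilated_profile s)" for s
  define IE where "IE s = integral {0..\<tau>} (virial_error s)" for s
  \<comment> \<open>The exponent 5 is 3 from the space Jacobian plus 2 from substituting
    \<open>s\<^sup>2 * t\<close> in the time integral.\<close>
  have main: "A s = (P \<tau> - P 0) - (P (s\<^sup>2 * \<tau>) - P 0) / s ^ 5 - (s\<^sup>2 - 1) * IX s + IE s" if s: "s > 1" for s
  proof -
    have s1: "s \<ge> 1" using s by simp
    have dd: "((\<lambda>t. P (s\<^sup>2 * t) / s ^ 5) has_real_derivative 1 / s ^ 3 * virial_integral (s\<^sup>2 * t)) (at t)" if "t \<ge> 0" for t
    proof -
      have "s\<^sup>2 * t > -1" using that by (smt (verit) mult_nonneg_nonneg zero_le_power2)
      have "((\<lambda>t. P (s\<^sup>2 * t)) has_real_derivative virial_integral (s\<^sup>2 * t) * s\<^sup>2) (at t)"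
        by (rule DERIV_chain2[where f=P and g="\<lambda>t. s\<^sup>2 * t", OF dP[OF \<open>s\<^sup>2 * t > -1\<close>]]) (auto intro!: derivative_eq_intros)
      from DERIV_cdivide[OF this, of "s ^ 5"]
      have "((\<lambda>t. P (s\<^sup>2 * t) / s ^ 5) has_real_derivative virial_integral (s\<^sup>2 * t) * s\<^sup>2 / s ^ 5) (at t)" .
      moreover have "virial_integral (s\<^sup>2 * t) * s\<^sup>2 / s ^ 5 = 1 / s ^ 3 * virial_integral (s\<^sup>2 * t)"
        using s by (simp add: eval_nat_numeral)
      ultimately show ?thesis by simp
    qed
    have h1: "((\<lambda>t. 1 / s ^ 3 * virial_integral (s\<^sup>2 * t)) has_integral P (s\<^sup>2 * \<tau>) / s ^ 5 - P (s\<^sup>2 * 0) / s ^ 5) {0..\<tau>}"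
    proof (rule fundamental_theorem_of_calculus)
      fix t assume "t \<in> {0..\<tau>}"
      then have "t \<ge> 0" by simp
      from has_field_derivative_at_within[OF dd[OF this]]
      show "((\<lambda>t. P (s\<^sup>2 * t) / s ^ 5) has_vector_derivative 1 / s ^ 3 * virial_integral (s\<^sup>2 * t)) (at t within {0..\<tau>})"
        unfolding has_real_derivative_iff_has_vector_derivative .
    qed (use \<tau> in simp)
    have h2: "(dilated_profile s has_integral IX s) {0..\<tau>}" "(virial_error s has_integral IE s) {0..\<tau>}"
      unfolding IX_def IE_def by (intro integrable_integral integrable_continuous_real continuous_dilated_profile s1)+
    have r: "((\<lambda>t. virial_integral t - 1 / s ^ 3 * virial_integral (s\<^sup>2 * t) - (s\<^sup>2 - 1) * dilated_profile s t + virial_error s t) has_integral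
      (P \<tau> - P 0) - (P (s\<^sup>2 * \<tau>) / s ^ 5 - P (s\<^sup>2 * 0) / s ^ 5) - (s\<^sup>2 - 1) * IX s + IE s) {0..\<tau>}"
      by (intro has_integral_add has_integral_diff Pint h1 has_integral_mult_right h2)
    \<comment> \<open>Since \<open>s\<^sup>2 * \<tau> = (s\<^sup>2 - 1) * \<tau> + \<tau>\<close>,
      periodicity of \<open>u\<close> takes the dilate at time \<open>\<tau>\<close> back to the
      small time \<open>(s\<^sup>2 - 1) * \<tau>\<close>. The dilate itself need not have period
      \<open>\<tau>\<close>, which is why a boundary term survives.\<close>
    have ut: "u \<tau> x = u 0 x" "dilate s \<tau> x = u ((s\<^sup>2 - 1) * \<tau>) (s *\<^sub>R x)" for x
      using per[of 0 x] per[of "(s\<^sup>2 - 1) * \<tau>" "s *\<^sub>R x"] by (simp_all add: dilate_def algebra_simps)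
    have e: "exp_decay (\<lambda>t x. cnj (u 0 x) * u t (s *\<^sub>R x))"
      using exp_decay_mult[OF exp_decay_time[OF exp_decay_cnj[OF exp_decay_u], of "\<lambda>_. 0"] exp_decay_scale[OF exp_decay_u s1]] by simp
    have bd: "(LINT x|lborel. cnj (u \<tau> x) * dilate s \<tau> x) - (LINT x|lborel. cnj (u 0 x) * dilate s 0 x)
       = (LINT x|lborel. cnj (u 0 x) * (u ((s\<^sup>2 - 1) * \<tau>) (s *\<^sub>R x) - u 0 (s *\<^sub>R x)))"
      unfolding ut using exp_decay_integrable[OF e] by (simp add: dilate_def right_diff_distrib)
    have "((\<lambda>t. Im (\<i> * ((LINT x|lborel. cnj (f t x) * dilate s t x) - (LINT x|lborel. cnj (u t x) * (of_real (s\<^sup>2) * f (s\<^sup>2 * t) (s *\<^sub>R x)))))) has_integral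
       Im ((LINT x|lborel. cnj (u \<tau> x) * dilate s \<tau> x) - (LINT x|lborel. cnj (u 0 x) * dilate s 0 x))) {0..\<tau>}"
      using has_integral_Im[OF weak_schrodinger_pairing[OF weak_u weak_schrodinger_scale[OF weak_u s1] less_imp_le[OF \<tau>]]]
      by (simp only: dilate_def[abs_def])
    moreover have "Im (\<i> * (z1 - z2)) = Re z1 - Re z2" for z1 z2 by simp
    ultimately have "((\<lambda>t. virial_integral t - 1 / s ^ 3 * virial_integral (s\<^sup>2 * t) - (s\<^sup>2 - 1) * dilated_profile s t + virial_error s t) has_integral A s) {0..\<tau>}"
      unfolding bd A_def by (simp only: dilated_pairing_integrand[OF s1])
    from has_integral_unique[OF this r] show ?thesis by (simp add: diff_divide_distrib)
  qed
  obtain M where M: "\<And>e. e > 0 \<Longrightarrow> \<forall>\<^sub>F s in at_right 1. \<forall>t\<in>{0..\<tau>}. \<bar>dilated_profile s t - profile_integral t\<bar> \<le> M * e"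
    "\<And>e. e > 0 \<Longrightarrow> \<forall>\<^sub>F s in at_right 1. \<forall>t\<in>{0..\<tau>}. \<bar>virial_error s t\<bar> \<le> M * e * (s - 1)"
    using dilated_profile_close[of \<tau>] by blast
  have ev: "\<forall>\<^sub>F s in at_right (1::real). 1 < s" by (auto simp: eventually_at_right_field intro!: exI[of _ 2])
  have IXlim: "((\<lambda>s. IX s - integral {0..\<tau>} profile_integral) \<longlongrightarrow> 0) (at_right 1)"
  proof (rule tendsto_zero_of_eventually_le[where c="M * \<tau>"])
    fix e :: real assume "e > 0"
    from M(1)[OF this] ev show "\<forall>\<^sub>F s in at_right 1. \<bar>IX s - integral {0..\<tau>} profile_integral\<bar> \<le> M * \<tau> * e"
    proof eventually_elim
      case (elim s)
      then have s: "s \<ge> 1" by simp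
      have "IX s - integral {0..\<tau>} profile_integral = integral {0..\<tau>} (\<lambda>t. dilated_profile s t - profile_integral t)"
        unfolding IX_def
        by (rule Henstock_Kurzweil_Integration.integral_diff[symmetric])
          (intro integrable_continuous_real continuous_dilated_profile continuous_virial_integral s)+
      also have "\<bar>\<dots>\<bar> \<le> M * e * \<tau>"
        by (rule abs_integral_le)
          (use elim \<tau> s in \<open>auto intro!: continuous_on_diff continuous_dilated_profile continuous_virial_integral\<close>)
      finally show ?case by (simp add: mult_ac)
    qed
  qed
  have IElim: "((\<lambda>s. IE s / (s - 1)) \<longlongrightarrow> 0) (at_right 1)"
  proof (rule tendsto_zero_of_eventually_le[where c="M * \<tau>"])
    fix e :: real assume "e > 0"
    from M(2)[OF this] ev show "\<forall>\<^sub>F s in at_right 1. \<bar>IE s / (s - 1)\<bar> \<le> M * \<tau> * e"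
    proof eventually_elim
      case (elim s)
      have "\<bar>IE s\<bar> \<le> M * e * (s - 1) * \<tau>"
        unfolding IE_def by (rule abs_integral_le) (use elim \<tau> in \<open>auto intro!: continuous_dilated_profile\<close>)
      then show ?case using elim by (simp add: pos_divide_le_eq mult_ac)
    qed
  qed
  \<comment> \<open>A derivative at \<open>s = 1\<close>: moving the endpoint
    \<open>s\<^sup>2 * \<tau>\<close> gives \<open>2 * \<tau> * virial_integral 0\<close>, by
    periodicity, and the denominator gives \<open>- 5\<close> times the integral of
    \<open>virial_integral\<close> over the period.\<close>
  have Dlim: "((\<lambda>s. ((P (s\<^sup>2 * \<tau>) - P 0) / s ^ 5 - (P \<tau> - P 0)) / (s - 1)) \<longlongrightarrow> 2 * \<tau> * virial_integral 0 - 5 * (P \<tau> - P 0)) (at_right 1)"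
  proof -
    have pc: "((\<lambda>s. P (s\<^sup>2 * \<tau>)) has_real_derivative virial_integral (1\<^sup>2 * \<tau>) * (2 * \<tau>)) (at 1)"
      by (rule DERIV_chain2[OF dP]) (use \<tau> in \<open>auto intro!: derivative_eq_intros\<close>)
    have "((\<lambda>s. (P (s\<^sup>2 * \<tau>) - P 0) / s ^ 5) has_real_derivative
       ((virial_integral (1\<^sup>2 * \<tau>) * (2 * \<tau>) - 0) * 1 ^ 5 - (P (1\<^sup>2 * \<tau>) - P 0) * (5 * 1 ^ 4)) / (1 ^ 5 * 1 ^ 5)) (at 1)"
      by (rule DERIV_divide DERIV_diff pc DERIV_const)+ (auto intro!: derivative_eq_intros)
    then have "((\<lambda>s. ((P (s\<^sup>2 * \<tau>) - P 0) / s ^ 5 - (P (1\<^sup>2 * \<tau>) - P 0) / 1 ^ 5) / (s - 1)) \<longlongrightarrow>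
       ((virial_integral (1\<^sup>2 * \<tau>) * (2 * \<tau>) - 0) * 1 ^ 5 - (P (1\<^sup>2 * \<tau>) - P 0) * (5 * 1 ^ 4)) / (1 ^ 5 * 1 ^ 5)) (at 1)"
      unfolding has_field_derivative_iff .
    then have "((\<lambda>s. ((P (s\<^sup>2 * \<tau>) - P 0) / s ^ 5 - (P \<tau> - P 0)) / (s - 1)) \<longlongrightarrow> 2 * \<tau> * virial_integral 0 - 5 * (P \<tau> - P 0)) (at 1)"
      by (simp add: N0 mult_ac)
    then show ?thesis by (rule filterlim_mono) (auto simp: at_le)
  qed
  have "((\<lambda>s. - (((P (s\<^sup>2 * \<tau>) - P 0) / s ^ 5 - (P \<tau> - P 0)) / (s - 1)) - (s + 1) * ((IX s - integral {0..\<tau>} profile_integral) + integral {0..\<tau>} profile_integral) + IE s / (s - 1)) \<longlongrightarrow>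
     - (2 * \<tau> * virial_integral 0 - 5 * (P \<tau> - P 0)) - (1 + 1) * (0 + integral {0..\<tau>} profile_integral) + 0) (at_right 1)"
    by (intro tendsto_intros Dlim IXlim IElim)
  moreover have "\<forall>\<^sub>F s in at_right 1. - (((P (s\<^sup>2 * \<tau>) - P 0) / s ^ 5 - (P \<tau> - P 0)) / (s - 1)) - (s + 1) * ((IX s - integral {0..\<tau>} profile_integral) + integral {0..\<tau>} profile_integral) + IE s / (s - 1) = A s / (s - 1)"
    using ev
  proof eventually_elim
    case (elim s)
    have "(s\<^sup>2 - 1) * IX s / (s - 1) = (s + 1) * IX s"
    proof -
      have eq: "(s\<^sup>2 - 1) * IX s = (s - 1) * ((s + 1) * IX s)" by (simp add: power2_eq_square algebra_simps)
      have "s - 1 \<noteq> 0" using elim by simp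
      then show ?thesis unfolding eq by (rule nonzero_mult_div_cancel_left)
    qed
    then show ?case unfolding main[OF elim] by (simp add: diff_divide_distrib add_divide_distrib)
  qed
  ultimately have "((\<lambda>s. A s / (s - 1)) \<longlongrightarrow>
     - (2 * \<tau> * virial_integral 0 - 5 * (P \<tau> - P 0)) - (1 + 1) * (0 + integral {0..\<tau>} profile_integral) + 0) (at_right 1)"
    by (rule Lim_transform_eventually)
  from tendsto_unique[OF _ this boundary_term_limit[OF \<tau>, folded A_def]]
  have "- (2 * \<tau> * virial_integral 0 - 5 * (P \<tau> - P 0)) - 2 * integral {0..\<tau>} profile_integral = - 2 * \<tau> * (kinetic + profile_integral 0)"
    by simp
  moreover have "integral {0..\<tau>} (\<lambda>t. 5 * virial_integral t - 2 * profile_integral t) = 5 * (P \<tau> - P 0) - 2 * integral {0..\<tau>} profile_integral"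
    by (intro integral_unique has_integral_diff has_integral_mult_right Pint Qint)
  ultimately show ?thesis by (simp add: algebra_simps)
qed

end

section \<open>From breathers to decaying solutions, and the two energy bounds\<close>

lemma nls_solution_equation:
  assumes "\<i> * v + l = of_real (lam1 * (cmod z)\<^sup>2) * z - of_real (lam2 * cmod z ^ 4) * z"
  shows "v = \<i> * (l - nonlinearity lam1 lam2 z)"
proof -
  have "nonlinearity lam1 lam2 z = of_real (lam1 * (cmod z)\<^sup>2) * z - of_real (lam2 * cmod z ^ 4) * z"
    by (simp add: nonlinearity_def power_profile_def left_diff_distrib flip: power_mult)
  with assms have "\<i> * v + l = nonlinearity lam1 lam2 z" by (simp only:)
  then have "\<i> * v = nonlinearity lam1 lam2 z - l" by (simp only: eq_diff_eq)
  then have "- \<i> * (\<i> * v) = - \<i> * (nonlinearity lam1 lam2 z - l)" by simp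
  then show ?thesis by (simp add: algebra_simps flip: mult.assoc)
qed

lemma breather_decaying_nls:
  assumes "breather lam1 lam2 u"
  obtains ut \<tau> where "decaying_nls lam1 lam2 u ut" "\<tau> > 0" "\<And>t x. u (t + \<tau>) x = u t x"
proof -
  from assms have sol: "nls_solution lam1 lam2 u" by (simp add: breather_def)
  from assms obtain \<tau> C \<gamma> :: real and \<alpha>' :: nat where b: "\<tau> > 0" "\<gamma> > 0" "\<And>t x. u (t + \<tau>) x = u t x"
    "\<And>x \<alpha> t. multi_order \<alpha> \<le> \<alpha>' \<Longrightarrow> cmod (multi_deriv \<alpha> (u t) x) \<le> C * exp (- \<gamma> * norm x)"
    unfolding breather_def by blast
  \<comment> \<open>The zero multi-index is admissible for every \<open>\<alpha>'\<close> and gives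
    the bound on \<open>u\<close> itself.\<close>
  have "cmod (u t x) \<le> C * exp (- \<gamma> * norm x)" for t x
    using b(4)[of 0 t x] by (simp add: multi_order_def multi_deriv_def)
  then have dec: "\<exists>C \<gamma>. \<gamma> > 0 \<and> (\<forall>t x. cmod (u t x) \<le> C * exp (- \<gamma> * norm x))" using b(2) by blast
  from sol obtain ut where ut: "\<And>t. Ck 2 (u t)" "continuous_on UNIV (\<lambda>(t, x). ut t x)"
    "\<And>t x. ((\<lambda>s. u s x) has_vector_derivative ut t x) (at t)"
    "\<And>t x. \<i> * ut t x + laplacian (u t) x =
             of_real (lam1 * (cmod (u t x))\<^sup>2) * u t x - of_real (lam2 * cmod (u t x) ^ 4) * u t x"
    unfolding nls_solution_def by blast
  have "decaying_nls lam1 lam2 u ut"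
    by unfold_locales (use ut(1-3) dec nls_solution_equation[OF ut(4)] in auto)
  with b that show ?thesis by blast
qed

context decaying_nls
begin

lemma potential_energy:
  "integrable lborel (\<lambda>x. lam1 / 2 * cmod (u t x) ^ 4 - lam2 / 3 * cmod (u t x) ^ 6)"
  "(LINT x|lborel. lam1 / 2 * cmod (u t x) ^ 4 - lam2 / 3 * cmod (u t x) ^ 6) = profile_integral t - virial_integral t"
proof -
  have eq: "lam1 / 2 * cmod (u t x) ^ 4 - lam2 / 3 * cmod (u t x) ^ 6
      = power_profile lam1 lam2 ((cmod (u t x))\<^sup>2) * (cmod (u t x))\<^sup>2 - virial_profile lam1 lam2 ((cmod (u t x))\<^sup>2)" for x
    by (simp add: power_profile_def virial_profile_def field_simps flip: power_mult power_add)
  have i: "integrable lborel (\<lambda>x. power_profile lam1 lam2 ((cmod (u t x))\<^sup>2) * (cmod (u t x))\<^sup>2)"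
    "integrable lborel (\<lambda>x. virial_profile lam1 lam2 ((cmod (u t x))\<^sup>2))"
    using exp_decay_integrable[OF exp_decay_mult[OF exp_decay_real_profile exp_decay_sq]] exp_decay_integrable[OF exp_decay_virial] by auto
  show "integrable lborel (\<lambda>x. lam1 / 2 * cmod (u t x) ^ 4 - lam2 / 3 * cmod (u t x) ^ 6)"
    unfolding eq using i by (rule Bochner_Integration.integrable_diff)
  show "(LINT x|lborel. lam1 / 2 * cmod (u t x) ^ 4 - lam2 / 3 * cmod (u t x) ^ 6) = profile_integral t - virial_integral t"
    unfolding eq profile_integral_def virial_integral_def using i by (rule Bochner_Integration.integral_diff)
qed

text \<open>The Bochner integral of a non-integrable function is \<open>0\<close>, so a nonzero energy already forces
  the gradient to be square integrable.\<close>

lemma decaying_nls_h1_of_energy: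
  assumes "energy1 lam1 lam2 (u 0) \<noteq> 0"
  shows "decaying_nls_h1 lam1 lam2 u ut"
proof unfold_locales
  let ?G = "\<lambda>x. \<Sum>j\<in>UNIV. (cmod (pdiff j (u 0) x))\<^sup>2"
  have "integrable lborel (\<lambda>x. ?G x + lam1 / 2 * cmod (u 0 x) ^ 4 - lam2 / 3 * cmod (u 0 x) ^ 6)"
    using assms not_integrable_integral_eq unfolding energy1_def by blast
  from Bochner_Integration.integrable_diff[OF this potential_energy(1)[of 0]]
  have G: "integrable lborel ?G" by (simp add: algebra_simps)
  fix j
  have [measurable]: "pdiff j (u 0) \<in> borel_measurable borel"
    by (rule borel_measurable_continuous_onI[OF Ck2D(5)[OF C2]])
  have "integrable lborel (\<lambda>x. (cmod (pdiff j (u 0) x))\<^sup>2)"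
    by (rule Bochner_Integration.integrable_bound[OF G]) (auto simp: sum_nonneg intro!: AE_I2 member_le_sum)
  then show "(\<integral>\<^sup>+x. ennreal ((cmod (pdiff j (u 0) x))\<^sup>2) \<partial>lborel) < \<infinity>"
    by (simp add: nn_integral_eq_integral)
qed

end

context decaying_nls_h1
begin

lemma energy_eq: "energy1 lam1 lam2 (u 0) = kinetic + profile_integral 0 - virial_integral 0"
proof -
  have "integrable lborel (\<lambda>x. \<Sum>j\<in>UNIV. (cmod (pdiff j (u 0) x))\<^sup>2)"
    by (intro Bochner_Integration.integrable_sum grad0_integrable)
  from Bochner_Integration.integral_add[OF this potential_energy(1)[of 0]]
  show ?thesis by (simp only: energy1_def kinetic_def potential_energy(2) add_diff_eq[symmetric])
qed

lemma kinetic_nonneg: "kinetic \<ge> 0"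
  unfolding kinetic_def by (intro Bochner_Integration.integral_nonneg sum_nonneg) auto

text \<open>The conditions on the solution are invariant under a shift of time; square integrability
  of the gradient at \<open>t0\<close> is the bound propagated forward from time 0.\<close>

lemma time_shift:
  assumes t0: "t0 \<ge> 0"
  shows "decaying_nls_h1 lam1 lam2 (\<lambda>t. u (t + t0)) (\<lambda>t. ut (t + t0))"
proof unfold_locales
  have "continuous_on UNIV (\<lambda>p::real \<times> (real^3). (fst p + t0, snd p))" by (intro continuous_intros)
  from continuous_on_compose2[OF ut_continuous this]
  show "continuous_on UNIV (\<lambda>(t, x). ut (t + t0) x)" by (simp add: split_def)
  show "((\<lambda>s. u (s + t0) x) has_vector_derivative ut (t + t0) x) (at t)" for t x
    using ut_derivative[of x "t + t0"] by (simp add: has_vector_derivative_iff_quotient add_ac)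
  show "\<exists>C \<gamma>. 0 < \<gamma> \<and> (\<forall>t x. cmod (u (t + t0) x) \<le> C * exp (- \<gamma> * norm x))" using decay by blast
  fix j
  obtain K where "\<And>j t. 0 \<le> t \<Longrightarrow> t \<le> t0 \<Longrightarrow> integrable lborel (\<lambda>x. (cmod (pdiff j (u t) x))\<^sup>2)"
    using gradient_bound[of t0] by metis
  from this[OF t0 order_refl, of j]
  show "(\<integral>\<^sup>+x. ennreal ((cmod (pdiff j (u (0 + t0)) x))\<^sup>2) \<partial>lborel) < \<infinity>"
    by (simp add: nn_integral_eq_integral)
qed (rule C2, rule equation)

text \<open>The virial identity holds from every initial time, and its integral term does not depend on
  that time; hence the energy does not either, and the potential energy never exceeds it.\<close>

lemma potential_le_energy:
  assumes \<tau>: "\<tau> > 0" and per: "\<And>t x. u (t + \<tau>) x = u t x" and t0: "0 \<le> t0" "t0 \<le> \<tau>"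
  shows "profile_integral t0 - virial_integral t0 \<le> energy1 lam1 lam2 (u 0)"
proof -
  interpret S: decaying_nls_h1 lam1 lam2 "\<lambda>t. u (t + t0)" "\<lambda>t. ut (t + t0)" by (rule time_shift[OF t0(1)])
  define g where "g t = 5 * virial_integral t - 2 * profile_integral t" for t
  have S: "S.virial_integral t = virial_integral (t + t0)" "S.profile_integral t = profile_integral (t + t0)" for t
    by (simp_all add: S.virial_integral_def virial_integral_def S.profile_integral_def profile_integral_def)
  have pg: "g (t + \<tau>) = g t" for t by (simp add: g_def virial_integral_def profile_integral_def per)
  have cg: "continuous_on X g" for X unfolding g_def by (intro continuous_intros continuous_virial_integral)
  have ig: "g integrable_on {a..b}" for a b by (rule integrable_continuous_real[OF cg])
  have per': "u (t + \<tau> + t0) x = u (t + t0) x" for t x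
    using per[of "t + t0" x] by (simp add: add_ac)
  \<comment> \<open>By periodicity the part of the shifted period beyond \<open>\<tau>\<close> folds
    back onto \<open>{0..t0}\<close>.\<close>
  have "integral {0..\<tau>} (\<lambda>t. g (t + t0)) = integral {0 + t0..\<tau> + t0} g"
    by (rule integral_shift[OF cg, unfolded o_def])
  also have "\<dots> = integral {t0..\<tau>} g + integral {\<tau>..\<tau> + t0} g"
    using Henstock_Kurzweil_Integration.integral_combine[of t0 \<tau> "\<tau> + t0" g] t0 ig by simp
  also have "integral {\<tau>..\<tau> + t0} g = integral {0..t0} (\<lambda>t. g (t + \<tau>))"
    using integral_shift[OF cg, of 0 t0 \<tau>] by (simp add: add.commute o_def)
  also have "\<dots> = integral {0..t0} g" by (simp add: pg)
  also have "integral {t0..\<tau>} g + integral {0..t0} g = integral {0..\<tau>} g"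
    using Henstock_Kurzweil_Integration.integral_combine[of 0 t0 \<tau> g] t0 ig by simp
  finally have shift: "integral {0..\<tau>} (\<lambda>t. g (t + t0)) = integral {0..\<tau>} g" .
  have "2 * \<tau> * (S.kinetic + profile_integral t0 - virial_integral t0) + integral {0..\<tau>} g = 0"
    using S.virial_identity[OF \<tau> per'] unfolding S shift[symmetric] by (simp add: g_def)
  moreover have "2 * \<tau> * energy1 lam1 lam2 (u 0) + integral {0..\<tau>} g = 0"
    using virial_identity[OF \<tau> per] unfolding energy_eq g_def .
  ultimately have "2 * \<tau> * (S.kinetic + profile_integral t0 - virial_integral t0) = 2 * \<tau> * energy1 lam1 lam2 (u 0)"
    by linarith
  then have "S.kinetic + profile_integral t0 - virial_integral t0 = energy1 lam1 lam2 (u 0)" using \<tau> by simp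
  then show ?thesis using S.kinetic_nonneg by linarith
qed

lemma focusing_energy_bound:
  assumes lam: "lam1 < 0" "lam2 < 0" and \<tau>: "\<tau> > 0" and per: "\<And>t x. u (t + \<tau>) x = u t x"
  shows "energy1 lam1 lam2 (u 0) \<le> 3 * lam1\<^sup>2 / (128 * \<bar>lam2\<bar>) * mass (u 0)"
proof -
  \<comment> \<open>The least constant for which \<open>pt\<close> holds: after division by
    \<open>\<rho>\<close> the difference of its sides is a quadratic, and this \<open>c\<close>
    makes its discriminant vanish. The double root \<open>3 * lam1 / (16 * lam2)\<close> is
    positive, both parameters being negative.\<close>
  define c where "c = 3 * lam1\<^sup>2 / (128 * \<bar>lam2\<bar>)"
  have pt: "- 2 * c * \<rho> \<le> 5 * virial_profile lam1 lam2 \<rho> - 2 * (power_profile lam1 lam2 \<rho> * \<rho>)" if "\<rho> \<ge> 0" for \<rho>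
  proof -
    have "5 * virial_profile lam1 lam2 \<rho> - 2 * (power_profile lam1 lam2 \<rho> * \<rho>) + 2 * c * \<rho>
        = - (4 * lam2 / 3) * \<rho> * (\<rho> - 3 * lam1 / (16 * lam2))\<^sup>2"
      using lam by (simp add: virial_profile_def power_profile_def c_def power2_eq_square power3_eq_cube field_simps)
    also have "\<dots> \<ge> 0" using lam that by (intro mult_nonneg_nonneg) auto
    finally show ?thesis by linarith
  qed
  have le: "- 2 * c * mass (u 0) \<le> 5 * virial_integral t - 2 * profile_integral t" if "t \<ge> 0" for t
  proof -
    have i: "integrable lborel (\<lambda>x. virial_profile lam1 lam2 ((cmod (u t x))\<^sup>2))"
      "integrable lborel (\<lambda>x. power_profile lam1 lam2 ((cmod (u t x))\<^sup>2) * (cmod (u t x))\<^sup>2)"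
      using exp_decay_integrable[OF exp_decay_virial] exp_decay_integrable[OF exp_decay_mult[OF exp_decay_real_profile exp_decay_sq]] by auto
    have "- 2 * c * mass (u t) = (LINT x|lborel. - 2 * c * (cmod (u t x))\<^sup>2)" by (simp add: mass_def)
    also have "\<dots> \<le> (LINT x|lborel. 5 * virial_profile lam1 lam2 ((cmod (u t x))\<^sup>2) - 2 * (power_profile lam1 lam2 ((cmod (u t x))\<^sup>2) * (cmod (u t x))\<^sup>2))"
      using i square_integrable_u[of t] pt by (intro integral_mono) auto
    also have "\<dots> = 5 * virial_integral t - 2 * profile_integral t"
      using i by (simp add: virial_integral_def profile_integral_def)
    finally show ?thesis using mass_conservation[OF that] by simp
  qed
  have "integral {0..\<tau>} (\<lambda>t. - 2 * c * mass (u 0)) \<le> integral {0..\<tau>} (\<lambda>t. 5 * virial_integral t - 2 * profile_integral t)"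
    by (intro integral_le integrable_continuous_real continuous_intros continuous_virial_integral) (use le in auto)
  then have "\<tau> * (- 2 * c * mass (u 0)) \<le> integral {0..\<tau>} (\<lambda>t. 5 * virial_integral t - 2 * profile_integral t)"
    using \<tau> by (simp add: mult_ac)
  then have "2 * \<tau> * energy1 lam1 lam2 (u 0) \<le> 2 * \<tau> * (c * mass (u 0))"
    using virial_identity[OF \<tau> per] unfolding energy_eq by (simp add: mult_ac)
  then have "energy1 lam1 lam2 (u 0) \<le> c * mass (u 0)"
    by (rule mult_left_le_imp_le) (use \<tau> in simp)
  then show ?thesis unfolding c_def .
qed

lemma defocusing_energy_nonneg:
  assumes lam: "lam1 > 0" and \<tau>: "\<tau> > 0" and per: "\<And>t x. u (t + \<tau>) x = u t x"
  shows "energy1 lam1 lam2 (u 0) \<ge> 0"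
proof -
  define e where "e = energy1 lam1 lam2 (u 0)"
  \<comment> \<open>The factor 4 matches the cubic terms in \<open>\<rho>\<close> on both sides;
    what is left is quadratic with the sign of \<open>lam1\<close>.\<close>
  have pt: "5 * virial_profile lam1 lam2 \<rho> - 2 * (power_profile lam1 lam2 \<rho> * \<rho>)
      \<le> 4 * (power_profile lam1 lam2 \<rho> * \<rho> - virial_profile lam1 lam2 \<rho>)" for \<rho>
  proof -
    have "4 * (power_profile lam1 lam2 \<rho> * \<rho> - virial_profile lam1 lam2 \<rho>)
       - (5 * virial_profile lam1 lam2 \<rho> - 2 * (power_profile lam1 lam2 \<rho> * \<rho>)) = 3 / 2 * lam1 * \<rho>\<^sup>2"
      by (simp add: virial_profile_def power_profile_def power2_eq_square power3_eq_cube field_simps)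
    moreover have "3 / 2 * lam1 * \<rho>\<^sup>2 \<ge> 0" using lam by simp
    ultimately show ?thesis by linarith
  qed
  have le: "5 * virial_integral t - 2 * profile_integral t \<le> 4 * e" if t: "0 \<le> t" "t \<le> \<tau>" for t
  proof -
    have i: "integrable lborel (\<lambda>x. virial_profile lam1 lam2 ((cmod (u t x))\<^sup>2))"
      "integrable lborel (\<lambda>x. power_profile lam1 lam2 ((cmod (u t x))\<^sup>2) * (cmod (u t x))\<^sup>2)"
      using exp_decay_integrable[OF exp_decay_virial] exp_decay_integrable[OF exp_decay_mult[OF exp_decay_real_profile exp_decay_sq]] by auto
    have "5 * virial_integral t - 2 * profile_integral t = (LINT x|lborel. 5 * virial_profile lam1 lam2 ((cmod (u t x))\<^sup>2) - 2 * (power_profile lam1 lam2 ((cmod (u t x))\<^sup>2) * (cmod (u t x))\<^sup>2))"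
      using i by (simp add: virial_integral_def profile_integral_def)
    also have "\<dots> \<le> (LINT x|lborel. 4 * (power_profile lam1 lam2 ((cmod (u t x))\<^sup>2) * (cmod (u t x))\<^sup>2 - virial_profile lam1 lam2 ((cmod (u t x))\<^sup>2)))"
      using i pt by (intro integral_mono) auto
    also have "\<dots> = 4 * (profile_integral t - virial_integral t)"
      using i by (simp add: virial_integral_def profile_integral_def)
    also have "\<dots> \<le> 4 * e" using potential_le_energy[OF \<tau> per t] by (simp add: e_def)
    finally show ?thesis .
  qed
  have "integral {0..\<tau>} (\<lambda>t. 5 * virial_integral t - 2 * profile_integral t) \<le> integral {0..\<tau>} (\<lambda>t. 4 * e)"
    by (intro integral_le integrable_continuous_real continuous_intros continuous_virial_integral) (use le in auto)
  then have "0 \<le> 2 * \<tau> * e + \<tau> * (4 * e)"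
    using virial_identity[OF \<tau> per] \<tau> unfolding energy_eq e_def by simp
  then have "0 \<le> (6 * \<tau>) * e" by (simp add: algebra_simps)
  then show ?thesis using \<tau> by (simp add: e_def zero_le_mult_iff)
qed

end

theorem theorem4p3:
  fixes lam1 lam2 :: real and u :: "real \<Rightarrow> real^3 \<Rightarrow> complex"
  assumes "lam1 * lam2 > 0"
    and "nls_solution lam1 lam2 u"
    and "momentum (u 0) = 0"
    and "(lam1 < 0 \<and> energy1 lam1 lam2 (u 0) > 3 * lam1\<^sup>2 / (128 * \<bar>lam2\<bar>) * mass (u 0)) \<or>
         (lam1 > 0 \<and> energy1 lam1 lam2 (u 0) < 0 \<and> weighted_momentum (u 0) > 0)"
  shows "\<not> breather lam1 lam2 u"
proof
  assume "breather lam1 lam2 u"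
  then obtain ut \<tau> where D: "decaying_nls lam1 lam2 u ut" and \<tau>: "\<tau> > 0" "\<And>t x. u (t + \<tau>) x = u t x"
    using breather_decaying_nls[of lam1 lam2 u] by blast
  interpret decaying_nls lam1 lam2 u ut by (rule D)
  have "3 * lam1\<^sup>2 / (128 * \<bar>lam2\<bar>) * mass (u 0) \<ge> 0"
    by (simp add: mass_def)
  \<comment> \<open>The threshold is nonnegative, so the energy is positive in the first case and
    negative in the second. Either way it is nonzero, which gives access to the gradient at time
    0.\<close>
  then have "energy1 lam1 lam2 (u 0) \<noteq> 0" using assms(4) by linarith
  then interpret decaying_nls_h1 lam1 lam2 u ut by (rule decaying_nls_h1_of_energy)
  show False
    using assms(4)
  proof
    assume *: "lam1 < 0 \<and> energy1 lam1 lam2 (u 0) > 3 * lam1\<^sup>2 / (128 * \<bar>lam2\<bar>) * mass (u 0)"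
    then have "lam2 < 0" using assms(1) by (simp add: zero_less_mult_iff)
    with * focusing_energy_bound[OF _ _ \<tau>] show False by fastforce
  next
    assume "lam1 > 0 \<and> energy1 lam1 lam2 (u 0) < 0 \<and> weighted_momentum (u 0) > 0"
    with defocusing_energy_nonneg[OF _ \<tau>] show False by fastforce
  qed
qed

end
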